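(* Let $R$ be a regular complete local Noetherian commutative ring of dimension $n$, and let $I=(x_1,\dots,x_t)$ be an ideal of $R$ with a chosen minimal set of generators forming a regular sequence. If $M$ is a flat $R$-module such that $M/IM$ is projective over $R/I$, then the $I$-adic completion $M_I^\wedge$ is also flat over $R$.
   Context: $M_I^\wedge=\lim_s M/I^sM$ denotes ordinary $I$-adic completion. *)

theory Defs
  imports "HOL-Algebra.Algebra" "HOL-Library.Extended_Nat"
begin

section \<open>Linear maps and quotient modules\<close>

definition module_hom ::
    "('r, 'k) ring_scheme \<Rightarrow> ('r, 'a, 'm) module_scheme \<Rightarrow> ('r, 'b, 'n) module_scheme \<Rightarrow> ('a \<Rightarrow> 'b) set"
  where "module_hom R M N =
    {f \<in> carrier M \<rightarrow> carrier N.
       (\<forall>x\<in>carrier M. \<forall>y\<in>carrier M. f (x \<oplus>\<^bsub>M\<^esub> y) = f x \<oplus>\<^bsub>N\<^esub> f y) \<and>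
       (\<forall>r\<in>carrier R. \<forall>x\<in>carrier M. f (r \<odot>\<^bsub>M\<^esub> x) = r \<odot>\<^bsub>N\<^esub> f x)}"

text \<open>The record type of modules extends that of rings; the fields \<open>mult\<close> and \<open>one\<close> play no
  role in the locale \<^locale>\<open>module\<close> and are left undefined below.\<close>

definition ring_as_module :: "('r, 'k) ring_scheme \<Rightarrow> ('r, 'r) module"
  where "ring_as_module R =
    \<lparr>carrier = carrier R, monoid.mult = undefined, one = undefined,
     ring.zero = \<zero>\<^bsub>R\<^esub>, ring.add = ring.add R, smult = monoid.mult R\<rparr>"

definition quot_module :: "('r, 'a, 'm) module_scheme \<Rightarrow> 'a set \<Rightarrow> ('r, 'a set) module"
  where "quot_module M N =
    \<lparr>carrier = a_rcosets\<^bsub>M\<^esub> N, monoid.mult = undefined, one = undefined,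
     ring.zero = N, ring.add = set_add M,
     smult = (\<lambda>r A. \<Union>x\<in>A. N +>\<^bsub>M\<^esub> (r \<odot>\<^bsub>M\<^esub> x))\<rparr>"

definition ideal_smult :: "'r set \<Rightarrow> ('r, 'a, 'm) module_scheme \<Rightarrow> 'a set"
  where "ideal_smult I M = generate (add_monoid M) {r \<odot>\<^bsub>M\<^esub> x |r x. r \<in> I \<and> x \<in> carrier M}"

text \<open>\<open>M/IM\<close> regarded as a module over the quotient ring \<open>R Quot I\<close>.\<close>

definition reduction :: "'r set \<Rightarrow> ('r, 'a, 'm) module_scheme \<Rightarrow> ('r set, 'a set) module"
  where "reduction I M =
    \<lparr>carrier = a_rcosets\<^bsub>M\<^esub> (ideal_smult I M), monoid.mult = undefined, one = undefined,
     ring.zero = ideal_smult I M, ring.add = set_add M,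
     smult = (\<lambda>A B. \<Union>r\<in>A. \<Union>x\<in>B. ideal_smult I M +>\<^bsub>M\<^esub> (r \<odot>\<^bsub>M\<^esub> x))\<rparr>"


section \<open>Adic completion\<close>

abbreviation ideal_power :: "('r, 'k) ring_scheme \<Rightarrow> 'r set \<Rightarrow> nat \<Rightarrow> 'r set"
  where "ideal_power R I s \<equiv> I [^]\<^bsub>ideals_set R\<^esub> s"

text \<open>The inverse limit of the modules \<open>M/I\<^sup>sM\<close>, realised as the compatible families of cosets.
  The transition map \<open>M/I\<^bsup>s+1\<^esup>M \<rightarrow> M/I\<^sup>sM\<close> sends a coset \<open>A\<close> to the coset \<open>I\<^sup>sM + A\<close>.\<close>

definition completion ::
    "('r, 'k) ring_scheme \<Rightarrow> 'r set \<Rightarrow> ('r, 'a, 'm) module_scheme \<Rightarrow> ('r, nat \<Rightarrow> 'a set) module"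
  where "completion R I M =
    (let Q = (\<lambda>s. quot_module M (ideal_smult (ideal_power R I s) M)) in
     \<lparr>carrier = {A. (\<forall>s. A s \<in> carrier (Q s)) \<and>
                    (\<forall>s. ideal_smult (ideal_power R I s) M <+>\<^bsub>M\<^esub> A (Suc s) = A s)},
      monoid.mult = undefined, one = undefined,
      ring.zero = (\<lambda>s. \<zero>\<^bsub>Q s\<^esub>),
      ring.add = (\<lambda>A B s. A s \<oplus>\<^bsub>Q s\<^esub> B s),
      smult = (\<lambda>r A s. r \<odot>\<^bsub>Q s\<^esub> A s)\<rparr>)"

definition completion_map ::
    "('r, 'k) ring_scheme \<Rightarrow> 'r set \<Rightarrow> ('r, 'a, 'm) module_scheme \<Rightarrow> 'a \<Rightarrow> nat \<Rightarrow> 'a set"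
  where "completion_map R I M x = (\<lambda>s. ideal_smult (ideal_power R I s) M +>\<^bsub>M\<^esub> x)"

definition adically_complete ::
    "('r, 'k) ring_scheme \<Rightarrow> 'r set \<Rightarrow> ('r, 'a, 'm) module_scheme \<Rightarrow> bool"
  where "adically_complete R I M \<longleftrightarrow>
    bij_betw (completion_map R I M) (carrier M) (carrier (completion R I M))"


section \<open>Regular local rings\<close>

definition local_ring :: "('r, 'k) ring_scheme \<Rightarrow> bool"
  where "local_ring R \<longleftrightarrow> cring R \<and> (\<exists>!m. maximalideal m R)"

definition max_ideal :: "('r, 'k) ring_scheme \<Rightarrow> 'r set"
  where "max_ideal R = (THE m. maximalideal m R)"

text \<open>A list \<open>[P\<^sub>0, \<dots>, P\<^sub>k]\<close> encodes a chain of primes of length \<open>k\<close>.\<close>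

definition krull_dim :: "('r, 'k) ring_scheme \<Rightarrow> enat"
  where "krull_dim R =
    (SUP Ps \<in> {Ps. Ps \<noteq> [] \<and> (\<forall>P\<in>set Ps. primeideal P R) \<and> sorted_wrt (\<subset>) Ps}.
       enat (length Ps - 1))"

definition min_num_generators :: "('r, 'k) ring_scheme \<Rightarrow> 'r set \<Rightarrow> nat"
  where "min_num_generators R J =
    (LEAST k. \<exists>S. S \<subseteq> carrier R \<and> finite S \<and> card S = k \<and> J = Idl\<^bsub>R\<^esub> S)"

definition regular_local_ring :: "('r, 'k) ring_scheme \<Rightarrow> bool"
  where "regular_local_ring R \<longleftrightarrow>
    noetherian_ring R \<and> local_ring R \<and>
    enat (min_num_generators R (max_ideal R)) = krull_dim R"

definition complete_local_ring :: "('r, 'k) ring_scheme \<Rightarrow> bool"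
  where "complete_local_ring R \<longleftrightarrow>
    local_ring R \<and> adically_complete R (max_ideal R) (ring_as_module R)"

definition minimal_generators :: "('r, 'k) ring_scheme \<Rightarrow> 'r set \<Rightarrow> 'r list \<Rightarrow> bool"
  where "minimal_generators R I xs \<longleftrightarrow>
    set xs \<subseteq> carrier R \<and> distinct xs \<and> I = Idl\<^bsub>R\<^esub> (set xs) \<and>
    (\<forall>S. S \<subset> set xs \<longrightarrow> Idl\<^bsub>R\<^esub> S \<noteq> I)"

text \<open>\<open>x\<^sub>i\<close> is a non-zero-divisor on \<open>R/(x\<^sub>0,\<dots>,x\<^bsub>i-1\<^esub>)\<close> for each \<open>i\<close>, and the \<open>x\<^sub>i\<close> generate a
  proper ideal.\<close>

definition regular_sequence :: "('r, 'k) ring_scheme \<Rightarrow> 'r list \<Rightarrow> bool"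
  where "regular_sequence R xs \<longleftrightarrow>
    set xs \<subseteq> carrier R \<and> Idl\<^bsub>R\<^esub> (set xs) \<noteq> carrier R \<and>
    (\<forall>i < length xs.
       let J = Idl\<^bsub>R\<^esub> (set (take i xs)); Q = R Quot J in
       \<forall>a \<in> carrier Q. (J +>\<^bsub>R\<^esub> xs ! i) \<otimes>\<^bsub>Q\<^esub> a = \<zero>\<^bsub>Q\<^esub> \<longrightarrow> a = \<zero>\<^bsub>Q\<^esub>)"


section \<open>Tensor products and flatness\<close>

definition tensor_relations ::
    "('r, 'k) ring_scheme \<Rightarrow> ('r, 'a, 'm) module_scheme \<Rightarrow> ('r, 'b, 'n) module_scheme
      \<Rightarrow> ('a \<times> 'b \<Rightarrow>\<^sub>0 int) set"
  where "tensor_relations R N M =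
    generate (free_Abelian_group (carrier N \<times> carrier M))
      ({frag_of (x \<oplus>\<^bsub>N\<^esub> x', y) - frag_of (x, y) - frag_of (x', y) |x x' y.
          x \<in> carrier N \<and> x' \<in> carrier N \<and> y \<in> carrier M} \<union>
       {frag_of (x, y \<oplus>\<^bsub>M\<^esub> y') - frag_of (x, y) - frag_of (x, y') |x y y'.
          x \<in> carrier N \<and> y \<in> carrier M \<and> y' \<in> carrier M} \<union>
       {frag_of (r \<odot>\<^bsub>N\<^esub> x, y) - frag_of (x, r \<odot>\<^bsub>M\<^esub> y) |r x y.
          r \<in> carrier R \<and> x \<in> carrier N \<and> y \<in> carrier M})"

text \<open>The underlying abelian group of \<open>N \<otimes>\<^sub>R M\<close>.\<close>

definition tensor_product ::
    "('r, 'k) ring_scheme \<Rightarrow> ('r, 'a, 'm) module_scheme \<Rightarrow> ('r, 'b, 'n) module_scheme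
      \<Rightarrow> ('a \<times> 'b \<Rightarrow>\<^sub>0 int) set monoid"
  where "tensor_product R N M =
    free_Abelian_group (carrier N \<times> carrier M) Mod tensor_relations R N M"

text \<open>The map \<open>f \<otimes> id : N \<otimes> M \<rightarrow> N' \<otimes> M\<close> induced by \<open>f : N \<rightarrow> N'\<close>, on cosets.\<close>

definition tensor_map ::
    "('r, 'k) ring_scheme \<Rightarrow> ('r, 'a, 'm) module_scheme \<Rightarrow> ('r, 'b, 'n) module_scheme
      \<Rightarrow> ('c \<Rightarrow> 'a) \<Rightarrow> ('c \<times> 'b \<Rightarrow>\<^sub>0 int) set \<Rightarrow> ('a \<times> 'b \<Rightarrow>\<^sub>0 int) set"
  where "tensor_map R N' M f A =
    (\<Union>c\<in>A. tensor_relations R N' M #>\<^bsub>free_Abelian_group (carrier N' \<times> carrier M)\<^esub>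
              frag_extend (\<lambda>(x, y). frag_of (f x, y)) c)"

text \<open>Flatness says that \<open>- \<otimes>\<^sub>R M\<close> preserves injectivity of linear maps between all modules.
  HOL cannot quantify over types inside a definition, so the type \<open>'c\<close> of the elements of the
  test modules is a parameter. A conclusion \<open>flat_module TYPE('c) R M\<close> with \<open>'c\<close> a free type
  variable is flatness against modules of every type. As an assumption, any \<open>'c\<close> in which every
  finitely generated module has an isomorphic copy suffices, because flatness can be tested on
  inclusions of finitely generated ideals into the ring. The type \<open>(nat \<Rightarrow> 'r) set\<close> is such a
  type: it contains, as cosets, all subquotients of a countable power of the ring.\<close>

definition flat_module ::
    "'c itself \<Rightarrow> ('r, 'k) ring_scheme \<Rightarrow> ('r, 'a, 'm) module_scheme \<Rightarrow> bool"
  where "flat_module _ R M \<longleftrightarrow> module R M \<and>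
    (\<forall>(N :: ('r, 'c) module) (N' :: ('r, 'c) module) f.
       module R N \<and> module R N' \<and> f \<in> module_hom R N N' \<and> inj_on f (carrier N) \<longrightarrow>
       inj_on (tensor_map R N' M f) (carrier (tensor_product R N M)))"


section \<open>Projectivity\<close>

text \<open>The lifting property against all surjections, again with the type \<open>'c\<close> of the elements of
  the test modules as a parameter. As an assumption, any \<open>'c\<close> that contains copies of \<open>P\<close> and of
  the free module on the carrier of \<open>P\<close> suffices, because a splitting of the canonical map from
  this free module to \<open>P\<close> makes \<open>P\<close> a direct summand of a free module. The type
  \<open>('p \<Rightarrow> 'r) set\<close> is such a type: it contains, as cosets, all subquotients of the power of the
  ring indexed by the elements of \<open>P\<close>.\<close>

definition projective_module ::
    "'c itself \<Rightarrow> ('r, 'k) ring_scheme \<Rightarrow> ('r, 'p, 'm) module_scheme \<Rightarrow> bool"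
  where "projective_module _ R P \<longleftrightarrow> module R P \<and>
    (\<forall>(N :: ('r, 'c) module) (N' :: ('r, 'c) module) g f.
       module R N \<and> module R N' \<and> g \<in> module_hom R N N' \<and> g ` carrier N = carrier N' \<and>
       f \<in> module_hom R P N' \<longrightarrow>
       (\<exists>h \<in> module_hom R P N. \<forall>x \<in> carrier P. g (h x) = f x))"

end

theory Submission
  imports Defs
begin

text \<open>The completion satisfies the equational criterion for flatness, which is where the proof aims: if
\<open>c\<close> is a matrix over \<open>R\<close> and \<open>z\<close> is a vector over the completion \<open>M\<^sup>^\<close> with \<open>c z = 0\<close>, then \<open>z\<close> is a
sum of tensors \<open>v \<otimes> u\<close> with \<open>v\<close> in the kernel of \<open>c\<close> over \<open>R\<close> and \<open>u \<in> M\<^sup>^\<close>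
(\<open>completion_equationally_flat\<close>). This criterion implies flatness against modules of every type,
because a tensor vanishes by virtue of finitely many bilinearity relators, and these mention only
finitely many elements of the flat module (\<open>flat_module_if_equationally_flat\<close>).

Let the columns of a matrix \<open>d\<close> generate the kernel of \<open>c\<close> in \<open>R\<^sup>p\<close>; there are finitely many
because \<open>R\<close> is Noetherian. Represent \<open>z\<close> by vectors \<open>z\<^sub>s\<close> over \<open>M\<close>, one for each power \<open>I\<^sup>s\<close>. Then \<open>c z\<^sub>s\<close>
has entries in \<open>I\<^sup>sM\<close>. If \<open>M\<close> were \<open>R\<close>, the Artin--Rees lemma would say that \<open>z\<^sub>s\<close> is congruent to an
element of the kernel of \<open>c\<close> modulo \<open>I\<^sup>b\<close>, where \<open>b\<close> grows with \<open>s\<close>. Flatness transfers this statement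
from \<open>R\<close> to \<open>M\<close> (\<open>flat_artin_rees\<close>): flatness makes \<open>M\<^sup>p \<rightarrow> M\<^sup>k/LM\<close> have kernel \<open>c\<^sup>-\<^sup>1(L)M\<close> for every
submodule \<open>L\<close> of \<open>R\<^sup>k\<close> (\<open>flat_imp_tensor_span_preimage\<close>), and \<open>I\<^sup>aM\<^sup>k\<close> is such an \<open>LM\<close>. So
\<open>z\<^sub>b\<close> is congruent to some \<open>d \<kappa>\<^sub>b\<close> modulo \<open>I\<^sup>b\<close>. The vectors \<open>\<kappa>\<^sub>b\<close> need not converge, but the differences
of the \<open>d \<kappa>\<^sub>b\<close> tend to \<open>0\<close>, and the same statement for \<open>d\<close> in place of \<open>c\<close> replaces the differences
of the \<open>\<kappa>\<^sub>b\<close> by vectors that tend to \<open>0\<close> and have the same image under \<open>d\<close>. Summing these gives a vector \<open>u\<close>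
over \<open>M\<^sup>^\<close> with \<open>z = d u\<close>, which is a sum of tensors of the required form.

Only a weak form of the Artin--Rees lemma is used, with no linear bound on the exponents
(\<open>weak_artin_rees\<close>). It has a short proof by maximality in place of Rees algebras.\<close>

section \<open>Modules and submodules\<close>

text \<open>The scalar \<open>-1\<close> provides the additive inverses.\<close>

lemma moduleI_without_inverses:
  assumes "cring R"
    and "\<And>x y. x \<in> carrier M \<Longrightarrow> y \<in> carrier M \<Longrightarrow> x \<oplus>\<^bsub>M\<^esub> y \<in> carrier M"
    and "\<zero>\<^bsub>M\<^esub> \<in> carrier M"
    and "\<And>x y z. x \<in> carrier M \<Longrightarrow> y \<in> carrier M \<Longrightarrow> z \<in> carrier M \<Longrightarrow>
           (x \<oplus>\<^bsub>M\<^esub> y) \<oplus>\<^bsub>M\<^esub> z = x \<oplus>\<^bsub>M\<^esub> (y \<oplus>\<^bsub>M\<^esub> z)"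
    and "\<And>x y. x \<in> carrier M \<Longrightarrow> y \<in> carrier M \<Longrightarrow> x \<oplus>\<^bsub>M\<^esub> y = y \<oplus>\<^bsub>M\<^esub> x"
    and "\<And>x. x \<in> carrier M \<Longrightarrow> \<zero>\<^bsub>M\<^esub> \<oplus>\<^bsub>M\<^esub> x = x"
    and "\<And>r x. r \<in> carrier R \<Longrightarrow> x \<in> carrier M \<Longrightarrow> r \<odot>\<^bsub>M\<^esub> x \<in> carrier M"
    and "\<And>r s x. r \<in> carrier R \<Longrightarrow> s \<in> carrier R \<Longrightarrow> x \<in> carrier M \<Longrightarrow>
           (r \<oplus>\<^bsub>R\<^esub> s) \<odot>\<^bsub>M\<^esub> x = r \<odot>\<^bsub>M\<^esub> x \<oplus>\<^bsub>M\<^esub> s \<odot>\<^bsub>M\<^esub> x"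
    and "\<And>r x y. r \<in> carrier R \<Longrightarrow> x \<in> carrier M \<Longrightarrow> y \<in> carrier M \<Longrightarrow>
           r \<odot>\<^bsub>M\<^esub> (x \<oplus>\<^bsub>M\<^esub> y) = r \<odot>\<^bsub>M\<^esub> x \<oplus>\<^bsub>M\<^esub> r \<odot>\<^bsub>M\<^esub> y"
    and "\<And>r s x. r \<in> carrier R \<Longrightarrow> s \<in> carrier R \<Longrightarrow> x \<in> carrier M \<Longrightarrow>
           (r \<otimes>\<^bsub>R\<^esub> s) \<odot>\<^bsub>M\<^esub> x = r \<odot>\<^bsub>M\<^esub> (s \<odot>\<^bsub>M\<^esub> x)"
    and one: "\<And>x. x \<in> carrier M \<Longrightarrow> \<one>\<^bsub>R\<^esub> \<odot>\<^bsub>M\<^esub> x = x"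
    and null: "\<And>x. x \<in> carrier M \<Longrightarrow> \<zero>\<^bsub>R\<^esub> \<odot>\<^bsub>M\<^esub> x = \<zero>\<^bsub>M\<^esub>"
  shows "module R M"
proof -
  interpret cring R by fact
  have inv: "\<exists>y \<in> carrier M. y \<oplus>\<^bsub>M\<^esub> x = \<zero>\<^bsub>M\<^esub>" if x: "x \<in> carrier M" for x
  proof
    show "(\<ominus>\<^bsub>R\<^esub> \<one>\<^bsub>R\<^esub>) \<odot>\<^bsub>M\<^esub> x \<in> carrier M" using x assms(7) by simp
    have "(\<ominus>\<^bsub>R\<^esub> \<one>\<^bsub>R\<^esub>) \<odot>\<^bsub>M\<^esub> x \<oplus>\<^bsub>M\<^esub> x = (\<ominus>\<^bsub>R\<^esub> \<one>\<^bsub>R\<^esub> \<oplus>\<^bsub>R\<^esub> \<one>\<^bsub>R\<^esub>) \<odot>\<^bsub>M\<^esub> x"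
      using assms(8)[of "\<ominus>\<^bsub>R\<^esub> \<one>\<^bsub>R\<^esub>" "\<one>\<^bsub>R\<^esub>" x] one x by simp
    also have "\<dots> = \<zero>\<^bsub>M\<^esub>" using null x by (simp add: l_neg)
    finally show "(\<ominus>\<^bsub>R\<^esub> \<one>\<^bsub>R\<^esub>) \<odot>\<^bsub>M\<^esub> x \<oplus>\<^bsub>M\<^esub> x = \<zero>\<^bsub>M\<^esub>" .
  qed
  show ?thesis
    by (intro moduleI abelian_groupI assms inv)
qed

lemma (in abelian_group) a_inv_zero [simp]: "\<ominus> \<zero> = \<zero>"
  by (rule minus_equality) auto

lemma (in module) submodule_if_closed:
  assumes "H \<subseteq> carrier M" "\<zero>\<^bsub>M\<^esub> \<in> H" "\<And>a b. a \<in> H \<Longrightarrow> b \<in> H \<Longrightarrow> a \<oplus>\<^bsub>M\<^esub> b \<in> H"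
    and s: "\<And>r a. r \<in> carrier R \<Longrightarrow> a \<in> H \<Longrightarrow> r \<odot>\<^bsub>M\<^esub> a \<in> H"
  shows "submodule H R M"
proof (rule submoduleI)
  fix a assume "a \<in> H"
  then show "\<ominus>\<^bsub>M\<^esub> a \<in> H" using s[of "\<ominus> \<one>" a] smult_l_minus[of \<one> a] assms(1) by auto
qed (use assms in auto)

lemma (in module) submodule_zero: "submodule H R M \<Longrightarrow> \<zero>\<^bsub>M\<^esub> \<in> H"
  using subgroup.one_closed[OF submodule.axioms(1)] by fastforce

lemma (in module) submodule_minus:
  "submodule H R M \<Longrightarrow> a \<in> H \<Longrightarrow> b \<in> H \<Longrightarrow> a \<ominus>\<^bsub>M\<^esub> b \<in> H"
  unfolding a_minus_def using submoduleE by metis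

lemma (in module) submodule_finsum:
  assumes "submodule H R M" "finite A" "\<And>i. i \<in> A \<Longrightarrow> f i \<in> H"
  shows "finsum M f A \<in> H"
  using assms(2,3)
proof (induction A rule: finite_induct)
  case empty
  then show ?case using submodule_zero[OF assms(1)] by simp
next
  case (insert a A)
  have "f ` insert a A \<subseteq> carrier M" using insert.prems submoduleE(1)[OF assms(1)] by auto
  then show ?case using insert submoduleE(5)[OF assms(1)] by (subst M.finsum_insert) auto
qed

lemma ring_as_module_sel [simp]:
  "carrier (ring_as_module R) = carrier R"
  "\<zero>\<^bsub>ring_as_module R\<^esub> = \<zero>\<^bsub>R\<^esub>"
  "r \<oplus>\<^bsub>ring_as_module R\<^esub> s = r \<oplus>\<^bsub>R\<^esub> s"
  "r \<odot>\<^bsub>ring_as_module R\<^esub> s = r \<otimes>\<^bsub>R\<^esub> s"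
  by (simp_all add: ring_as_module_def)

lemma a_inv_ring_as_module [simp]: "\<ominus>\<^bsub>ring_as_module R\<^esub> x = \<ominus>\<^bsub>R\<^esub> x"
  by (simp add: a_inv_def m_inv_def)

lemma module_ring_as_module: "cring R \<Longrightarrow> module R (ring_as_module R)"
proof -
  assume "cring R"
  then interpret cring R .
  show ?thesis
    by (rule moduleI_without_inverses)
      (auto simp: a_assoc m_assoc l_distr r_distr is_cring intro: a_comm)
qed

lemma finsum_of_additive:
  assumes "abelian_monoid P" "abelian_monoid Q"
    and "h \<in> carrier P \<rightarrow> carrier Q" "h \<zero>\<^bsub>P\<^esub> = \<zero>\<^bsub>Q\<^esub>"
    and "\<And>x y. x \<in> carrier P \<Longrightarrow> y \<in> carrier P \<Longrightarrow> h (x \<oplus>\<^bsub>P\<^esub> y) = h x \<oplus>\<^bsub>Q\<^esub> h y"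
    and "finite A" "f \<in> A \<rightarrow> carrier P"
  shows "h (finsum P f A) = finsum Q (\<lambda>i. h (f i)) A"
proof -
  interpret P: abelian_monoid P by fact
  interpret Q: abelian_monoid Q by fact
  show ?thesis
    using assms(6,7)
  proof (induction A rule: finite_induct)
    case empty then show ?case using assms(4) by simp
  next
    case (insert a A)
    then have "f a \<in> carrier P" "f \<in> A \<rightarrow> carrier P" "(\<lambda>i. h (f i)) \<in> A \<rightarrow> carrier Q" "h (f a) \<in> carrier Q"
      using assms(3) by auto
    then show ?case using insert assms(5) by (simp add: P.finsum_insert Q.finsum_insert)
  qed
qed

lemma finsum_delta:
  assumes "abelian_monoid G" "finite A" "a \<in> A" "x \<in> carrier G"
  shows "finsum G (\<lambda>i. if i = a then x else \<zero>\<^bsub>G\<^esub>) A = x"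
proof -
  interpret abelian_monoid G by fact
  show ?thesis using add.finprod_singleton_swap[of a A "\<lambda>_. x"] assms by simp
qed

section \<open>Quotient modules\<close>

locale quotient_module = P: module R P for R (structure) and P (structure) and K +
  assumes sub: "submodule K R P"
begin

abbreviation cls where "cls x \<equiv> K +>\<^bsub>P\<^esub> x"

abbreviation Q where "Q \<equiv> quot_module P K"

lemma K_closed: "x \<in> K \<Longrightarrow> x \<in> carrier P"
  using P.submoduleE(1)[OF sub] by blast

lemma K_zero: "\<zero>\<^bsub>P\<^esub> \<in> K"
  using subgroup.one_closed[OF submodule.axioms(1)[OF sub]] by simp

lemma K_add: "x \<in> K \<Longrightarrow> y \<in> K \<Longrightarrow> x \<oplus>\<^bsub>P\<^esub> y \<in> K"
  by (rule P.submoduleE(5)[OF sub])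

lemma K_smult: "r \<in> carrier R \<Longrightarrow> x \<in> K \<Longrightarrow> r \<odot>\<^bsub>P\<^esub> x \<in> K"
  by (rule P.submoduleE(4)[OF sub])

lemma mem_cls_iff: "x \<in> carrier P \<Longrightarrow> y \<in> cls x \<longleftrightarrow> y \<in> carrier P \<and> y \<ominus>\<^bsub>P\<^esub> x \<in> K"
proof
  assume x: "x \<in> carrier P" and "y \<in> cls x"
  then obtain k where k: "k \<in> K" "y = k \<oplus>\<^bsub>P\<^esub> x" by (auto simp: a_r_coset_def')
  then have "k \<in> carrier P" using K_closed by blast
  then show "y \<in> carrier P \<and> y \<ominus>\<^bsub>P\<^esub> x \<in> K"
    using k x by (auto simp: a_minus_def P.M.a_assoc P.M.r_neg)
next
  assume x: "x \<in> carrier P" and y: "y \<in> carrier P \<and> y \<ominus>\<^bsub>P\<^esub> x \<in> K"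
  then have "y = (y \<ominus>\<^bsub>P\<^esub> x) \<oplus>\<^bsub>P\<^esub> x" by (simp add: a_minus_def P.M.a_assoc P.M.l_neg)
  then show "y \<in> cls x" using y by (auto simp: a_r_coset_def' intro!: bexI[of _ "y \<ominus>\<^bsub>P\<^esub> x"])
qed

lemma cls_eq_iff:
  assumes "x \<in> carrier P" "y \<in> carrier P"
  shows "cls x = cls y \<longleftrightarrow> x \<ominus>\<^bsub>P\<^esub> y \<in> K"
proof
  assume "cls x = cls y"
  moreover have "x \<in> cls x" using assms mem_cls_iff K_zero by (simp add: a_minus_def P.M.r_neg)
  ultimately show "x \<ominus>\<^bsub>P\<^esub> y \<in> K" using assms mem_cls_iff by blast
next
  assume "x \<ominus>\<^bsub>P\<^esub> y \<in> K"
  then have "x \<in> cls y" using assms mem_cls_iff by blast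
  then show "cls x = cls y"
    using P.M.add.repr_independence[of x K y] assms submodule.axioms(1)[OF sub]
    unfolding a_r_coset_def by blast
qed

lemma cls_eq_zero_iff: "x \<in> carrier P \<Longrightarrow> cls x = K \<longleftrightarrow> x \<in> K"
proof -
  assume x: "x \<in> carrier P"
  have "cls \<zero>\<^bsub>P\<^esub> = K"
    using K_closed by (force simp: a_r_coset_def')
  then show ?thesis using cls_eq_iff[OF x, of "\<zero>\<^bsub>P\<^esub>"] x by (simp add: a_minus_def)
qed

lemma carrier_Q: "carrier Q = cls ` carrier P"
  by (auto simp: quot_module_def A_RCOSETS_def' )

lemma cls_zero: "cls \<zero>\<^bsub>P\<^esub> = K"
  using cls_eq_zero_iff K_zero by blast

lemma Q_zero: "\<zero>\<^bsub>Q\<^esub> = cls \<zero>\<^bsub>P\<^esub>" by (simp add: quot_module_def cls_zero)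

lemma Q_add:
  assumes "x \<in> carrier P" "y \<in> carrier P"
  shows "cls x \<oplus>\<^bsub>Q\<^esub> cls y = cls (x \<oplus>\<^bsub>P\<^esub> y)"
proof -
  have "(cls x) <+>\<^bsub>P\<^esub> (cls y) = cls (x \<oplus>\<^bsub>P\<^esub> y)"
  proof -
    interpret S: abelian_subgroup K P
      by (rule abelian_subgroupI3)
        (auto simp: additive_subgroup_def submodule.axioms(1)[OF sub] P.M.abelian_group_axioms)
    show ?thesis using assms by (rule S.a_rcos_sum)
  qed
  then show ?thesis by (simp add: quot_module_def)
qed

lemma Q_smult:
  assumes "r \<in> carrier R" "x \<in> carrier P"
  shows "r \<odot>\<^bsub>Q\<^esub> cls x = cls (r \<odot>\<^bsub>P\<^esub> x)"
proof -
  have *: "cls (r \<odot>\<^bsub>P\<^esub> y) = cls (r \<odot>\<^bsub>P\<^esub> x)" if "y \<in> cls x" for y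
  proof -
    have y: "y \<in> carrier P" "y \<ominus>\<^bsub>P\<^esub> x \<in> K" using that assms mem_cls_iff by auto
    have "r \<odot>\<^bsub>P\<^esub> y \<ominus>\<^bsub>P\<^esub> r \<odot>\<^bsub>P\<^esub> x = r \<odot>\<^bsub>P\<^esub> (y \<ominus>\<^bsub>P\<^esub> x)"
      using y assms by (simp add: a_minus_def P.smult_r_distr P.smult_r_minus)
    then show ?thesis using K_smult[OF assms(1) y(2)] y assms by (simp add: cls_eq_iff)
  qed
  have "x \<in> cls x" using assms mem_cls_iff K_zero by (simp add: a_minus_def P.M.r_neg)
  then have "cls x \<noteq> {}" by blast
  then have "(\<Union>y\<in>cls x. cls (r \<odot>\<^bsub>P\<^esub> x)) = cls (r \<odot>\<^bsub>P\<^esub> x)" by (rule UN_constant[THEN trans, OF if_not_P])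
  moreover have "(\<Union>y\<in>cls x. cls (r \<odot>\<^bsub>P\<^esub> y)) = (\<Union>y\<in>cls x. cls (r \<odot>\<^bsub>P\<^esub> x))"
    by (rule SUP_cong[OF refl *])
  ultimately have "(\<Union>y\<in>cls x. cls (r \<odot>\<^bsub>P\<^esub> y)) = cls (r \<odot>\<^bsub>P\<^esub> x)" by (rule trans[rotated])
  then show ?thesis by (simp add: quot_module_def)
qed

lemma module_Q: "module R Q"
proof (rule moduleI_without_inverses)
  show "cring R" by (rule P.R.is_cring)
  show "x \<oplus>\<^bsub>Q\<^esub> y = y \<oplus>\<^bsub>Q\<^esub> x" if "x \<in> carrier Q" "y \<in> carrier Q" for x y
  proof -
    from that obtain x' y' where "x = cls x'" "y = cls y'" "x' \<in> carrier P" "y' \<in> carrier P"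
      unfolding carrier_Q by blast
    then show ?thesis using P.M.a_comm[of x' y'] by (simp add: Q_add)
  qed
  show "x \<oplus>\<^bsub>Q\<^esub> y \<oplus>\<^bsub>Q\<^esub> z = x \<oplus>\<^bsub>Q\<^esub> (y \<oplus>\<^bsub>Q\<^esub> z)"
    if "x \<in> carrier Q" "y \<in> carrier Q" "z \<in> carrier Q" for x y z
    using that by (auto simp: carrier_Q Q_add P.M.a_assoc)
qed (auto simp: carrier_Q Q_add Q_smult Q_zero P.smult_assoc1 P.smult_l_distr P.smult_r_distr)

lemma finsum_Q:
  assumes "finite A" "f \<in> A \<rightarrow> carrier P"
  shows "finsum Q (\<lambda>i. cls (f i)) A = cls (finsum P f A)"
proof -
  interpret Q: module R Q by (rule module_Q)
  show ?thesis
    by (rule finsum_of_additive[symmetric])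
      (auto simp: carrier_Q Q_add Q_zero assms P.M.abelian_monoid_axioms Q.M.abelian_monoid_axioms)
qed

end

section \<open>Powers of a module and matrices over the ring\<close>

text \<open>Vectors are sequences that vanish from index \<open>k\<close> on. With the dimension in a bound instead of a type,
  statements can quantify over it, and \<open>R\<^sup>k\<close> has the type \<open>nat \<Rightarrow> 'r\<close>, whose sets of elements carry the
  quotients of \<open>R\<^sup>k\<close>.\<close>

definition power_module :: "nat \<Rightarrow> ('r, 'a, 'm) module_scheme \<Rightarrow> ('r, nat \<Rightarrow> 'a) module"
  where "power_module k M =
    \<lparr>carrier = {v. (\<forall>i<k. v i \<in> carrier M) \<and> (\<forall>i\<ge>k. v i = \<zero>\<^bsub>M\<^esub>)},
     monoid.mult = undefined, one = undefined,
     ring.zero = (\<lambda>_. \<zero>\<^bsub>M\<^esub>), ring.add = (\<lambda>v w i. v i \<oplus>\<^bsub>M\<^esub> w i),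
     smult = (\<lambda>r v i. r \<odot>\<^bsub>M\<^esub> v i)\<rparr>"

abbreviation free_power :: "('r, 'k) ring_scheme \<Rightarrow> nat \<Rightarrow> ('r, nat \<Rightarrow> 'r) module"
  where "free_power R k \<equiv> power_module k (ring_as_module R)"

abbreviation vecs :: "('r, 'k) ring_scheme \<Rightarrow> nat \<Rightarrow> (nat \<Rightarrow> 'r) set"
  where "vecs R k \<equiv> carrier (free_power R k)"

abbreviation mvecs :: "('r, 'a, 'm) module_scheme \<Rightarrow> nat \<Rightarrow> (nat \<Rightarrow> 'a) set"
  where "mvecs M k \<equiv> carrier (power_module k M)"

lemma power_module_sel [simp]:
  "\<zero>\<^bsub>power_module k M\<^esub> = (\<lambda>_. \<zero>\<^bsub>M\<^esub>)"
  "v \<oplus>\<^bsub>power_module k M\<^esub> w = (\<lambda>i. v i \<oplus>\<^bsub>M\<^esub> w i)"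
  "r \<odot>\<^bsub>power_module k M\<^esub> v = (\<lambda>i. r \<odot>\<^bsub>M\<^esub> v i)"
  by (simp_all add: power_module_def)

lemma mem_power_module_iff:
  "v \<in> mvecs M k \<longleftrightarrow> (\<forall>i<k. v i \<in> carrier M) \<and> (\<forall>i\<ge>k. v i = \<zero>\<^bsub>M\<^esub>)"
  by (simp add: power_module_def)

lemma module_power_module:
  assumes "module R M" shows "module R (power_module k M)"
proof -
  interpret M: module R M by fact
  have z: "\<forall>i. v i \<in> carrier M" if "v \<in> mvecs M k" for v
    using that by (metis M.M.zero_closed mem_power_module_iff not_le)
  show ?thesis
    by (rule moduleI_without_inverses)
      (auto simp: mem_power_module_iff M.M.a_assoc z M.smult_assoc1 M.smult_l_distr
          M.smult_r_distr M.R.is_cring intro!: ext M.M.a_comm dest!: z)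
qed

lemma power_module_nth:
  assumes "module R M" "v \<in> mvecs M k" shows "v i \<in> carrier M"
proof -
  interpret M: module R M by fact
  show ?thesis using assms(2) by (metis M.M.zero_closed mem_power_module_iff not_le)
qed

lemma power_module_a_inv:
  assumes "module R M" "v \<in> mvecs M k"
  shows "\<ominus>\<^bsub>power_module k M\<^esub> v = (\<lambda>i. \<ominus>\<^bsub>M\<^esub> v i)"
proof -
  interpret M: module R M by fact
  interpret P: module R "power_module k M" by (rule module_power_module) fact
  note nth = power_module_nth[OF assms]
  have w: "(\<lambda>i. \<ominus>\<^bsub>M\<^esub> v i) \<in> mvecs M k"
    using assms(2) nth by (auto simp: mem_power_module_iff)
  have "(\<lambda>i. \<ominus>\<^bsub>M\<^esub> v i) \<oplus>\<^bsub>power_module k M\<^esub> v = \<zero>\<^bsub>power_module k M\<^esub>"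
    using nth by (simp add: M.M.l_neg)
  then show ?thesis using P.M.minus_equality[OF _ assms(2) w] by simp
qed

text \<open>A matrix over \<open>R\<close> acts on vectors over every \<open>R\<close>-module; \<open>c i\<close> is its \<open>i\<close>-th column.\<close>

definition matrix_map ::
    "('r, 'a, 'm) module_scheme \<Rightarrow> nat \<Rightarrow> (nat \<Rightarrow> nat \<Rightarrow> 'r) \<Rightarrow> (nat \<Rightarrow> 'a) \<Rightarrow> nat \<Rightarrow> 'a"
  where "matrix_map M p c y = (\<lambda>l. finsum M (\<lambda>i. c i l \<odot>\<^bsub>M\<^esub> y i) {..<p})"

text \<open>The image of \<open>v \<otimes> u\<close> under the isomorphism from \<open>R\<^sup>k \<otimes> M\<close> to \<open>M\<^sup>k\<close>.\<close>

definition outer :: "('r, 'a, 'm) module_scheme \<Rightarrow> (nat \<Rightarrow> 'r) \<Rightarrow> 'a \<Rightarrow> nat \<Rightarrow> 'a"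
  where "outer M v u = (\<lambda>i. v i \<odot>\<^bsub>M\<^esub> u)"

text \<open>For a submodule \<open>K\<close> of \<open>R\<^sup>k\<close> this is \<open>KM\<close>, the image of \<open>K \<otimes> M\<close> in \<open>M\<^sup>k\<close>. As an inductive set it
  avoids finite sums of unspecified length in the proofs below.\<close>

inductive_set tensor_span :: "('r, 'a, 'm) module_scheme \<Rightarrow> (nat \<Rightarrow> 'r) set \<Rightarrow> (nat \<Rightarrow> 'a) set"
  for M K where
    zero: "(\<lambda>_. \<zero>\<^bsub>M\<^esub>) \<in> tensor_span M K"
  | add: "v \<in> K \<Longrightarrow> u \<in> carrier M \<Longrightarrow> w \<in> tensor_span M K \<Longrightarrow>
      (\<lambda>i. outer M v u i \<oplus>\<^bsub>M\<^esub> w i) \<in> tensor_span M K"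

locale matrix_module = module R M for R (structure) and M (structure)
begin

abbreviation Rm where "Rm \<equiv> ring_as_module R"

lemma module_Rm: "module R Rm" by (rule module_ring_as_module) (rule R.is_cring)

sublocale Rm: module R Rm by (rule module_Rm)

lemma module_pow: "module R (power_module k M)" by (rule module_power_module) unfold_locales

lemma module_vec: "module R (free_power R k)" by (rule module_power_module[OF module_Rm])

lemma pow_nth: "v \<in> mvecs M k \<Longrightarrow> v i \<in> carrier M"
  by (rule power_module_nth[of R]) unfold_locales

lemma vec_nth: "v \<in> vecs R k \<Longrightarrow> v i \<in> carrier R"
  using power_module_nth[OF module_Rm, of v k i] by simp

lemma pow_zero: "v \<in> mvecs M k \<Longrightarrow> k \<le> i \<Longrightarrow> v i = \<zero>\<^bsub>M\<^esub>"
  by (simp add: mem_power_module_iff)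

lemma vec_zero: "v \<in> vecs R k \<Longrightarrow> k \<le> i \<Longrightarrow> v i = \<zero>"
  by (simp add: mem_power_module_iff)

lemma pow_memI:
  "(\<And>i. i < k \<Longrightarrow> v i \<in> carrier M) \<Longrightarrow> (\<And>i. k \<le> i \<Longrightarrow> v i = \<zero>\<^bsub>M\<^esub>) \<Longrightarrow> v \<in> mvecs M k"
  by (simp add: mem_power_module_iff)

lemma vec_memI:
  "(\<And>i. i < k \<Longrightarrow> v i \<in> carrier R) \<Longrightarrow> (\<And>i. k \<le> i \<Longrightarrow> v i = \<zero>) \<Longrightarrow> v \<in> vecs R k"
  by (simp add: mem_power_module_iff)

lemma outer_closed:
  "v \<in> vecs R k \<Longrightarrow> u \<in> carrier M \<Longrightarrow> outer M v u \<in> mvecs M k"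
  by (auto simp: outer_def vec_nth vec_zero intro!: pow_memI)

lemma tensor_span_closed:
  assumes "K \<subseteq> vecs R k" "w \<in> tensor_span M K"
  shows "w \<in> mvecs M k"
proof -
  interpret P: module R "power_module k M" by (rule module_pow)
  show ?thesis using assms(2)
  proof induction
    case zero then show ?case using P.M.zero_closed by simp
  next
    case (add v u w)
    then show ?case using P.M.a_closed[OF outer_closed[of v k u] add.IH] assms(1) by auto
  qed
qed

lemma tensor_span_add:
  assumes "K \<subseteq> vecs R k" "w \<in> tensor_span M K" "w' \<in> tensor_span M K"
  shows "(\<lambda>i. w i \<oplus>\<^bsub>M\<^esub> w' i) \<in> tensor_span M K"
  using assms(2)
proof induction
  case zero
  have "w' i \<in> carrier M" for i using tensor_span_closed[OF assms(1,3)] pow_nth by blast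
  then show ?case using assms(3) by simp
next
  case (add v u w)
  have *: "w' i \<in> carrier M" "w i \<in> carrier M" "outer M v u i \<in> carrier M" for i
    using tensor_span_closed[OF assms(1)] assms(3) add outer_closed[of v k u] pow_nth assms(1)
    by blast+
  show ?case using tensor_span.add[OF add(1,2) add.IH] * by (simp add: M.a_assoc)
qed

lemma outer_in_tensor_span:
  assumes "v \<in> K" "K \<subseteq> vecs R k" "u \<in> carrier M"
  shows "outer M v u \<in> tensor_span M K"
proof -
  have "outer M v u i \<in> carrier M" for i using outer_closed[of v k u] pow_nth assms by blast
  then show ?thesis using tensor_span.add[OF assms(1,3) tensor_span.zero] by simp
qed

lemma tensor_span_uminus:
  assumes "K \<subseteq> vecs R k" "w \<in> tensor_span M K"
  shows "(\<lambda>i. \<ominus>\<^bsub>M\<^esub> w i) \<in> tensor_span M K"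
  using assms(2)
proof induction
  case zero then show ?case by (simp add: tensor_span.zero)
next
  case (add v u w)
  have *: "w i \<in> carrier M" "outer M v u i \<in> carrier M" "v i \<in> carrier R" for i
    using tensor_span_closed[OF assms(1)] add outer_closed[of v k u] pow_nth assms(1) vec_nth
    by blast+
  have "\<ominus>\<^bsub>M\<^esub> u \<in> carrier M" using add by simp
  moreover have "outer M v (\<ominus>\<^bsub>M\<^esub> u) i = \<ominus>\<^bsub>M\<^esub> (outer M v u i)" for i
    using * add by (simp add: outer_def smult_r_minus)
  ultimately show ?case using tensor_span.add[OF add(1) _ add.IH, of "\<ominus>\<^bsub>M\<^esub> u"] *
    by (simp add: M.minus_add)
qed

lemma tensor_span_mono: "K \<subseteq> L \<Longrightarrow> tensor_span M K \<subseteq> tensor_span M L"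
proof
  fix w assume "K \<subseteq> L" "w \<in> tensor_span M K"
  from this(2,1) show "w \<in> tensor_span M L"
    by induction (auto intro: tensor_span.intros)
qed

lemma submodule_tensor_span:
  assumes "submodule K R (free_power R k)"
  shows "submodule (tensor_span M K) R (power_module k M)"
proof -
  interpret P: module R "power_module k M" by (rule module_pow)
  interpret V: module R "free_power R k" by (rule module_vec)
  have K: "K \<subseteq> vecs R k" using V.submoduleE(1)[OF assms] .
  show ?thesis
  proof (rule P.submoduleI)
    show "tensor_span M K \<subseteq> mvecs M k" using tensor_span_closed[OF K] by blast
    show "\<zero>\<^bsub>power_module k M\<^esub> \<in> tensor_span M K" using tensor_span.zero by simp
    show "\<ominus>\<^bsub>power_module k M\<^esub> a \<in> tensor_span M K" if "a \<in> tensor_span M K" for a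
      using tensor_span_uminus[OF K that] tensor_span_closed[OF K that] power_module_a_inv[of R M a k]
        module_axioms by simp
    show "a \<oplus>\<^bsub>power_module k M\<^esub> b \<in> tensor_span M K" if "a \<in> tensor_span M K" "b \<in> tensor_span M K" for a b
      using tensor_span_add[OF K that] by simp
    fix r x assume r: "r \<in> carrier R" and "x \<in> tensor_span M K"
    from this(2) show "r \<odot>\<^bsub>power_module k M\<^esub> x \<in> tensor_span M K"
    proof induction
      case zero then show ?case using r tensor_span.zero by simp
    next
      case (add v u w)
      have v: "v i \<in> carrier R" and w: "w i \<in> carrier M" for i
        using add K vec_nth tensor_span_closed[OF K] pow_nth by blast+
      have "r \<odot>\<^bsub>M\<^esub> (v i \<odot>\<^bsub>M\<^esub> u) = v i \<odot>\<^bsub>M\<^esub> (r \<odot>\<^bsub>M\<^esub> u)" for i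
        using r v[of i] add(2) by (simp add: smult_assoc1[symmetric] R.m_comm)
      then have "r \<odot>\<^bsub>power_module k M\<^esub> (\<lambda>i. outer M v u i \<oplus>\<^bsub>M\<^esub> w i) =
        (\<lambda>i. outer M v (r \<odot>\<^bsub>M\<^esub> u) i \<oplus>\<^bsub>M\<^esub> (r \<odot>\<^bsub>power_module k M\<^esub> w) i)"
        using r v w add(2) by (simp add: outer_def smult_r_distr)
      then show ?case using tensor_span.add[OF add(1) _ add.IH] r add(2) by simp
    qed
  qed
qed

lemma matrix_map_closed:
  assumes "\<And>i. i < p \<Longrightarrow> c i \<in> vecs R k" "y \<in> mvecs M p"
  shows "matrix_map M p c y \<in> mvecs M k"
proof (rule pow_memI)
  show "matrix_map M p c y i \<in> carrier M" for i
    unfolding matrix_map_def using assms pow_nth vec_nth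
    by (intro M.finsum_closed) (blast intro: smult_closed)
  fix l assume l: "k \<le> l"
  have "c i l \<odot>\<^bsub>M\<^esub> y i = \<zero>\<^bsub>M\<^esub>" if "i < p" for i
    using assms(1)[OF that] assms(2) l by (simp add: vec_zero pow_nth)
  then show "matrix_map M p c y l = \<zero>\<^bsub>M\<^esub>"
    unfolding matrix_map_def using M.add.finprod_one_eqI[of "{..<p}"] by simp
qed

lemma matrix_map_add:
  assumes "\<And>i. i < p \<Longrightarrow> c i \<in> vecs R k"
    and "y \<in> mvecs M p" "y' \<in> mvecs M p"
  shows "matrix_map M p c (\<lambda>i. y i \<oplus>\<^bsub>M\<^esub> y' i) =
    (\<lambda>l. matrix_map M p c y l \<oplus>\<^bsub>M\<^esub> matrix_map M p c y' l)"
  unfolding matrix_map_def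
proof
  fix l
  have *: "c i l \<in> carrier R" "y i \<in> carrier M" "y' i \<in> carrier M" if "i < p" for i
    using assms that pow_nth vec_nth by blast+
  have "(finsum M (\<lambda>i. c i l \<odot>\<^bsub>M\<^esub> (y i \<oplus>\<^bsub>M\<^esub> y' i)) {..<p}) = (finsum M (\<lambda>i. c i l \<odot>\<^bsub>M\<^esub> y i \<oplus>\<^bsub>M\<^esub> c i l \<odot>\<^bsub>M\<^esub> y' i) {..<p})"
    using * by (intro M.finsum_cong') (auto simp: smult_r_distr)
  also have "\<dots> = (finsum M (\<lambda>i. c i l \<odot>\<^bsub>M\<^esub> y i) {..<p}) \<oplus>\<^bsub>M\<^esub> (finsum M (\<lambda>i. c i l \<odot>\<^bsub>M\<^esub> y' i) {..<p})"
    using * by (intro M.finsum_addf) auto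
  finally show "(finsum M (\<lambda>i. c i l \<odot>\<^bsub>M\<^esub> (y i \<oplus>\<^bsub>M\<^esub> y' i)) {..<p}) = \<dots>" .
qed

lemma (in matrix_module) matrix_map_smult:
  assumes "\<And>i. i < p \<Longrightarrow> c i \<in> vecs R k" "y \<in> mvecs M p" "r \<in> carrier R"
  shows "matrix_map M p c (\<lambda>i. r \<odot>\<^bsub>M\<^esub> y i) = (\<lambda>l. r \<odot>\<^bsub>M\<^esub> matrix_map M p c y l)"
proof
  fix l
  have *: "c i l \<in> carrier R" "y i \<in> carrier M" if "i < p" for i
    using assms that pow_nth vec_nth by blast+
  have "r \<odot>\<^bsub>M\<^esub> matrix_map M p c y l = finsum M (\<lambda>i. r \<odot>\<^bsub>M\<^esub> (c i l \<odot>\<^bsub>M\<^esub> y i)) {..<p}"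
    unfolding matrix_map_def using * assms(3) by (intro finsum_smult_ldistr) auto
  also have "\<dots> = finsum M (\<lambda>i. c i l \<odot>\<^bsub>M\<^esub> (r \<odot>\<^bsub>M\<^esub> y i)) {..<p}"
    using * assms(3) by (intro M.finsum_cong') (auto simp: smult_assoc1[symmetric] R.m_comm)
  finally show "matrix_map M p c (\<lambda>i. r \<odot>\<^bsub>M\<^esub> y i) l = r \<odot>\<^bsub>M\<^esub> matrix_map M p c y l"
    by (simp add: matrix_map_def)
qed

lemma (in matrix_module) matrix_map_minus:
  assumes c: "\<And>i. i < p \<Longrightarrow> c i \<in> vecs R k"
    and "y \<in> mvecs M p" "y' \<in> mvecs M p"
  shows "matrix_map M p c (\<lambda>i. y i \<ominus>\<^bsub>M\<^esub> y' i) l = matrix_map M p c y l \<ominus>\<^bsub>M\<^esub> matrix_map M p c y' l"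
proof -
  have y'n: "y' i \<in> carrier M" for i using pow_nth[OF assms(3)] .
  have n: "(\<lambda>i. (\<ominus> \<one>) \<odot>\<^bsub>M\<^esub> y' i) = (\<lambda>i. \<ominus>\<^bsub>M\<^esub> y' i)"
    using y'n smult_l_minus[of \<one>] by auto
  have nc: "(\<lambda>i. \<ominus>\<^bsub>M\<^esub> y' i) \<in> mvecs M p"
    using y'n pow_zero[OF assms(3)] by (intro pow_memI) auto
  have "matrix_map M p c (\<lambda>i. \<ominus>\<^bsub>M\<^esub> y' i) l = (\<ominus> \<one>) \<odot>\<^bsub>M\<^esub> matrix_map M p c y' l"
    using matrix_map_smult[where r = "\<ominus> \<one>", OF c assms(3)] n by simp
  also have "\<dots> = \<ominus>\<^bsub>M\<^esub> matrix_map M p c y' l"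
    using pow_nth[OF matrix_map_closed[OF c assms(3)], where i = l] smult_l_minus[of \<one>] by simp
  finally show ?thesis
    using matrix_map_add[OF c assms(2) nc] by (simp add: a_minus_def)
qed

lemma matrix_map_outer:
  assumes "\<And>i. i < p \<Longrightarrow> c i \<in> vecs R k"
    and "v \<in> vecs R p" "u \<in> carrier M"
  shows "matrix_map M p c (outer M v u) = outer M (matrix_map Rm p c v) u"
proof
  fix l
  have *: "c i l \<in> carrier R" "v i \<in> carrier R" if "i < p" for i
    using assms that vec_nth by blast+
  have "(matrix_map Rm p c v l) \<odot>\<^bsub>M\<^esub> u = (finsum M (\<lambda>i. (c i l \<otimes> v i) \<odot>\<^bsub>M\<^esub> u) {..<p})"
    unfolding matrix_map_def using * assms(3)
    by (subst finsum_of_additive[where h = "\<lambda>r. r \<odot>\<^bsub>M\<^esub> u" and P = Rm and Q = M])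
      (auto simp: smult_l_distr Rm.abelian_monoid_axioms M.abelian_monoid_axioms)
  also have "\<dots> = (finsum M (\<lambda>i. c i l \<odot>\<^bsub>M\<^esub> outer M v u i) {..<p})"
    using * assms(3) by (intro M.finsum_cong') (auto simp: smult_assoc1 outer_def)
  finally show "matrix_map M p c (outer M v u) l = outer M (matrix_map Rm p c v) u l"
    by (simp add: matrix_map_def outer_def)
qed

lemma matrix_map_Suc:
  assumes "\<And>i. i < Suc p \<Longrightarrow> c i \<in> vecs R k" "\<And>i. i < Suc p \<Longrightarrow> y i \<in> carrier M"
  shows "matrix_map M (Suc p) c y = (\<lambda>i. outer M (c p) (y p) i \<oplus>\<^bsub>M\<^esub> matrix_map M p c y i)"
proof
  fix l
  have *: "c i l \<in> carrier R" "y i \<in> carrier M" if "i < Suc p" for i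
    using assms that vec_nth by blast+
  show "matrix_map M (Suc p) c y l = outer M (c p) (y p) l \<oplus>\<^bsub>M\<^esub> matrix_map M p c y l"
    unfolding matrix_map_def lessThan_Suc outer_def
    using * by (subst M.finsum_insert) auto
qed

lemma matrix_map_in_tensor_span:
  assumes "\<And>i. i < p \<Longrightarrow> c i \<in> K" "K \<subseteq> vecs R k" "\<And>i. i < p \<Longrightarrow> y i \<in> carrier M"
  shows "matrix_map M p c y \<in> tensor_span M K"
  using assms
proof (induction p)
  case 0
  then show ?case using tensor_span.zero by (simp add: matrix_map_def)
next
  case (Suc p)
  then show ?case by (subst matrix_map_Suc[of p c k y]) (auto intro!: tensor_span.add)
qed

lemma matrix_map_tensor_span_kernel:
  assumes "\<And>i. i < p \<Longrightarrow> c i \<in> vecs R k"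
    and "w \<in> tensor_span M {v \<in> vecs R p. matrix_map Rm p c v = (\<lambda>_. \<zero>)}"
  shows "matrix_map M p c w = (\<lambda>_. \<zero>\<^bsub>M\<^esub>)"
  using assms(2)
proof induction
  case zero
  show ?case unfolding matrix_map_def
  proof
    fix l
    have "c i l \<odot>\<^bsub>M\<^esub> \<zero>\<^bsub>M\<^esub> = \<zero>\<^bsub>M\<^esub>" if "i < p" for i
      using assms(1)[OF that] by (simp add: vec_nth)
    then show "(finsum M (\<lambda>i. c i l \<odot>\<^bsub>M\<^esub> \<zero>\<^bsub>M\<^esub>) {..<p}) = \<zero>\<^bsub>M\<^esub>"
      using M.add.finprod_one_eqI[of "{..<p}"] by simp
  qed
next
  case (add v u w)
  then have "w \<in> mvecs M p" "outer M v u \<in> mvecs M p"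
    using tensor_span_closed[of "{v \<in> vecs R p. matrix_map Rm p c v = (\<lambda>_. \<zero>)}" p w]
      outer_closed[of v p u] by auto
  moreover have "matrix_map M p c (outer M v u) = (\<lambda>_. \<zero>\<^bsub>M\<^esub>)"
    using add by (subst matrix_map_outer[OF assms(1)]) (auto simp: outer_def)
  ultimately show ?case
    using add by (subst matrix_map_add[OF assms(1)]) auto
qed

text \<open>The map \<open>K \<otimes> M \<rightarrow> M\<^sup>k\<close> and the surjection \<open>R\<^sup>p \<rightarrow> K\<close> given by generators have a composite with the image \<open>KM\<close>,
  so that elements of \<open>KM\<close> are combinations of a fixed list of vectors.\<close>

lemma tensor_span_image:
  assumes "\<And>i. i < p \<Longrightarrow> c i \<in> vecs R k"
    and "w \<in> tensor_span M (matrix_map Rm p c ` vecs R p)"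
  shows "\<exists>y \<in> mvecs M p. w = matrix_map M p c y"
  using assms(2)
proof induction
  case zero
  have "matrix_map M p c (\<lambda>_. \<zero>\<^bsub>M\<^esub>) = (\<lambda>_. \<zero>\<^bsub>M\<^esub>)"
    by (rule matrix_map_tensor_span_kernel[OF assms(1) tensor_span.zero])
  moreover have "(\<lambda>_. \<zero>\<^bsub>M\<^esub>) \<in> mvecs M p" by (auto intro: pow_memI)
  ultimately show ?case by metis
next
  case (add v u w)
  then obtain y a where y: "y \<in> mvecs M p" "w = matrix_map M p c y"
    and a: "a \<in> vecs R p" "v = matrix_map Rm p c a" by auto
  interpret P: module R "power_module p M" by (rule module_pow)
  have o: "outer M a u \<in> mvecs M p" using a add outer_closed by blast
  show ?case
  proof
    show "(\<lambda>i. outer M a u i \<oplus>\<^bsub>M\<^esub> y i) \<in> mvecs M p"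
      using P.M.a_closed[OF o y(1)] by simp
    show "(\<lambda>i. outer M v u i \<oplus>\<^bsub>M\<^esub> w i) = matrix_map M p c (\<lambda>i. outer M a u i \<oplus>\<^bsub>M\<^esub> y i)"
      using o y a add by (subst matrix_map_add[OF assms(1)]) (auto simp: matrix_map_outer[OF assms(1)])
  qed
qed

lemma (in matrix_module) submodule_preimage:
  assumes c: "\<And>i. i < p \<Longrightarrow> c i \<in> vecs R k" and L: "submodule L R (power_module k M)"
  shows "submodule {y \<in> mvecs M p. matrix_map M p c y \<in> L} R (power_module p M)"
proof -
  let ?H = "{y \<in> mvecs M p. matrix_map M p c y \<in> L}"
  interpret P: module R "power_module p M" by (rule module_pow)
  interpret T: module R "power_module k M" by (rule module_pow)
  note L' = T.submoduleE[OF L]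
  have add: "matrix_map M p c (\<lambda>i. y i \<oplus>\<^bsub>M\<^esub> y' i) = (\<lambda>l. matrix_map M p c y l \<oplus>\<^bsub>M\<^esub> matrix_map M p c y' l)"
    if "y \<in> mvecs M p" "y' \<in> mvecs M p" for y y'
    using matrix_map_add[OF c that] by simp
  have sm: "matrix_map M p c (\<lambda>i. r \<odot>\<^bsub>M\<^esub> y i) = (\<lambda>l. r \<odot>\<^bsub>M\<^esub> matrix_map M p c y l)"
    if "y \<in> mvecs M p" "r \<in> carrier R" for y r
    using matrix_map_smult[OF c that] by simp
  have zc: "(\<lambda>_. \<zero>\<^bsub>M\<^esub>) \<in> mvecs M p" by (auto intro: pow_memI)
  have z: "matrix_map M p c (\<lambda>_. \<zero>\<^bsub>M\<^esub>) = \<zero>\<^bsub>power_module k M\<^esub>"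
  proof -
    have "matrix_map M p c (\<lambda>_. \<zero>\<^bsub>M\<^esub>) l \<in> carrier M" for l
      by (rule pow_nth[OF matrix_map_closed[OF c zc]])
    then show ?thesis using sm[OF zc R.zero_closed] by simp
  qed
  have smc: "r \<odot>\<^bsub>power_module p M\<^esub> x \<in> ?H"
    if "r \<in> carrier R" "x \<in> ?H" for r x
    using P.smult_closed[of r x] that sm[of x r] L'(4)[of r "matrix_map M p c x"] by auto
  show ?thesis
  proof (rule P.submodule_if_closed)
    show "\<zero>\<^bsub>power_module p M\<^esub> \<in> ?H"
      using zc z T.submodule_zero[OF L] by simp
    fix x y assume x: "x \<in> ?H"
    assume y: "y \<in> ?H"
    show "x \<oplus>\<^bsub>power_module p M\<^esub> y \<in> ?H"
      using P.M.a_closed[of x y] x y add[of x y] L'(5)[of "matrix_map M p c x" "matrix_map M p c y"] by auto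
  qed (use smc in auto)
qed

lemma (in matrix_module) submodule_matrix_map_image:
  assumes c: "\<And>i. i < p \<Longrightarrow> c i \<in> vecs R k" and H: "submodule H R (power_module p M)"
  shows "submodule (matrix_map M p c ` H) R (power_module k M)"
proof -
  interpret P: module R "power_module p M" by (rule module_pow)
  interpret T: module R "power_module k M" by (rule module_pow)
  note H' = P.submoduleE[OF H]
  have car: "y \<in> mvecs M p" if "y \<in> H" for y using that H'(1) by blast
  show ?thesis
  proof (rule T.submodule_if_closed)
    show "matrix_map M p c ` H \<subseteq> mvecs M k"
      using matrix_map_closed[OF c] car by auto
    have "matrix_map M p c (\<lambda>_. \<zero>\<^bsub>M\<^esub>) = (\<lambda>_. \<zero>\<^bsub>M\<^esub>)"
      by (rule matrix_map_tensor_span_kernel[OF c tensor_span.zero])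
    then show "\<zero>\<^bsub>power_module k M\<^esub> \<in> matrix_map M p c ` H"
      using P.submodule_zero[OF H] by (auto intro!: image_eqI[of _ _ "\<lambda>_. \<zero>\<^bsub>M\<^esub>"])
    fix a b assume "a \<in> matrix_map M p c ` H"
    then obtain y where y: "a = matrix_map M p c y" "y \<in> H" by blast
    {
      assume "b \<in> matrix_map M p c ` H"
      then obtain y' where y': "b = matrix_map M p c y'" "y' \<in> H" by blast
      show "a \<oplus>\<^bsub>power_module k M\<^esub> b \<in> matrix_map M p c ` H"
        using matrix_map_add[OF c car[OF y(2)] car[OF y'(2)]] H'(5)[OF y(2) y'(2)] y y'
        by (auto intro!: image_eqI[of _ _ "\<lambda>i. y i \<oplus>\<^bsub>M\<^esub> y' i"])
    }
    fix r assume r: "r \<in> carrier R"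
    show "r \<odot>\<^bsub>power_module k M\<^esub> a \<in> matrix_map M p c ` H"
      using matrix_map_smult[OF c car[OF y(2)] r] H'(4)[OF r y(2)] y
      by (auto intro!: image_eqI[of _ _ "\<lambda>i. r \<odot>\<^bsub>M\<^esub> y i"])
  qed
qed

definition unit_vec where "unit_vec (i::nat) = (\<lambda>j. if j = i then \<one> else \<zero>)"

lemma unit_vec_closed: "i < k \<Longrightarrow> unit_vec i \<in> vecs R k"
  by (auto simp: unit_vec_def intro!: vec_memI)

lemma matrix_map_unit_vec:
  assumes "\<And>i. i < p \<Longrightarrow> c i \<in> vecs R k" "i < p"
  shows "matrix_map Rm p c (unit_vec i) = c i"
proof
  fix l
  have "matrix_map Rm p c (unit_vec i) l = finsum Rm (\<lambda>j. if j = i then c i l else \<zero>\<^bsub>Rm\<^esub>) {..<p}"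
    unfolding matrix_map_def using assms(1) vec_nth[OF assms(1)]
    by (intro Rm.M.finsum_cong') (auto simp: unit_vec_def)
  also have "\<dots> = c i l"
    using assms vec_nth[OF assms(1)] Rm.M.abelian_monoid_axioms by (intro finsum_delta) auto
  finally show "matrix_map Rm p c (unit_vec i) l = c i l" .
qed

lemma finsum_power_module_nth:
  assumes "finite A" "f \<in> A \<rightarrow> mvecs M k"
  shows "finsum (power_module k M) f A l = finsum M (\<lambda>i. f i l) A"
proof -
  interpret P: module R "power_module k M" by (rule module_pow)
  show ?thesis
    using assms M.abelian_monoid_axioms P.M.abelian_monoid_axioms
    by (intro finsum_of_additive[where h = "\<lambda>v. v l"]) (auto intro: pow_nth)
qed

lemma finsum_outer_unit_vec:
  assumes "y \<in> mvecs M p"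
  shows "finsum (power_module p M) (\<lambda>i. outer M (unit_vec i) (y i)) {..<p} = y"
proof
  fix l
  have o: "outer M (unit_vec i) (y i) \<in> mvecs M p" if "i < p" for i
    using that assms by (intro outer_closed unit_vec_closed pow_nth)
  have "finsum (power_module p M) (\<lambda>i. outer M (unit_vec i) (y i)) {..<p} l =
    finsum M (\<lambda>i. outer M (unit_vec i) (y i) l) {..<p}"
    using o by (intro finsum_power_module_nth) auto
  also have "\<dots> = finsum M (\<lambda>i. if i = l then y l else \<zero>\<^bsub>M\<^esub>) {..<p}"
    using assms pow_nth by (intro M.finsum_cong') (auto simp: outer_def unit_vec_def)
  also have "\<dots> = y l"
  proof (cases "l < p")
    case True then show ?thesis using assms pow_nth M.abelian_monoid_axioms by (intro finsum_delta) auto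
  next
    case False
    then have "finsum M (\<lambda>i. if i = l then y l else \<zero>\<^bsub>M\<^esub>) {..<p} = finsum M (\<lambda>i. \<zero>\<^bsub>M\<^esub>) {..<p}"
      by (intro M.finsum_cong') auto
    then show ?thesis using pow_zero[OF assms, of l] False by simp
  qed
  finally show "finsum (power_module p M) (\<lambda>i. outer M (unit_vec i) (y i)) {..<p} l = y l" .
qed

lemma (in matrix_module) finsum_unit_vec:
  assumes "v \<in> vecs R k"
  shows "finsum (free_power R k) (\<lambda>i. v i \<odot>\<^bsub>free_power R k\<^esub> unit_vec i) {..<k} = v"
proof -
  interpret V: matrix_module R Rm by unfold_locales
  interpret P: module R "free_power R k" by (rule module_vec)
  have "finsum (free_power R k) (\<lambda>i. outer Rm (unit_vec i) (v i)) {..<k} = v"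
    using V.finsum_outer_unit_vec[OF assms] by simp
  moreover have "finsum (free_power R k) (\<lambda>i. v i \<odot>\<^bsub>free_power R k\<^esub> unit_vec i) {..<k} =
      finsum (free_power R k) (\<lambda>i. outer Rm (unit_vec i) (v i)) {..<k}"
  proof (rule P.M.finsum_cong'[OF refl])
    show "(\<lambda>i. outer Rm (unit_vec i) (v i)) \<in> {..<k} \<rightarrow> vecs R k"
      using assms vec_nth V.outer_closed unit_vec_closed by auto
  qed (use assms vec_nth in \<open>auto simp: outer_def unit_vec_def R.m_comm\<close>)
  ultimately show ?thesis by simp
qed

text \<open>The row of a matrix that expresses the relation \<open>w\<^sub>a = r w\<^sub>b + s w\<^sub>b\<^sub>'\<close>. The indices may coincide, which is
  why the row is a combination of unit vectors and not a case distinction.\<close>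

lemma (in matrix_module) finsum_unit_vec_combination:
  assumes "a < q" "b < q" "b' < q" "r \<in> carrier R" "s \<in> carrier R" "\<And>j. j < q \<Longrightarrow> w j \<in> carrier M"
  shows "finsum M (\<lambda>j. (unit_vec a j \<oplus> \<ominus> (r \<otimes> unit_vec b j \<oplus> s \<otimes> unit_vec b' j)) \<odot>\<^bsub>M\<^esub> w j) {..<q} =
    w a \<oplus>\<^bsub>M\<^esub> \<ominus>\<^bsub>M\<^esub> (r \<odot>\<^bsub>M\<^esub> w b \<oplus>\<^bsub>M\<^esub> s \<odot>\<^bsub>M\<^esub> w b')"
proof -
  let ?d = "\<lambda>r a j. if j = a then r \<odot>\<^bsub>M\<^esub> w a else \<zero>\<^bsub>M\<^esub>"
  have 1: "finsum M (?d r a) {..<q} = r \<odot>\<^bsub>M\<^esub> w a" if "a < q" "r \<in> carrier R" for a r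
    using that assms M.abelian_monoid_axioms by (intro finsum_delta) auto
  have "finsum M (\<lambda>j. (unit_vec a j \<oplus> \<ominus> (r \<otimes> unit_vec b j \<oplus> s \<otimes> unit_vec b' j)) \<odot>\<^bsub>M\<^esub> w j) {..<q} =
    finsum M (\<lambda>j. ?d \<one> a j \<oplus>\<^bsub>M\<^esub> (?d (\<ominus> r) b j \<oplus>\<^bsub>M\<^esub> ?d (\<ominus> s) b' j)) {..<q}"
    using assms
    by (intro M.finsum_cong') (auto simp: unit_vec_def smult_l_distr smult_l_minus R.minus_add)
  also have "\<dots> = finsum M (?d \<one> a) {..<q} \<oplus>\<^bsub>M\<^esub> (finsum M (?d (\<ominus> r) b) {..<q} \<oplus>\<^bsub>M\<^esub> finsum M (?d (\<ominus> s) b') {..<q})"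
    using assms by (subst M.finsum_addf, auto)+
  also have "\<dots> = w a \<oplus>\<^bsub>M\<^esub> \<ominus>\<^bsub>M\<^esub> (r \<odot>\<^bsub>M\<^esub> w b \<oplus>\<^bsub>M\<^esub> s \<odot>\<^bsub>M\<^esub> w b')"
    using assms by (simp add: 1 smult_l_minus M.minus_add)
  finally show ?thesis .
qed

end

section \<open>Relations between tensors\<close>

lemma keys_frag_of_diff:
  "a \<in> S \<Longrightarrow> b \<in> S \<Longrightarrow> Poly_Mapping.keys (frag_of a - frag_of b) \<subseteq> S"
  using keys_diff[of "frag_of a" "frag_of b"] by auto

lemma keys_frag_of_diff3:
  "a \<in> S \<Longrightarrow> b \<in> S \<Longrightarrow> c \<in> S \<Longrightarrow> Poly_Mapping.keys (frag_of a - frag_of b - frag_of c) \<subseteq> S"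
  using keys_diff[of "frag_of a - frag_of b" "frag_of c"] keys_frag_of_diff[of a S b] by auto

text \<open>Tensors are handled as elements of the free Abelian group \<open>F\<close> modulo the subgroup \<open>rel\<close>, and not as cosets:
  the addition of \<open>F\<close> is that of a type class, and all identities become memberships in \<open>rel\<close>.\<close>

locale tensor_setup = N: module R N + M: matrix_module R M
  for R (structure) and N (structure) and M (structure)
begin

abbreviation rel where "rel \<equiv> tensor_relations R N M"

abbreviation F where "F \<equiv> free_Abelian_group (carrier N \<times> carrier M)"

abbreviation supported where
  "supported t \<equiv> Poly_Mapping.keys t \<subseteq> carrier N \<times> carrier M"

abbreviation relators where "relators \<equiv>
      {frag_of (x \<oplus>\<^bsub>N\<^esub> x', y) - frag_of (x, y) - frag_of (x', y) |x x' y.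
          x \<in> carrier N \<and> x' \<in> carrier N \<and> y \<in> carrier M} \<union>
       {frag_of (x, y \<oplus>\<^bsub>M\<^esub> y') - frag_of (x, y) - frag_of (x, y') |x y y'.
          x \<in> carrier N \<and> y \<in> carrier M \<and> y' \<in> carrier M} \<union>
       {frag_of (r \<odot>\<^bsub>N\<^esub> x, y) - frag_of (x, r \<odot>\<^bsub>M\<^esub> y) |r x y.
          r \<in> carrier R \<and> x \<in> carrier N \<and> y \<in> carrier M}"

lemma rel_subgroup: "subgroup rel F"
  unfolding tensor_relations_def
proof (rule group.generate_is_subgroup[OF group_free_Abelian_group], goal_cases)
  case 1
  show ?case
  proof
    fix t assume "t \<in> relators"
    then show "t \<in> carrier F"
      unfolding carrier_free_Abelian_group_iff
      by (elim UnE CollectE exE conjE; hypsubst)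
        (intro keys_frag_of_diff3 keys_frag_of_diff; simp)+
  qed
qed

lemma rel_zero: "0 \<in> rel"
  using subgroup.one_closed[OF rel_subgroup] by simp

lemma rel_add: "a \<in> rel \<Longrightarrow> b \<in> rel \<Longrightarrow> a + b \<in> rel"
  using subgroup.m_closed[OF rel_subgroup] by simp

lemma rel_keys: "a \<in> rel \<Longrightarrow> supported a"
  using subgroup.mem_carrier[OF rel_subgroup] by simp

lemma rel_uminus: "a \<in> rel \<Longrightarrow> - a \<in> rel"
  using subgroup.m_inv_closed[OF rel_subgroup] rel_keys by simp

lemma rel_diff: "a \<in> rel \<Longrightarrow> b \<in> rel \<Longrightarrow> a - b \<in> rel"
  using rel_add[OF _ rel_uminus] by simp

lemma rel_cong: "a - b \<in> rel \<Longrightarrow> b \<in> rel \<longleftrightarrow> a \<in> rel"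
  using rel_add[of "a - b" b] rel_diff[of a "a - b"] by auto

lemma rel_trans: "a - b \<in> rel \<Longrightarrow> b - c \<in> rel \<Longrightarrow> a - c \<in> rel"
  using rel_add[of "a - b" "b - c"] by simp

lemma rel_sum: "(\<And>i. i \<in> A \<Longrightarrow> f i \<in> rel) \<Longrightarrow> sum f A \<in> rel"
  by (induction A rule: infinite_finite_induct) (auto intro: rel_zero rel_add)

lemma rel_add_left:
  "x \<in> carrier N \<Longrightarrow> x' \<in> carrier N \<Longrightarrow> y \<in> carrier M \<Longrightarrow>
    frag_of (x \<oplus>\<^bsub>N\<^esub> x', y) - frag_of (x, y) - frag_of (x', y) \<in> rel"
  unfolding tensor_relations_def by (rule generate.incl) auto

lemma rel_add_right:
  "x \<in> carrier N \<Longrightarrow> y \<in> carrier M \<Longrightarrow> y' \<in> carrier M \<Longrightarrow>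
    frag_of (x, y \<oplus>\<^bsub>M\<^esub> y') - frag_of (x, y) - frag_of (x, y') \<in> rel"
  unfolding tensor_relations_def by (rule generate.incl) auto

lemma rel_smult:
  "r \<in> carrier R \<Longrightarrow> x \<in> carrier N \<Longrightarrow> y \<in> carrier M \<Longrightarrow>
    frag_of (r \<odot>\<^bsub>N\<^esub> x, y) - frag_of (x, r \<odot>\<^bsub>M\<^esub> y) \<in> rel"
  unfolding tensor_relations_def by (rule generate.incl) auto

lemma rel_left_zero: "y \<in> carrier M \<Longrightarrow> frag_of (\<zero>\<^bsub>N\<^esub>, y) \<in> rel"
  using rel_uminus[OF rel_add_left[of "\<zero>\<^bsub>N\<^esub>" "\<zero>\<^bsub>N\<^esub>" y]] by simp

lemma rel_right_zero: "x \<in> carrier N \<Longrightarrow> frag_of (x, \<zero>\<^bsub>M\<^esub>) \<in> rel"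
  using rel_uminus[OF rel_add_right[of x "\<zero>\<^bsub>M\<^esub>" "\<zero>\<^bsub>M\<^esub>"]] by simp

lemma rel_left_uminus:
  assumes "x \<in> carrier N" "y \<in> carrier M"
  shows "frag_of (\<ominus>\<^bsub>N\<^esub> x, y) + frag_of (x, y) \<in> rel"
  using rel_diff[OF rel_left_zero[OF assms(2)] rel_add_left[of "\<ominus>\<^bsub>N\<^esub> x" x y]] assms
  by (simp add: N.M.l_neg add.commute)

lemma mem_coset_iff: "x \<in> rel #>\<^bsub>F\<^esub> s \<longleftrightarrow> x - s \<in> rel"
  by (auto simp: r_coset_def intro!: bexI[of _ "x - s"])

lemma coset_eq_iff: "rel #>\<^bsub>F\<^esub> s = rel #>\<^bsub>F\<^esub> t \<longleftrightarrow> s - t \<in> rel"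
proof
  show "s - t \<in> rel" if "rel #>\<^bsub>F\<^esub> s = rel #>\<^bsub>F\<^esub> t"
    using that mem_coset_iff[of s s] mem_coset_iff[of s t] rel_zero by simp
  assume st: "s - t \<in> rel"
  then have ts: "t - s \<in> rel" using rel_uminus by fastforce
  show "rel #>\<^bsub>F\<^esub> s = rel #>\<^bsub>F\<^esub> t"
    using rel_trans[OF _ st] rel_trans[OF _ ts] by (auto simp: mem_coset_iff)
qed

definition pure_sum where "pure_sum (k::nat) n m = (\<Sum>i<k. frag_of (n i, m i))"

lemma pure_sum_keys:
  "(\<And>i. i < k \<Longrightarrow> n i \<in> carrier N) \<Longrightarrow> (\<And>i. i < k \<Longrightarrow> m i \<in> carrier M) \<Longrightarrow>
    supported (pure_sum k n m)"
  using sum_closed_free_Abelian_group[of "{..<k}" "\<lambda>i. frag_of (n i, m i)" "carrier N \<times> carrier M"]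
  by (simp add: pure_sum_def)

lemma pure_sum_add:
  assumes "\<And>i. i < k \<Longrightarrow> n i \<in> carrier N" "\<And>i. i < k \<Longrightarrow> m i \<in> carrier M"
    "\<And>i. i < k \<Longrightarrow> m' i \<in> carrier M"
  shows "pure_sum k n (\<lambda>i. m i \<oplus>\<^bsub>M\<^esub> m' i) - (pure_sum k n m + pure_sum k n m') \<in> rel"
proof -
  have "pure_sum k n (\<lambda>i. m i \<oplus>\<^bsub>M\<^esub> m' i) - (pure_sum k n m + pure_sum k n m') =
    (\<Sum>i<k. frag_of (n i, m i \<oplus>\<^bsub>M\<^esub> m' i) - frag_of (n i, m i) - frag_of (n i, m' i))"
    by (simp add: pure_sum_def sum_subtractf)
  also have "\<dots> \<in> rel" using assms by (intro rel_sum rel_add_right) auto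
  finally show ?thesis .
qed

lemma pure_sum_outer:
  assumes "\<And>i. i < k \<Longrightarrow> n i \<in> carrier N" "\<And>i. i < k \<Longrightarrow> v i \<in> carrier R" "u \<in> carrier M"
  shows "pure_sum k n (outer M v u) - frag_of (finsum N (\<lambda>i. v i \<odot>\<^bsub>N\<^esub> n i) {..<k}, u) \<in> rel"
  using assms(1,2)
proof (induction k)
  case 0
  then show ?case using rel_uminus[OF rel_left_zero[OF assms(3)]] by (simp add: pure_sum_def)
next
  case (Suc k)
  let ?s = "\<lambda>k. finsum N (\<lambda>i. v i \<odot>\<^bsub>N\<^esub> n i) {..<k}"
  have s: "?s k \<in> carrier N" using Suc by (intro N.M.finsum_closed) auto
  have e: "?s (Suc k) = v k \<odot>\<^bsub>N\<^esub> n k \<oplus>\<^bsub>N\<^esub> ?s k"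
    unfolding lessThan_Suc using Suc.prems by (subst N.M.finsum_insert) auto
  have 1: "frag_of (v k \<odot>\<^bsub>N\<^esub> n k, u) - frag_of (n k, v k \<odot>\<^bsub>M\<^esub> u) \<in> rel"
    using Suc.prems assms(3) by (intro rel_smult) auto
  have 2: "frag_of (?s (Suc k), u) - frag_of (v k \<odot>\<^bsub>N\<^esub> n k, u) - frag_of (?s k, u) \<in> rel"
    unfolding e using Suc.prems assms(3) s by (intro rel_add_left) auto
  have 3: "pure_sum k n (outer M v u) - frag_of (?s k, u) \<in> rel" using Suc by auto
  have "pure_sum (Suc k) n (outer M v u) - frag_of (?s (Suc k), u) =
    (pure_sum k n (outer M v u) - frag_of (?s k, u))
    - (frag_of (?s (Suc k), u) - frag_of (v k \<odot>\<^bsub>N\<^esub> n k, u) - frag_of (?s k, u))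
    - (frag_of (v k \<odot>\<^bsub>N\<^esub> n k, u) - frag_of (n k, v k \<odot>\<^bsub>M\<^esub> u))"
    by (simp add: pure_sum_def outer_def)
  then show ?case using rel_diff[OF rel_diff[OF 3 2] 1] by metis
qed

text \<open>The easy half of the description of vanishing tensors: if \<open>m = v\<^sub>1 \<otimes> u\<^sub>1 + \<dots>\<close> with vectors \<open>v\<^sub>j\<close> that annihilate
  \<open>n\<close>, then \<open>\<Sum>\<^sub>i n\<^sub>i \<otimes> m\<^sub>i\<close> collects to \<open>\<Sum>\<^sub>j (\<Sum>\<^sub>i v\<^sub>j\<^sub>i n\<^sub>i) \<otimes> u\<^sub>j = 0\<close>. The converse holds over an equationally flat \<open>M\<close>
  (\<open>equational_vanishing\<close> below).\<close>

lemma pure_sum_tensor_span: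
  assumes n: "\<And>i. i < k \<Longrightarrow> n i \<in> carrier N"
    and K: "K \<subseteq> vecs R k"
      "\<And>v. v \<in> K \<Longrightarrow> finsum N (\<lambda>i. v i \<odot>\<^bsub>N\<^esub> n i) {..<k} = \<zero>\<^bsub>N\<^esub>"
    and m: "m \<in> tensor_span M K"
  shows "pure_sum k n m \<in> rel"
  using m
proof induction
  case zero
  then show ?case unfolding pure_sum_def using n by (intro rel_sum rel_right_zero) auto
next
  case (add v u w)
  have v: "v \<in> vecs R k" using add K by auto
  have w: "w \<in> mvecs M k" using add M.tensor_span_closed[OF K(1)] by blast
  have o: "outer M v u \<in> mvecs M k" using v add M.outer_closed by blast
  have "pure_sum k n (outer M v u) \<in> rel"
    using pure_sum_outer[of k n v u] n v add K(2)[of v] M.vec_nth rel_left_zero[of u] rel_cong by metis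
  then have "pure_sum k n (outer M v u) + pure_sum k n w \<in> rel"
    using add rel_add by blast
  then show ?case using pure_sum_add[of k n "outer M v u" w] n o w M.pow_nth rel_cong by blast
qed

text \<open>The scalars of a matrix move across the tensor sign.\<close>

lemma pure_sum_matrix_map:
  assumes n: "\<And>l. l < k \<Longrightarrow> n l \<in> carrier N"
    and "\<And>i. i < p \<Longrightarrow> c i \<in> vecs R k" "\<And>i. i < p \<Longrightarrow> y i \<in> carrier M"
  shows "pure_sum p (\<lambda>i. finsum N (\<lambda>l. c i l \<odot>\<^bsub>N\<^esub> n l) {..<k}) y
    - pure_sum k n (matrix_map M p c y) \<in> rel"
  using assms(2,3)
proof (induction p)
  case 0
  show ?case unfolding pure_sum_def matrix_map_def using n
    by (auto intro!: rel_uminus rel_sum rel_right_zero)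
next
  case (Suc p)
  have cl: "matrix_map M p c y l \<in> carrier M" for l
    unfolding matrix_map_def using Suc.prems M.vec_nth
    by (intro M.M.finsum_closed) (blast intro: M.smult_closed less_SucI)
  have o: "outer M (c p) (y p) l \<in> carrier M" for l
    unfolding outer_def using Suc.prems M.vec_nth by blast
  have e: "matrix_map M (Suc p) c y = (\<lambda>i. outer M (c p) (y p) i \<oplus>\<^bsub>M\<^esub> matrix_map M p c y i)"
    using Suc.prems by (intro M.matrix_map_Suc) auto
  let ?g = "\<lambda>i. finsum N (\<lambda>l. c i l \<odot>\<^bsub>N\<^esub> n l) {..<k}"
  have 1: "pure_sum k n (matrix_map M (Suc p) c y) - (pure_sum k n (outer M (c p) (y p))
      + pure_sum k n (matrix_map M p c y)) \<in> rel"
    unfolding e using n cl o by (intro pure_sum_add) auto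
  have 2: "pure_sum k n (outer M (c p) (y p)) - frag_of (?g p, y p) \<in> rel"
    using n Suc.prems M.vec_nth by (intro pure_sum_outer) blast+
  have 3: "pure_sum p ?g y - pure_sum k n (matrix_map M p c y) \<in> rel"
    using Suc by auto
  have "pure_sum (Suc p) ?g y - pure_sum k n (matrix_map M (Suc p) c y) =
    (pure_sum p ?g y - pure_sum k n (matrix_map M p c y))
    - (pure_sum k n (matrix_map M (Suc p) c y) - (pure_sum k n (outer M (c p) (y p))
        + pure_sum k n (matrix_map M p c y)))
    - (pure_sum k n (outer M (c p) (y p)) - frag_of (?g p, y p))"
    by (simp add: pure_sum_def[of "Suc p"] pure_sum_def[of p])
  then show ?case using rel_diff[OF rel_diff[OF 3 1] 2] by metis
qed

end

lemma sum_lessThan_append: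
  fixes f :: "nat \<Rightarrow> 'z::comm_monoid_add"
  shows "(\<Sum>i<k+l. f i) = (\<Sum>i<k. f i) + (\<Sum>i<l. f (k + i))"
  by (induction l) (auto simp: add.assoc)

context tensor_setup begin

lemma ex_pure_sum:
  assumes "supported t"
  shows "\<exists>k n m. (\<forall>i<k. n i \<in> carrier N) \<and> (\<forall>i<k. m i \<in> carrier M) \<and> t - pure_sum k n m \<in> rel"
  using assms
proof (induction t rule: free_Abelian_group_induct [consumes 1, case_names zero diff single])
  case zero
  show ?case by (rule exI[of _ "0::nat"]) (simp add: pure_sum_def rel_zero)
next
  case (diff s t)
  obtain k n m where s: "\<forall>i<k. n i \<in> carrier N" "\<forall>i<k. m i \<in> carrier M" "s - pure_sum k n m \<in> rel"
    using diff by blast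
  obtain k' n' m' where t: "\<forall>i<k'. n' i \<in> carrier N" "\<forall>i<k'. m' i \<in> carrier M" "t - pure_sum k' n' m' \<in> rel"
    using diff by blast
  let ?n = "\<lambda>i. if i < k then n i else \<ominus>\<^bsub>N\<^esub> n' (i - k)"
  let ?m = "\<lambda>i. if i < k then m i else m' (i - k)"
  have r: "(\<Sum>i<k'. frag_of (\<ominus>\<^bsub>N\<^esub> n' i, m' i) + frag_of (n' i, m' i)) \<in> rel"
    using t by (intro rel_sum rel_left_uminus) auto
  have "s - t - pure_sum (k + k') ?n ?m = (s - pure_sum k n m) - (t - pure_sum k' n' m')
    - (\<Sum>i<k'. frag_of (\<ominus>\<^bsub>N\<^esub> n' i, m' i) + frag_of (n' i, m' i))"
    by (simp add: pure_sum_def sum_lessThan_append sum.distrib)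
  then have "s - t - pure_sum (k + k') ?n ?m \<in> rel"
    using rel_diff[OF rel_diff[OF s(3) t(3)] r] by presburger
  moreover have "\<forall>i<k+k'. ?n i \<in> carrier N" "\<forall>i<k+k'. ?m i \<in> carrier M" using s t by auto
  ultimately show ?case by (intro exI[of _ "k + k'"] exI[of _ ?n] exI[of _ ?m] conjI)
next
  case (single a)
  show ?case
    by (rule exI[of _ "1::nat"], rule exI[of _ "\<lambda>_. fst a"], rule exI[of _ "\<lambda>_. snd a"])
      (use single in \<open>auto simp: pure_sum_def rel_zero\<close>)
qed

end

context tensor_setup begin

text \<open>For an arbitrary function \<open>g\<close> of pairs, \<open>h\<close> is the homomorphism on the free Abelian group that extends it;
  only for a bilinear \<open>g\<close> does it vanish on \<open>rel\<close>.\<close>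

definition linear_extension where
  "linear_extension G g h \<longleftrightarrow> h 0 = \<zero>\<^bsub>G\<^esub> \<and> (\<forall>a \<in> carrier F. h a \<in> carrier G) \<and>
    (\<forall>a \<in> carrier F. \<forall>b \<in> carrier F. h (a + b) = h a \<oplus>\<^bsub>G\<^esub> h b) \<and>
    (\<forall>a \<in> carrier F. h (- a) = \<ominus>\<^bsub>G\<^esub> h a) \<and>
    (\<forall>x \<in> carrier N. \<forall>y \<in> carrier M. h (frag_of (x, y)) = g x y)"

lemma ex_linear_extension:
  assumes "abelian_group G" "\<And>x y. x \<in> carrier N \<Longrightarrow> y \<in> carrier M \<Longrightarrow> g x y \<in> carrier G"
  shows "\<exists>h. linear_extension G g h"
proof -
  interpret G: abelian_group G by fact
  have "(\<lambda>(x, y). g x y) ` (carrier N \<times> carrier M) \<subseteq> carrier (add_monoid G)" using assms(2) by auto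
  from comm_group.free_Abelian_group_universal[OF G.a_comm_group this]
  obtain h where h: "h \<in> hom F (add_monoid G)"
    "\<And>x. x \<in> carrier N \<times> carrier M \<Longrightarrow> h (frag_of x) = (case x of (x, y) \<Rightarrow> g x y)" by blast
  interpret H: group_hom F "add_monoid G" h
    by (intro group_hom.intro group_hom_axioms.intro h group_free_Abelian_group G.a_group)
  have "h (- a) = \<ominus>\<^bsub>G\<^esub> h a" if "a \<in> carrier F" for a
    using H.hom_inv[OF that] that by (simp add: a_inv_def)
  moreover have "h (a + b) = h a \<oplus>\<^bsub>G\<^esub> h b" if "a \<in> carrier F" "b \<in> carrier F" for a b
    using H.hom_mult[OF that] by simp
  moreover have "h a \<in> carrier G" if "a \<in> carrier F" for a
    using H.hom_closed[OF that] by simp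
  moreover have "h 0 = \<zero>\<^bsub>G\<^esub>" using H.hom_one by simp
  moreover have "h (frag_of (x, y)) = g x y" if "x \<in> carrier N" "y \<in> carrier M" for x y
    using h(2)[of "(x, y)"] that by simp
  ultimately show ?thesis unfolding linear_extension_def by blast
qed

lemma linear_extension_frag_of:
  "linear_extension G g h \<Longrightarrow> x \<in> carrier N \<Longrightarrow> y \<in> carrier M \<Longrightarrow> h (frag_of (x, y)) = g x y"
  unfolding linear_extension_def by blast

lemma linear_extension_diff:
  assumes "linear_extension G g h" "a \<in> carrier F" "b \<in> carrier F"
  shows "h (a - b) = h a \<oplus>\<^bsub>G\<^esub> \<ominus>\<^bsub>G\<^esub> h b"
proof -
  have "- b \<in> carrier F" using assms(3) by simp
  then have "h (a + - b) = h a \<oplus>\<^bsub>G\<^esub> h (- b)" "h (- b) = \<ominus>\<^bsub>G\<^esub> h b"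
    using assms unfolding linear_extension_def by blast+
  then show ?thesis by simp
qed

lemma linear_extension_diff3:
  assumes "abelian_group G" "linear_extension G g h" "h (frag_of a) = h (frag_of b) \<oplus>\<^bsub>G\<^esub> h (frag_of c)"
    "a \<in> carrier N \<times> carrier M" "b \<in> carrier N \<times> carrier M" "c \<in> carrier N \<times> carrier M"
  shows "h (frag_of a - frag_of b - frag_of c) = \<zero>\<^bsub>G\<^esub>"
proof -
  interpret G: abelian_group G by fact
  have "frag_of a - frag_of b \<in> carrier F" "frag_of a \<in> carrier F" "frag_of b \<in> carrier F" "frag_of c \<in> carrier F"
    using assms(4-6) keys_frag_of_diff[OF assms(4,5)] by simp_all
  then have "h (frag_of a - frag_of b - frag_of c) =
      h (frag_of a) \<oplus>\<^bsub>G\<^esub> \<ominus>\<^bsub>G\<^esub> h (frag_of b) \<oplus>\<^bsub>G\<^esub> \<ominus>\<^bsub>G\<^esub> h (frag_of c)"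
    and "h (frag_of b) \<in> carrier G" "h (frag_of c) \<in> carrier G"
    using assms(2) linear_extension_diff[OF assms(2)] unfolding linear_extension_def by metis+
  then show ?thesis unfolding assms(3)
    using G.add.m_comm[of "h (frag_of b)" "h (frag_of c)"] by (simp add: G.a_assoc G.r_neg)
qed

lemma linear_extension_pure_sum:
  assumes "abelian_group G" "\<And>x y. x \<in> carrier N \<Longrightarrow> y \<in> carrier M \<Longrightarrow> g x y \<in> carrier G"
    and "linear_extension G g h"
    and "\<And>i. i < k \<Longrightarrow> n i \<in> carrier N" "\<And>i. i < k \<Longrightarrow> m i \<in> carrier M"
  shows "h (pure_sum k n m) = finsum G (\<lambda>i. g (n i) (m i)) {..<k}"
  using assms(4,5)
proof (induction k)
  interpret G: abelian_group G by fact
  {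
    case 0 then show ?case using assms(3) by (simp add: pure_sum_def linear_extension_def)
  next
    case (Suc k)
    have "frag_of (n k, m k) \<in> carrier F" "pure_sum k n m \<in> carrier F"
      using Suc.prems pure_sum_keys[of k n m] by auto
    then have "h (frag_of (n k, m k) + pure_sum k n m) = h (frag_of (n k, m k)) \<oplus>\<^bsub>G\<^esub> h (pure_sum k n m)"
      using assms(3) unfolding linear_extension_def by blast
    then have "h (pure_sum (Suc k) n m) = g (n k) (m k) \<oplus>\<^bsub>G\<^esub> finsum G (\<lambda>i. g (n i) (m i)) {..<k}"
      using Suc linear_extension_frag_of[OF assms(3)] by (simp add: pure_sum_def add.commute)
    then show ?case
      unfolding lessThan_Suc using Suc.prems assms(2) by (subst G.finsum_insert) auto
  }
qed

lemma ex_hom_of_bilinear: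
  assumes G: "abelian_group G"
    and closed: "\<And>x y. x \<in> carrier N \<Longrightarrow> y \<in> carrier M \<Longrightarrow> g x y \<in> carrier G"
    and left: "\<And>x x' y. x \<in> carrier N \<Longrightarrow> x' \<in> carrier N \<Longrightarrow> y \<in> carrier M \<Longrightarrow>
      g (x \<oplus>\<^bsub>N\<^esub> x') y = g x y \<oplus>\<^bsub>G\<^esub> g x' y"
    and right: "\<And>x y y'. x \<in> carrier N \<Longrightarrow> y \<in> carrier M \<Longrightarrow> y' \<in> carrier M \<Longrightarrow>
      g x (y \<oplus>\<^bsub>M\<^esub> y') = g x y \<oplus>\<^bsub>G\<^esub> g x y'"
    and bal: "\<And>r x y. r \<in> carrier R \<Longrightarrow> x \<in> carrier N \<Longrightarrow> y \<in> carrier M \<Longrightarrow>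
      g (r \<odot>\<^bsub>N\<^esub> x) y = g x (r \<odot>\<^bsub>M\<^esub> y)"
  shows "\<exists>h. (\<forall>t\<in>rel. h t = \<zero>\<^bsub>G\<^esub>) \<and> (\<forall>k n m. (\<forall>i<k. n i \<in> carrier N) \<longrightarrow> (\<forall>i<k. m i \<in> carrier M) \<longrightarrow>
    h (pure_sum k n m) = finsum G (\<lambda>i. g (n i) (m i)) {..<k})"
proof -
  interpret G: abelian_group G by fact
  have "\<exists>h. linear_extension G g h" by (rule ex_linear_extension[OF G closed])
  then obtain h where h: "linear_extension G g h" ..
  note hf = linear_extension_frag_of[OF h]
  have gen: "h t = \<zero>\<^bsub>G\<^esub>" if "t \<in> relators" for t
    using that
  proof (elim UnE CollectE exE conjE, goal_cases)
    case (1 x x' y) then show ?case using left by (auto intro!: linear_extension_diff3[OF G h] simp: hf)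
  next
    case (2 x y y') then show ?case using right by (auto intro!: linear_extension_diff3[OF G h] simp: hf)
  next
    case (3 r x y)
    have "g x (r \<odot>\<^bsub>M\<^esub> y) \<in> carrier G" using 3 closed by simp
    then show ?case using 3 bal by (auto simp: linear_extension_diff[OF h] hf G.r_neg)
  qed
  have car: "t \<in> carrier F" if "t \<in> rel" for t using rel_keys[OF that] by simp
  have "h t = \<zero>\<^bsub>G\<^esub>" if "t \<in> rel" for t
    using that unfolding tensor_relations_def
  proof (induction rule: generate.induct)
    case one then show ?case using h by (simp add: linear_extension_def)
  next
    case (incl t) then show ?case by (rule gen)
  next
    case (inv t)
    have "t \<in> rel" unfolding tensor_relations_def by (rule generate.incl[OF inv])
    then have t: "t \<in> carrier F" by (rule car)
    then have "h (- t) = \<ominus>\<^bsub>G\<^esub> h t" using h unfolding linear_extension_def by blast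
    then show ?case using gen[OF inv] t by simp
  next
    case (eng s t)
    then have "s \<in> carrier F" "t \<in> carrier F" using car unfolding tensor_relations_def by blast+
    then have "h (s + t) = h s \<oplus>\<^bsub>G\<^esub> h t" using h unfolding linear_extension_def by blast
    then show ?case using eng by simp
  qed
  moreover have "h (pure_sum k n m) = finsum G (\<lambda>i. g (n i) (m i)) {..<k}"
    if "\<forall>i<k. n i \<in> carrier N" "\<forall>i<k. m i \<in> carrier M" for k n m
    using that by (intro linear_extension_pure_sum[OF G closed h]) auto
  ultimately show ?thesis by blast
qed

end

section \<open>The map induced on tensor products\<close>

locale tensor_map_setup = tensor_setup R N M + T': tensor_setup R N' M
  for R (structure) and N (structure) and M (structure) and N' (structure) +
  fixes f assumes hom: "f \<in> module_hom R N N'"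
begin

definition push where "push = frag_extend (\<lambda>(x, y). frag_of (f x, y))"

lemma f_closed: "x \<in> carrier N \<Longrightarrow> f x \<in> carrier N'"
  using hom by (auto simp: module_hom_def)

lemma f_add: "x \<in> carrier N \<Longrightarrow> y \<in> carrier N \<Longrightarrow> f (x \<oplus>\<^bsub>N\<^esub> y) = f x \<oplus>\<^bsub>N'\<^esub> f y"
  using hom by (auto simp: module_hom_def)

lemma f_smult: "r \<in> carrier R \<Longrightarrow> x \<in> carrier N \<Longrightarrow> f (r \<odot>\<^bsub>N\<^esub> x) = r \<odot>\<^bsub>N'\<^esub> f x"
  using hom by (auto simp: module_hom_def)

lemma f_zero: "f \<zero>\<^bsub>N\<^esub> = \<zero>\<^bsub>N'\<^esub>"
  using f_smult[of \<zero> "\<zero>\<^bsub>N\<^esub>"] f_closed[of "\<zero>\<^bsub>N\<^esub>"] by simp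

lemma push_simps [simp]:
  "push 0 = 0" "push (a + b) = push a + push b" "push (a - b) = push a - push b" "push (- a) = - push a"
  "push (frag_of (x, y)) = frag_of (f x, y)"
  by (simp_all add: push_def frag_extend_add frag_extend_diff frag_extend_minus)

lemma push_sum [simp]: "push (sum g A) = (\<Sum>i\<in>A. push (g i))"
  by (induction A rule: infinite_finite_induct) auto

lemma push_rel: "t \<in> rel \<Longrightarrow> push t \<in> T'.rel"
proof -
  have gen: "push t \<in> T'.rel" if "t \<in> relators" (is "t \<in> ?G") for t
    using that
    by (auto simp: f_add f_smult f_closed intro!: T'.rel_add_left T'.rel_add_right T'.rel_smult)
  have Grel: "t \<in> rel" if "t \<in> ?G" for t
    using that unfolding tensor_relations_def by (rule generate.incl)
  assume "t \<in> rel"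
  then have "t \<in> generate F ?G" by (simp add: tensor_relations_def)
  then show ?thesis
  proof induction
    case one then show ?case using T'.rel_zero by simp
  next
    case (incl h) then show ?case by (rule gen)
  next
    case (inv h)
    then have "inv\<^bsub>F\<^esub> h = - h" using rel_keys[OF Grel] by simp
    then show ?case using T'.rel_uminus[OF gen[OF inv]] by simp
  next
    case (eng h1 h2) then show ?case using T'.rel_add by simp
  qed
qed

lemma tensor_map_coset:
  assumes "supported s"
  shows "tensor_map R N' M f (rel #>\<^bsub>F\<^esub> s) = T'.rel #>\<^bsub>T'.F\<^esub> push s"
proof -
  have "T'.rel #>\<^bsub>T'.F\<^esub> push c = T'.rel #>\<^bsub>T'.F\<^esub> push s" if "c \<in> rel #>\<^bsub>F\<^esub> s" for c
    using that push_rel[of "c - s"] by (simp add: T'.coset_eq_iff mem_coset_iff)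
  moreover have "s \<in> rel #>\<^bsub>F\<^esub> s" by (simp add: mem_coset_iff rel_zero)
  ultimately show ?thesis unfolding tensor_map_def push_def[symmetric] by blast
qed

text \<open>Injectivity on cosets becomes the reflection of \<open>rel\<close>; the rest of the development uses flatness only in this form.\<close>

lemma inj_on_tensor_map_iff:
  "inj_on (tensor_map R N' M f) (carrier (tensor_product R N M)) \<longleftrightarrow>
    (\<forall>t. supported t \<longrightarrow> push t \<in> T'.rel \<longrightarrow> t \<in> rel)"
proof -
  have car: "carrier (tensor_product R N M) = {rel #>\<^bsub>F\<^esub> s |s. supported s}"
    by (auto simp: tensor_product_def FactGroup_def RCOSETS_def)
  have *: "rel #>\<^bsub>F\<^esub> s = rel #>\<^bsub>F\<^esub> t \<longleftrightarrow> s - t \<in> rel" for s t by (rule coset_eq_iff)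
  have k: "supported (s - t)"
    if "supported s" "supported t"
    for s t :: "_ \<times> _ \<Rightarrow>\<^sub>0 int"
    using that keys_diff[of s t] by blast
  show ?thesis
  proof (intro iffI allI impI)
    fix t assume inj: "inj_on (tensor_map R N' M f) (carrier (tensor_product R N M))"
      and t: "supported t" "push t \<in> T'.rel"
    have "tensor_map R N' M f (rel #>\<^bsub>F\<^esub> t) = tensor_map R N' M f (rel #>\<^bsub>F\<^esub> 0)"
      using t by (simp add: tensor_map_coset T'.coset_eq_iff)
    moreover have "rel #>\<^bsub>F\<^esub> t \<in> carrier (tensor_product R N M)" "rel #>\<^bsub>F\<^esub> 0 \<in> carrier (tensor_product R N M)"
      using t unfolding car by fastforce+
    ultimately have "rel #>\<^bsub>F\<^esub> t = rel #>\<^bsub>F\<^esub> 0" using inj by (auto dest: inj_onD)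
    then show "t \<in> rel" by (simp add: *)
  next
    assume *: "\<forall>t. supported t \<longrightarrow> push t \<in> T'.rel \<longrightarrow> t \<in> rel"
    show "inj_on (tensor_map R N' M f) (carrier (tensor_product R N M))"
    proof (rule inj_onI)
      fix A B assume "A \<in> carrier (tensor_product R N M)" "B \<in> carrier (tensor_product R N M)"
        and eq: "tensor_map R N' M f A = tensor_map R N' M f B"
      then obtain s t where st: "A = rel #>\<^bsub>F\<^esub> s" "B = rel #>\<^bsub>F\<^esub> t"
        "supported s" "supported t"
        unfolding car by blast
      then have "push (s - t) \<in> T'.rel"
        using eq by (simp add: tensor_map_coset T'.coset_eq_iff)
      then show "A = B" using * k[OF st(3,4)] st(1,2) by (simp add: coset_eq_iff)
    qed
  qed
qed

end

section \<open>Flatness in terms of vectors\<close>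

text \<open>Flatness is applied to the injection \<open>R\<^sup>p/c\<^sup>-\<^sup>1(L) \<rightarrow> R\<^sup>k/L\<close> induced by the matrix \<open>c\<close>. Tensoring with \<open>M\<close> turns it into
  \<open>M\<^sup>p/c\<^sup>-\<^sup>1(L)M \<rightarrow> M\<^sup>k/LM\<close>, and the lemma is the injectivity of this map. The identification of \<open>(R\<^sup>p/K) \<otimes> M\<close> with \<open>M\<^sup>p/KM\<close>
  is needed in one direction on each side only: on the right the tensor of \<open>y\<close> is shown to vanish,
  and on the left a map out of the tensor product recovers the class of \<open>y\<close>.\<close>

lemma flat_imp_tensor_span_preimage:
  fixes R :: "('a, 'r) ring_scheme" and M :: "('a, 'b, 'm) module_scheme"
  assumes flat: "flat_module TYPE((nat \<Rightarrow> 'a) set) R M"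
    and c: "\<And>i. i < p \<Longrightarrow> c i \<in> vecs R k"
    and L: "submodule L R (free_power R k)"
    and y: "y \<in> mvecs M p" "matrix_map M p c y \<in> tensor_span M L"
  shows "y \<in> tensor_span M {v \<in> vecs R p. matrix_map (ring_as_module R) p c v \<in> L}"
proof -
  interpret module R M using flat by (simp add: flat_module_def)
  interpret matrix_module R M by unfold_locales
  interpret V: matrix_module R Rm by unfold_locales
  let ?P = "free_power R p" and ?T = "free_power R k"
  let ?\<phi> = "matrix_map Rm p c"
  define K where "K = {v \<in> vecs R p. ?\<phi> v \<in> L}"
  have K: "submodule K R (?P)" unfolding K_def by (rule V.submodule_preimage[OF c L])
  interpret P: module R ?P by (rule module_vec)
  interpret P': module R ?T by (rule module_vec)
  interpret Q: quotient_module R ?P K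
    by (intro quotient_module.intro quotient_module_axioms.intro P.module_axioms K)
  interpret Q': quotient_module R ?T L
    by (intro quotient_module.intro quotient_module_axioms.intro P'.module_axioms L)
  \<comment> \<open>The union is over equal cosets: the class of \<open>a\<close> goes to the class of \<open>\<phi>(a)\<close>.\<close>
  define f where "f = (\<lambda>A. \<Union>a\<in>A. Q'.cls (?\<phi> a))"
  have \<phi>c: "?\<phi> a \<in> vecs R k" if "a \<in> vecs R p" for a
    by (rule V.matrix_map_closed[OF c that])
  have \<phi>a: "?\<phi> (a \<oplus>\<^bsub>?P\<^esub> b) = ?\<phi> a \<oplus>\<^bsub>?T\<^esub> ?\<phi> b"
    if "a \<in> vecs R p" "b \<in> vecs R p" for a b
    using V.matrix_map_add[OF c that] by simp
  have \<phi>s: "?\<phi> (r \<odot>\<^bsub>?P\<^esub> a) = r \<odot>\<^bsub>?T\<^esub> ?\<phi> a"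
    if "a \<in> vecs R p" "r \<in> carrier R" for a r
    using V.matrix_map_smult[OF c that] by simp
  have \<phi>m: "?\<phi> (a \<ominus>\<^bsub>?P\<^esub> b) = ?\<phi> a \<ominus>\<^bsub>?T\<^esub> ?\<phi> b"
    if ab: "a \<in> vecs R p" "b \<in> vecs R p" for a b
  proof -
    have "\<ominus>\<^bsub>?P\<^esub> b = (\<ominus>\<^bsub>R\<^esub> \<one>\<^bsub>R\<^esub>) \<odot>\<^bsub>?P\<^esub> b"
      "\<ominus>\<^bsub>?T\<^esub> ?\<phi> b = (\<ominus>\<^bsub>R\<^esub> \<one>\<^bsub>R\<^esub>) \<odot>\<^bsub>?T\<^esub> ?\<phi> b"
      using ab \<phi>c[of b] P.smult_l_minus[of "\<one>\<^bsub>R\<^esub>" b] P'.smult_l_minus[of "\<one>\<^bsub>R\<^esub>" "?\<phi> b"]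
        P.smult_one[of b] P'.smult_one[of "?\<phi> b"] by simp_all
    then show ?thesis using \<phi>a[of a "\<ominus>\<^bsub>?P\<^esub> b"] \<phi>s[of b "\<ominus>\<^bsub>R\<^esub> \<one>\<^bsub>R\<^esub>"] ab
      unfolding a_minus_def by (metis P.M.a_inv_closed R.a_inv_closed R.one_closed)
  qed
  have f_eq: "f (Q.cls a) = Q'.cls (?\<phi> a)" if a: "a \<in> vecs R p" for a
  proof -
    have *: "Q'.cls (?\<phi> b) = Q'.cls (?\<phi> a)" if "b \<in> Q.cls a" for b
    proof -
      have b: "b \<in> vecs R p" "b \<ominus>\<^bsub>?P\<^esub> a \<in> K"
        using that a Q.mem_cls_iff by auto
      then have "?\<phi> b \<ominus>\<^bsub>?T\<^esub> ?\<phi> a \<in> L" using \<phi>m[OF b(1) a] by (simp add: K_def)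
      then show ?thesis using Q'.cls_eq_iff[of "?\<phi> b" "?\<phi> a"] \<phi>c a b by simp
    qed
    have "a \<in> Q.cls a" using a Q.mem_cls_iff[OF a, of a] Q.K_zero by (simp add: a_minus_def P.M.r_neg del: power_module_sel)
    then show ?thesis unfolding f_def using * by blast
  qed
  have hom: "f \<in> module_hom R Q.Q Q'.Q"
    unfolding module_hom_def
    using \<phi>c \<phi>a \<phi>s P.M.a_closed P.smult_closed
    by (auto simp: Q.carrier_Q Q'.carrier_Q f_eq Q.Q_add Q'.Q_add Q.Q_smult Q'.Q_smult simp del: power_module_sel)
  have inj: "inj_on f (carrier Q.Q)"
  proof (rule inj_onI)
    fix A B assume "A \<in> carrier Q.Q" "B \<in> carrier Q.Q" and eq: "f A = f B"
    then obtain a b where ab: "A = Q.cls a" "B = Q.cls b" "a \<in> vecs R p" "b \<in> vecs R p"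
      unfolding Q.carrier_Q by blast
    then have "?\<phi> a \<ominus>\<^bsub>?T\<^esub> ?\<phi> b \<in> L" using eq f_eq Q'.cls_eq_iff \<phi>c by simp
    then have "a \<ominus>\<^bsub>?P\<^esub> b \<in> K" using \<phi>m[of a b] ab P.M.minus_closed by (simp add: K_def)
    then show "A = B" using ab Q.cls_eq_iff by simp
  qed
  interpret QM: module R Q.Q by (rule Q.module_Q)
  interpret QM': module R Q'.Q by (rule Q'.module_Q)
  interpret tensor_map_setup R Q.Q M Q'.Q f by unfold_locales (rule hom)
  have tinj: "t \<in> rel" if "Poly_Mapping.keys t \<subseteq> carrier Q.Q \<times> carrier M" "push t \<in> T'.rel" for t
    using flat QM.module_axioms QM'.module_axioms hom inj that inj_on_tensor_map_iff
    unfolding flat_module_def by blast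
  have yn: "y i \<in> carrier M" for i using y(1) pow_nth by blast
  let ?e = "\<lambda>i. Q.cls (unit_vec i)" and ?e' = "\<lambda>l. Q'.cls (unit_vec l)"
  have e: "?e i \<in> carrier Q.Q" if "i < p" for i using that unit_vec_closed by (auto simp: Q.carrier_Q)
  have e': "?e' i \<in> carrier Q'.Q" if "i < k" for i using that unit_vec_closed by (auto simp: Q'.carrier_Q)
  have lin: "finsum Q'.Q (\<lambda>l. v l \<odot>\<^bsub>Q'.Q\<^esub> ?e' l) {..<k} = Q'.cls v" if v: "v \<in> vecs R k" for v
  proof -
    have "finsum Q'.Q (\<lambda>l. v l \<odot>\<^bsub>Q'.Q\<^esub> ?e' l) {..<k} = finsum Q'.Q (\<lambda>l. Q'.cls (v l \<odot>\<^bsub>?T\<^esub> unit_vec l)) {..<k}"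
      using v vec_nth unit_vec_closed P'.smult_closed Q'.carrier_Q
      by (intro QM'.M.finsum_cong') (auto simp: Q'.Q_smult simp del: power_module_sel)
    also have "\<dots> = Q'.cls v"
      using v vec_nth unit_vec_closed P'.smult_closed finsum_unit_vec[OF v]
      by (subst Q'.finsum_Q) (auto simp del: power_module_sel)
    finally show ?thesis .
  qed
  \<comment> \<open>This tensor corresponds to the class of \<open>y\<close>; its image corresponds to the class of \<open>c y\<close>, which is zero.\<close>
  have in_rel: "pure_sum p ?e y \<in> rel"
  proof (rule tinj)
    show "Poly_Mapping.keys (pure_sum p ?e y) \<subseteq> carrier Q.Q \<times> carrier M"
      using e yn by (intro pure_sum_keys) auto
    have "push (pure_sum p ?e y) = T'.pure_sum p (\<lambda>i. finsum Q'.Q (\<lambda>l. c i l \<odot>\<^bsub>Q'.Q\<^esub> ?e' l) {..<k}) y"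
      unfolding pure_sum_def T'.pure_sum_def using unit_vec_closed c
      by (auto simp: f_eq lin matrix_map_unit_vec[OF c] intro!: sum.cong)
    moreover have "T'.pure_sum k ?e' (matrix_map M p c y) \<in> T'.rel"
    proof (rule T'.pure_sum_tensor_span[OF _ P'.submoduleE(1)[OF L] _ y(2)])
      show "finsum Q'.Q (\<lambda>l. v l \<odot>\<^bsub>Q'.Q\<^esub> ?e' l) {..<k} = \<zero>\<^bsub>Q'.Q\<^esub>" if "v \<in> L" for v
      proof -
        have v: "v \<in> vecs R k" using that P'.submoduleE(1)[OF L] by blast
        show ?thesis unfolding lin[OF v] Q'.Q_zero Q'.cls_zero
          using Q'.cls_eq_zero_iff[OF v] that by blast
      qed
    qed (rule e')
    moreover have "T'.pure_sum p (\<lambda>i. finsum Q'.Q (\<lambda>l. c i l \<odot>\<^bsub>Q'.Q\<^esub> ?e' l) {..<k}) y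
      - T'.pure_sum k ?e' (matrix_map M p c y) \<in> T'.rel"
      using e' c yn by (intro T'.pure_sum_matrix_map) auto
    ultimately show "push (pure_sum p ?e y) \<in> T'.rel" using T'.rel_cong by simp
  qed
  interpret PM: module R "power_module p M" by (rule module_pow)
  have Kc: "K \<subseteq> vecs R p" by (auto simp: K_def)
  interpret S: quotient_module R "power_module p M" "tensor_span M K"
    by (intro quotient_module.intro quotient_module_axioms.intro PM.module_axioms submodule_tensor_span[OF K])
  interpret SQ: module R S.Q by (rule S.module_Q)
  \<comment> \<open>The bilinear map \<open>([a], u) \<mapsto> [a \<otimes> u]\<close> from \<open>R\<^sup>p/K\<close> and \<open>M\<close> to \<open>M\<^sup>p/KM\<close>.\<close>
  define g where "g = (\<lambda>A u. S.cls (outer M (SOME a. a \<in> A \<and> a \<in> vecs R p) u))"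
  have g: "g (Q.cls a) u = S.cls (outer M a u)" if a: "a \<in> vecs R p" and u: "u \<in> carrier M" for a u
  proof -
    let ?b = "SOME b. b \<in> Q.cls a \<and> b \<in> vecs R p"
    have "a \<in> Q.cls a" using a Q.mem_cls_iff[OF a, of a] Q.K_zero by (simp add: a_minus_def P.M.r_neg del: power_module_sel)
    then have "?b \<in> Q.cls a \<and> ?b \<in> vecs R p" using a by (metis (mono_tags, lifting) someI)
    then have b: "?b \<in> vecs R p" "?b \<ominus>\<^bsub>?P\<^esub> a \<in> K"
      using Q.mem_cls_iff[OF a] by auto
    have o: "outer M ?b u \<in> mvecs M p" "outer M a u \<in> mvecs M p"
      using b a u outer_closed by auto
    have "outer M ?b u \<ominus>\<^bsub>power_module p M\<^esub> outer M a u = outer M (?b \<ominus>\<^bsub>?P\<^esub> a) u"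
    proof
      fix i
      have *: "?b i \<in> carrier R" "a i \<in> carrier R" using a b vec_nth by blast+
      have "\<ominus>\<^bsub>Rm\<^esub> a i = \<ominus>\<^bsub>R\<^esub> a i"
        using * by (intro Rm.M.minus_equality) (auto simp: R.l_neg)
      then show "(outer M ?b u \<ominus>\<^bsub>power_module p M\<^esub> outer M a u) i = outer M (?b \<ominus>\<^bsub>?P\<^esub> a) u i"
        using power_module_a_inv[OF module_Rm a] power_module_a_inv[OF module_axioms o(2)] u *
        by (simp add: a_minus_def outer_def smult_l_distr smult_l_minus)
    qed
    also have "\<dots> \<in> tensor_span M K" by (rule outer_in_tensor_span[OF b(2) Kc u])
    finally show ?thesis using S.cls_eq_iff[OF o] by (simp add: g_def)
  qed
  have oadd: "outer M (a \<oplus>\<^bsub>?P\<^esub> b) u = outer M a u \<oplus>\<^bsub>power_module p M\<^esub> outer M b u"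
    if "a \<in> vecs R p" "b \<in> vecs R p" "u \<in> carrier M" for a b u
    using that vec_nth by (auto simp: outer_def smult_l_distr)
  have oadd': "outer M a (u \<oplus>\<^bsub>M\<^esub> w) = outer M a u \<oplus>\<^bsub>power_module p M\<^esub> outer M a w"
    if "a \<in> vecs R p" "w \<in> carrier M" "u \<in> carrier M" for a w u
    using that vec_nth by (auto simp: outer_def smult_r_distr)
  have obal: "outer M (r \<odot>\<^bsub>?P\<^esub> a) u = outer M a (r \<odot>\<^bsub>M\<^esub> u)"
    if "a \<in> vecs R p" "r \<in> carrier R" "u \<in> carrier M" for a r u
    using that vec_nth by (auto simp: outer_def smult_assoc1[symmetric] R.m_comm)
  have "\<exists>h. (\<forall>t\<in>rel. h t = \<zero>\<^bsub>S.Q\<^esub>) \<and> (\<forall>k n m. (\<forall>i<k. n i \<in> carrier Q.Q) \<longrightarrow> (\<forall>i<k. m i \<in> carrier M) \<longrightarrow>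
    h (pure_sum k n m) = finsum S.Q (\<lambda>i. g (n i) (m i)) {..<k})"
  proof (rule ex_hom_of_bilinear)
    show "g x u \<in> carrier S.Q" if "x \<in> carrier Q.Q" "u \<in> carrier M" for x u
      using that outer_closed by (auto simp: Q.carrier_Q S.carrier_Q g)
    show "g (x \<oplus>\<^bsub>Q.Q\<^esub> x') u = g x u \<oplus>\<^bsub>S.Q\<^esub> g x' u"
      if "x \<in> carrier Q.Q" "x' \<in> carrier Q.Q" "u \<in> carrier M" for x x' u
      using that outer_closed P.M.a_closed
      by (auto simp: Q.carrier_Q g S.Q_add Q.Q_add oadd simp del: power_module_sel)
    show "g x (u \<oplus>\<^bsub>M\<^esub> w) = g x u \<oplus>\<^bsub>S.Q\<^esub> g x w"
      if "x \<in> carrier Q.Q" "u \<in> carrier M" "w \<in> carrier M" for x u w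
      using that outer_closed by (auto simp: Q.carrier_Q g S.Q_add oadd' simp del: power_module_sel)
    show "g (r \<odot>\<^bsub>Q.Q\<^esub> x) u = g x (r \<odot>\<^bsub>M\<^esub> u)"
      if "r \<in> carrier R" "x \<in> carrier Q.Q" "u \<in> carrier M" for r x u
      using that P.smult_closed by (auto simp: Q.carrier_Q g Q.Q_smult obal simp del: power_module_sel)
  qed (rule SQ.M.abelian_group_axioms)
  then obtain h where h: "\<forall>t\<in>rel. h t = \<zero>\<^bsub>S.Q\<^esub>"
    "\<And>k n m. (\<forall>i<k. n i \<in> carrier Q.Q) \<Longrightarrow> (\<forall>i<k. m i \<in> carrier M) \<Longrightarrow>
    h (pure_sum k n m) = finsum S.Q (\<lambda>i. g (n i) (m i)) {..<k}" by blast
  have o: "outer M (unit_vec i) (y i) \<in> mvecs M p" if "i < p" for i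
    using that yn unit_vec_closed outer_closed by blast
  have "h (pure_sum p ?e y) = finsum S.Q (\<lambda>i. g (?e i) (y i)) {..<p}"
    using e yn by (intro h(2)) auto
  also have "\<dots> = finsum S.Q (\<lambda>i. S.cls (outer M (unit_vec i) (y i))) {..<p}"
    using o by (intro SQ.M.finsum_cong') (auto simp: g unit_vec_closed yn S.carrier_Q)
  also have "\<dots> = S.cls y"
    using o by (subst S.finsum_Q) (auto simp: finsum_outer_unit_vec[OF y(1)])
  finally have "h (pure_sum p ?e y) = S.cls y" .
  then have "S.cls y = tensor_span M K" using in_rel h(1) S.Q_zero S.cls_zero by simp
  then show ?thesis using S.cls_eq_zero_iff[OF y(1)] by (simp add: K_def)
qed

section \<open>The equational criterion for flatness\<close>

text \<open>Every linear relation between elements of \<open>M\<close> is a consequence of relations in \<open>R\<close>. Systems of relations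
  (matrices \<open>c\<close> with several rows) are allowed from the start.\<close>

definition equationally_flat :: "('r, 'k) ring_scheme \<Rightarrow> ('r, 'a, 'm) module_scheme \<Rightarrow> bool"
  where "equationally_flat R M \<longleftrightarrow>
    (\<forall>p k c y. (\<forall>i<p. c i \<in> vecs R k) \<longrightarrow> y \<in> mvecs M p \<longrightarrow>
      matrix_map M p c y = (\<lambda>_. \<zero>\<^bsub>M\<^esub>) \<longrightarrow>
      y \<in> tensor_span M {v \<in> vecs R p.
        matrix_map (ring_as_module R) p c v = (\<lambda>_. \<zero>\<^bsub>R\<^esub>)})"

context tensor_setup begin

text \<open>If \<open>\<phi>\<close> were linear, then \<open>x \<otimes> y \<mapsto> \<phi>(y) x\<close> would be defined on the tensor product; here \<open>\<phi>\<close> is an arbitrary function,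
  which will be linear on a finite part of \<open>M\<close> only.\<close>

abbreviation evaluates where "evaluates \<phi> \<equiv> linear_extension N (\<lambda>x y. \<phi> y \<odot>\<^bsub>N\<^esub> x)"

text \<open>A quadruple \<open>(r, s, y, y')\<close> stands for the requirement that \<open>\<phi>\<close> is linear on \<open>r y + s y'\<close>. Additivity is the case
  \<open>r = s = 1\<close> and homogeneity the case \<open>s = 0\<close>.\<close>

definition obeys where
  "obeys \<phi> T \<longleftrightarrow> (\<forall>(r, s, y, y') \<in> T.
    \<phi> (r \<odot>\<^bsub>M\<^esub> y \<oplus>\<^bsub>M\<^esub> s \<odot>\<^bsub>M\<^esub> y') = r \<otimes> \<phi> y \<oplus> s \<otimes> \<phi> y')"

lemma generator_constraints:
  assumes "t \<in> relators"
  shows "\<exists>T. finite T \<and> T \<subseteq> carrier R \<times> carrier R \<times> carrier M \<times> carrier M \<and>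
    (\<forall>\<phi> h. \<phi> \<in> carrier M \<rightarrow> carrier R \<longrightarrow> obeys \<phi> T \<longrightarrow> evaluates \<phi> h \<longrightarrow> h t = \<zero>\<^bsub>N\<^esub>)"
  using assms
proof (elim UnE CollectE exE conjE, goal_cases)
  note d3 = linear_extension_diff3[OF N.M.abelian_group_axioms]
  {
    case (1 x x' y)
    have "h t = \<zero>\<^bsub>N\<^esub>" if "\<phi> \<in> carrier M \<rightarrow> carrier R" "evaluates \<phi> h" for \<phi> h
    proof -
      have "\<phi> y \<in> carrier R" using that 1 by auto
      then show ?thesis unfolding 1(1) using 1 that(2)
        by (intro d3[OF that(2)]) (auto simp: linear_extension_frag_of N.smult_r_distr)
    qed
    then show ?case by (intro exI[of _ "{}"]) auto
  next
    case (2 x y y')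
    have "h t = \<zero>\<^bsub>N\<^esub>"
      if "\<phi> \<in> carrier M \<rightarrow> carrier R" "evaluates \<phi> h" "obeys \<phi> {(\<one>, \<one>, y, y')}" for \<phi> h
    proof -
      have c: "\<phi> y \<in> carrier R" "\<phi> y' \<in> carrier R" using that 2 by auto
      then have "\<phi> (y \<oplus>\<^bsub>M\<^esub> y') = \<phi> y \<oplus> \<phi> y'" using that(3) 2 by (simp add: obeys_def)
      then show ?thesis unfolding 2(1) using 2 that(2) c
        by (intro d3[OF that(2)]) (auto simp: linear_extension_frag_of N.smult_l_distr)
    qed
    then show ?case using 2 by (intro exI[of _ "{(\<one>, \<one>, y, y')}"]) auto
  next
    case (3 r x y)
    have "h t = \<zero>\<^bsub>N\<^esub>"
      if "\<phi> \<in> carrier M \<rightarrow> carrier R" "evaluates \<phi> h" "obeys \<phi> {(r, \<zero>, y, y)}" for \<phi> h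
    proof -
      have c: "\<phi> y \<in> carrier R" using that 3 by auto
      then have "\<phi> (r \<odot>\<^bsub>M\<^esub> y) = r \<otimes> \<phi> y" using that(3) 3 by (simp add: obeys_def)
      moreover have "r \<odot>\<^bsub>N\<^esub> (\<phi> y \<odot>\<^bsub>N\<^esub> x) = \<phi> y \<odot>\<^bsub>N\<^esub> (r \<odot>\<^bsub>N\<^esub> x)"
        using 3 c by (simp add: N.smult_assoc1[symmetric] N.R.m_comm)
      ultimately show ?thesis unfolding 3(1) using 3 that(2) c
        by (subst linear_extension_diff[OF that(2)]) (auto simp: linear_extension_frag_of N.smult_assoc1 N.M.r_neg)
    qed
    then show ?case using 3 by (intro exI[of _ "{(r, \<zero>, y, y)}"]) auto
  }
qed

text \<open>An element of \<open>rel\<close> is a combination of finitely many relators, and each of them is annihilated by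
  \<open>x \<otimes> y \<mapsto> \<phi>(y) x\<close> as soon as \<open>\<phi>\<close> is linear at one place. So finitely many instances of linearity suffice.\<close>

lemma rel_constraints:
  assumes "t \<in> rel"
  shows "\<exists>T. finite T \<and> T \<subseteq> carrier R \<times> carrier R \<times> carrier M \<times> carrier M \<and>
    (\<forall>\<phi> h. \<phi> \<in> carrier M \<rightarrow> carrier R \<longrightarrow> obeys \<phi> T \<longrightarrow> evaluates \<phi> h \<longrightarrow> h t = \<zero>\<^bsub>N\<^esub>)"
  using assms unfolding tensor_relations_def
proof (induction rule: generate.induct)
  case one
  then show ?case by (intro exI[of _ "{}"]) (auto simp: linear_extension_def)
next
  case (incl t)
  then show ?case by (rule generator_constraints)
next
  case (inv t)
  have "t \<in> rel" unfolding tensor_relations_def by (rule generate.incl[OF inv])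
  then have k: "supported t" by (rule rel_keys)
  obtain T where T: "finite T" "T \<subseteq> carrier R \<times> carrier R \<times> carrier M \<times> carrier M"
    "\<And>\<phi> h. \<phi> \<in> carrier M \<rightarrow> carrier R \<Longrightarrow> obeys \<phi> T \<Longrightarrow> evaluates \<phi> h \<Longrightarrow> h t = \<zero>\<^bsub>N\<^esub>"
    using generator_constraints[OF inv] by blast
  have "h (- t) = \<zero>\<^bsub>N\<^esub>"
    if "\<phi> \<in> carrier M \<rightarrow> carrier R" "obeys \<phi> T" "evaluates \<phi> h" for \<phi> h
  proof -
    have "h (- t) = \<ominus>\<^bsub>N\<^esub> h t" using that(3) k unfolding linear_extension_def by simp
    then show ?thesis using T(3)[OF that] by simp
  qed
  then show ?case using T(1,2) k by (intro exI[of _ T]) simp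
next
  case (eng s t)
  then have k: "supported s" "supported t"
    using rel_keys unfolding tensor_relations_def by blast+
  obtain S where S: "finite S" "S \<subseteq> carrier R \<times> carrier R \<times> carrier M \<times> carrier M"
    "\<And>\<phi> h. \<phi> \<in> carrier M \<rightarrow> carrier R \<Longrightarrow> obeys \<phi> S \<Longrightarrow> evaluates \<phi> h \<Longrightarrow> h s = \<zero>\<^bsub>N\<^esub>"
    using eng.IH(1) by blast
  obtain T where T: "finite T" "T \<subseteq> carrier R \<times> carrier R \<times> carrier M \<times> carrier M"
    "\<And>\<phi> h. \<phi> \<in> carrier M \<rightarrow> carrier R \<Longrightarrow> obeys \<phi> T \<Longrightarrow> evaluates \<phi> h \<Longrightarrow> h t = \<zero>\<^bsub>N\<^esub>"
    using eng.IH(2) by blast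
  have "h (s + t) = \<zero>\<^bsub>N\<^esub>"
    if "\<phi> \<in> carrier M \<rightarrow> carrier R" "obeys \<phi> (S \<union> T)" "evaluates \<phi> h" for \<phi> h
  proof -
    have "obeys \<phi> S" "obeys \<phi> T" using that(2) by (auto simp: obeys_def)
    then have "h s = \<zero>\<^bsub>N\<^esub>" "h t = \<zero>\<^bsub>N\<^esub>" using S(3) T(3) that by blast+
    moreover have "h (s + t) = h s \<oplus>\<^bsub>N\<^esub> h t" using that(3) k unfolding linear_extension_def by simp
    ultimately show ?thesis by simp
  qed
  then show ?case using S(1,2) T(1,2) by (intro exI[of _ "S \<union> T"]) simp
qed

text \<open>If \<open>\<Sum>\<^sub>i n\<^sub>i \<otimes> m\<^sub>i = 0\<close>, let \<open>E\<close> be the finite set of the \<open>m\<^sub>i\<close> and of the elements of \<open>M\<close> in the constraints of the previous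
  lemma. The constraints are linear relations between the elements of \<open>E\<close>. The equational criterion writes the family
  of these elements as a sum of \<open>v \<otimes> u\<close> in which each vector \<open>v\<close> satisfies the relations. Such a \<open>v\<close>,
  read as a function \<open>\<phi>\<close> on \<open>E\<close> and extended by \<open>0\<close>, obeys the constraints, hence \<open>\<Sum>\<^sub>i \<phi>(m\<^sub>i) n\<^sub>i = 0\<close>.\<close>

lemma equational_vanishing:
  assumes eq: "equationally_flat R M"
    and n: "\<And>i. i < k \<Longrightarrow> n i \<in> carrier N" and m: "\<And>i. i < k \<Longrightarrow> m i \<in> carrier M"
    and rel: "pure_sum k n m \<in> rel"
  shows "(\<lambda>i. if i < k then m i else \<zero>\<^bsub>M\<^esub>) \<in> tensor_span M
    {v \<in> vecs R k. finsum N (\<lambda>i. v i \<odot>\<^bsub>N\<^esub> n i) {..<k} = \<zero>\<^bsub>N\<^esub>}"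
proof -
  interpret V: matrix_module R M.Rm by unfold_locales
  obtain T where T: "finite T" "T \<subseteq> carrier R \<times> carrier R \<times> carrier M \<times> carrier M"
    "\<And>\<phi> h. \<phi> \<in> carrier M \<rightarrow> carrier R \<Longrightarrow> obeys \<phi> T \<Longrightarrow> evaluates \<phi> h \<Longrightarrow> h (pure_sum k n m) = \<zero>\<^bsub>N\<^esub>"
    using rel_constraints[OF rel] by blast
  define E where "E = m ` {..<k} \<union> (\<Union>(r, s, y, y')\<in>T. {r \<odot>\<^bsub>M\<^esub> y \<oplus>\<^bsub>M\<^esub> s \<odot>\<^bsub>M\<^esub> y', y, y'})"
  have E: "finite E" "E \<subseteq> carrier M" using T(1,2) m by (auto simp: E_def)
  define q where "q = card E"
  obtain e where e: "bij_betw e {..<q} E"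
    using ex_bij_betw_nat_finite[OF E(1)] by (auto simp: q_def atLeast0LessThan)
  define idx where "idx = inv_into {..<q} e"
  have idx: "idx x < q" "e (idx x) = x" if "x \<in> E" for x
    using that e bij_betw_inv_into_right[OF e] inv_into_into[of x e "{..<q}"]
    by (auto simp: idx_def bij_betw_def)
  have ec: "e j \<in> carrier M" if "j < q" for j using e E(2) that by (auto simp: bij_betw_def)
  define l where "l = card T"
  obtain \<tau> where \<tau>: "bij_betw \<tau> {..<l} T"
    using ex_bij_betw_nat_finite[OF T(1)] by (auto simp: l_def atLeast0LessThan)
  \<comment> \<open>Row \<open>t\<close> of the matrix is the \<open>t\<close>-th constraint, as a relation between the \<open>e j\<close>.\<close>
  define c where "c = (\<lambda>j t. if t < l then (case \<tau> t of (r, s, y, y') \<Rightarrow>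
    M.unit_vec (idx (r \<odot>\<^bsub>M\<^esub> y \<oplus>\<^bsub>M\<^esub> s \<odot>\<^bsub>M\<^esub> y')) j \<oplus>
      \<ominus> (r \<otimes> M.unit_vec (idx y) j \<oplus> s \<otimes> M.unit_vec (idx y') j)) else \<zero>)"
  have \<tau>c: "r \<in> carrier R" "s \<in> carrier R" "y \<in> carrier M" "y' \<in> carrier M" "y \<in> E" "y' \<in> E"
    "r \<odot>\<^bsub>M\<^esub> y \<oplus>\<^bsub>M\<^esub> s \<odot>\<^bsub>M\<^esub> y' \<in> E" if "t < l" "\<tau> t = (r, s, y, y')" for t r s y y'
  proof -
    have *: "(r, s, y, y') \<in> T" using that \<tau> by (metis bij_betwE lessThan_iff)
    then show "r \<in> carrier R" "s \<in> carrier R" "y \<in> carrier M" "y' \<in> carrier M" using T(2) by auto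
    show "y \<in> E" "y' \<in> E" "r \<odot>\<^bsub>M\<^esub> y \<oplus>\<^bsub>M\<^esub> s \<odot>\<^bsub>M\<^esub> y' \<in> E"
      using * unfolding E_def by force+
  qed
  have cc: "c j \<in> vecs R l" for j
  proof (rule M.vec_memI)
    fix t assume t: "t < l"
    obtain r s y y' where \<tau>t: "\<tau> t = (r, s, y, y')" by (metis prod_cases4)
    show "c j t \<in> carrier R" using t \<tau>t \<tau>c(1,2)[OF t \<tau>t] by (simp add: c_def M.unit_vec_def)
  qed (simp add: c_def)
  have "matrix_map M q c e t = \<zero>\<^bsub>M\<^esub>" for t
  proof (cases "t < l")
    case True
    obtain r s y y' where \<tau>t: "\<tau> t = (r, s, y, y')" by (metis prod_cases4)
    note x = \<tau>c[OF True \<tau>t]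
    have "matrix_map M q c e t = e (idx (r \<odot>\<^bsub>M\<^esub> y \<oplus>\<^bsub>M\<^esub> s \<odot>\<^bsub>M\<^esub> y')) \<oplus>\<^bsub>M\<^esub>
      \<ominus>\<^bsub>M\<^esub> (r \<odot>\<^bsub>M\<^esub> e (idx y) \<oplus>\<^bsub>M\<^esub> s \<odot>\<^bsub>M\<^esub> e (idx y'))"
      unfolding matrix_map_def c_def using True \<tau>t x idx ec
      by (simp add: M.finsum_unit_vec_combination)
    then show ?thesis using x idx by (simp add: M.M.r_neg)
  next
    case False
    then have "finsum M (\<lambda>i. c i t \<odot>\<^bsub>M\<^esub> e i) {..<q} = \<zero>\<^bsub>M\<^esub>"
      using ec by (intro M.M.add.finprod_one_eqI) (simp add: c_def)
    then show ?thesis by (simp add: matrix_map_def)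
  qed
  then have me: "matrix_map M q c e = (\<lambda>_. \<zero>\<^bsub>M\<^esub>)" by blast
  define e' where "e' = (\<lambda>j. if j < q then e j else \<zero>\<^bsub>M\<^esub>)"
  have e': "e' \<in> mvecs M q" using ec by (auto simp: e'_def intro!: M.pow_memI)
  have "matrix_map M q c e' = matrix_map M q c e"
  proof
    fix t show "matrix_map M q c e' t = matrix_map M q c e t"
      unfolding matrix_map_def using ec M.vec_nth[OF cc] by (intro M.M.finsum_cong') (auto simp: e'_def)
  qed
  then have sp: "e' \<in> tensor_span M {v \<in> vecs R q. matrix_map M.Rm q c v = (\<lambda>_. \<zero>)}"
    (is "_ \<in> tensor_span M ?K") using eq e' cc me unfolding equationally_flat_def by auto
  let ?A = "{v \<in> vecs R k. finsum N (\<lambda>i. v i \<odot>\<^bsub>N\<^esub> n i) {..<k} = \<zero>\<^bsub>N\<^esub>}"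
  have mE: "m i \<in> E" if "i < k" for i using that by (auto simp: E_def)
  \<comment> \<open>A vector that satisfies the constraints, restricted to the positions of the \<open>m i\<close>, annihilates \<open>n\<close>.\<close>
  have ann: "(\<lambda>i. if i < k then v (idx (m i)) else \<zero>) \<in> ?A" if "v \<in> ?K" for v
  proof -
    have v: "v \<in> vecs R q" "matrix_map M.Rm q c v = (\<lambda>_. \<zero>)" using that by auto
    note vn = M.vec_nth[OF v(1)]
    define \<phi> where "\<phi> = (\<lambda>x. if x \<in> E then v (idx x) else \<zero>)"
    have \<phi>: "\<phi> \<in> carrier M \<rightarrow> carrier R" using vn by (auto simp: \<phi>_def)
    have "obeys \<phi> T"
      unfolding obeys_def
    proof (intro ballI, clarify)
      fix r s y y' assume "(r, s, y, y') \<in> T"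
      then obtain t where t: "t < l" "\<tau> t = (r, s, y, y')" using \<tau> by (metis bij_betw_iff_bijections lessThan_iff)
      note x = \<tau>c[OF t]
      have "\<zero> = matrix_map M.Rm q c v t" using v by simp
      also have "\<dots> = v (idx (r \<odot>\<^bsub>M\<^esub> y \<oplus>\<^bsub>M\<^esub> s \<odot>\<^bsub>M\<^esub> y')) \<oplus>\<^bsub>M.Rm\<^esub>
        \<ominus>\<^bsub>M.Rm\<^esub> (r \<odot>\<^bsub>M.Rm\<^esub> v (idx y) \<oplus>\<^bsub>M.Rm\<^esub> s \<odot>\<^bsub>M.Rm\<^esub> v (idx y'))"
        unfolding matrix_map_def c_def using t x idx vn
        by (simp del: ring_as_module_sel(3,4) add: V.finsum_unit_vec_combination)
      finally have 0: "v (idx (r \<odot>\<^bsub>M\<^esub> y \<oplus>\<^bsub>M\<^esub> s \<odot>\<^bsub>M\<^esub> y')) \<oplus>\<^bsub>M.Rm\<^esub>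
        \<ominus>\<^bsub>M.Rm\<^esub> (r \<odot>\<^bsub>M.Rm\<^esub> v (idx y) \<oplus>\<^bsub>M.Rm\<^esub> s \<odot>\<^bsub>M.Rm\<^esub> v (idx y')) = \<zero>\<^bsub>M.Rm\<^esub>" by simp
      have "v (idx (r \<odot>\<^bsub>M\<^esub> y \<oplus>\<^bsub>M\<^esub> s \<odot>\<^bsub>M\<^esub> y')) =
        r \<odot>\<^bsub>M.Rm\<^esub> v (idx y) \<oplus>\<^bsub>M.Rm\<^esub> s \<odot>\<^bsub>M.Rm\<^esub> v (idx y')"
        using M.Rm.M.minus_equality[OF 0] x vn by simp
      then show "\<phi> (r \<odot>\<^bsub>M\<^esub> y \<oplus>\<^bsub>M\<^esub> s \<odot>\<^bsub>M\<^esub> y') = r \<otimes> \<phi> y \<oplus> s \<otimes> \<phi> y'"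
        using x by (simp add: \<phi>_def)
    qed
    moreover have \<phi>N: "\<phi> y \<odot>\<^bsub>N\<^esub> x \<in> carrier N" if "x \<in> carrier N" "y \<in> carrier M" for x y
      using \<phi> that by auto
    moreover have "\<exists>h. evaluates \<phi> h"
      by (rule ex_linear_extension[OF N.M.abelian_group_axioms]) (rule \<phi>N)
    then obtain h where h: "evaluates \<phi> h" ..
    ultimately have "finsum N (\<lambda>i. \<phi> (m i) \<odot>\<^bsub>N\<^esub> n i) {..<k} = \<zero>\<^bsub>N\<^esub>"
      using T(3)[OF \<phi> _ h] linear_extension_pure_sum[OF N.M.abelian_group_axioms \<phi>N h n m] by simp
    moreover have "finsum N (\<lambda>i. (if i < k then v (idx (m i)) else \<zero>) \<odot>\<^bsub>N\<^esub> n i) {..<k} =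
      finsum N (\<lambda>i. \<phi> (m i) \<odot>\<^bsub>N\<^esub> n i) {..<k}"
      using vn n mE by (intro N.M.finsum_cong') (auto simp: \<phi>_def)
    ultimately show ?thesis using vn by (auto intro!: M.vec_memI)
  qed
  have "(\<lambda>i. if i < k then w (idx (m i)) else \<zero>\<^bsub>M\<^esub>) \<in> tensor_span M ?A" if "w \<in> tensor_span M ?K" for w
    using that
  proof induction
    case zero
    then show ?case using tensor_span.zero[of M ?A] by simp
  next
    case (add v u w)
    have "(\<lambda>i. if i < k then outer M v u (idx (m i)) \<oplus>\<^bsub>M\<^esub> w (idx (m i)) else \<zero>\<^bsub>M\<^esub>) =
      (\<lambda>i. outer M (\<lambda>i. if i < k then v (idx (m i)) else \<zero>) u i \<oplus>\<^bsub>M\<^esub>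
        (if i < k then w (idx (m i)) else \<zero>\<^bsub>M\<^esub>))"
      using add(2) by (auto simp: outer_def)
    then show ?case using tensor_span.add[OF ann[OF add(1)] add(2) add.IH] by simp
  qed
  from this[OF sp] have "(\<lambda>i. if i < k then e' (idx (m i)) else \<zero>\<^bsub>M\<^esub>) \<in> tensor_span M ?A" .
  moreover have "(\<lambda>i. if i < k then e' (idx (m i)) else \<zero>\<^bsub>M\<^esub>) = (\<lambda>i. if i < k then m i else \<zero>\<^bsub>M\<^esub>)"
    using idx mE by (auto simp: e'_def)
  ultimately show ?thesis by simp
qed

end

text \<open>An injective map has the same linear relations among \<open>f(n\<^sub>i)\<close> as among \<open>n\<^sub>i\<close>, so the two halves of the description of vanishing tensors
  apply to the same vectors.\<close>

lemma (in tensor_map_setup) inj_on_tensor_map: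
  assumes eq: "equationally_flat R M" and inj: "inj_on f (carrier N)"
  shows "inj_on (tensor_map R N' M f) (carrier (tensor_product R N M))"
  unfolding inj_on_tensor_map_iff
proof (intro allI impI)
  fix t assume t: "supported t" "push t \<in> T'.rel"
  obtain k n m where nm: "\<forall>i<k. n i \<in> carrier N" "\<forall>i<k. m i \<in> carrier M" "t - pure_sum k n m \<in> rel"
    using ex_pure_sum[OF t(1)] by blast
  have "push t - push (pure_sum k n m) \<in> T'.rel" using push_rel[OF nm(3)] by simp
  moreover have "push (pure_sum k n m) = T'.pure_sum k (\<lambda>i. f (n i)) m"
    by (simp add: pure_sum_def T'.pure_sum_def)
  ultimately have r: "T'.pure_sum k (\<lambda>i. f (n i)) m \<in> T'.rel"
    using t(2) T'.rel_cong[of "push t" "T'.pure_sum k (\<lambda>i. f (n i)) m"] by simp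
  let ?A = "{v \<in> vecs R k. finsum N (\<lambda>i. v i \<odot>\<^bsub>N\<^esub> n i) {..<k} = \<zero>\<^bsub>N\<^esub>}"
  let ?A' = "{v \<in> vecs R k. finsum N' (\<lambda>i. v i \<odot>\<^bsub>N'\<^esub> f (n i)) {..<k} = \<zero>\<^bsub>N'\<^esub>}"
  have "?A' \<subseteq> ?A"
  proof safe
    fix v assume v: "v \<in> vecs R k"
      and 0: "finsum N' (\<lambda>i. v i \<odot>\<^bsub>N'\<^esub> f (n i)) {..<k} = \<zero>\<^bsub>N'\<^esub>"
    have vn: "v i \<in> carrier R" for i using M.vec_nth[OF v] .
    let ?s = "finsum N (\<lambda>i. v i \<odot>\<^bsub>N\<^esub> n i) {..<k}"
    have "f ?s = finsum N' (\<lambda>i. f (v i \<odot>\<^bsub>N\<^esub> n i)) {..<k}"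
      using nm vn f_closed f_zero f_add N.M.abelian_monoid_axioms T'.N.M.abelian_monoid_axioms
      by (intro finsum_of_additive) auto
    also have "\<dots> = finsum N' (\<lambda>i. v i \<odot>\<^bsub>N'\<^esub> f (n i)) {..<k}"
      using nm vn f_closed by (intro T'.N.M.finsum_cong') (auto simp: f_smult)
    finally have "f ?s = f \<zero>\<^bsub>N\<^esub>" using 0 f_zero by simp
    moreover have "?s \<in> carrier N" using nm vn by (intro N.M.finsum_closed) auto
    ultimately show "?s = \<zero>\<^bsub>N\<^esub>" using inj by (auto dest: inj_onD)
  qed
  moreover have "(\<lambda>i. if i < k then m i else \<zero>\<^bsub>M\<^esub>) \<in> tensor_span M ?A'"
    using nm f_closed by (intro T'.equational_vanishing[OF eq _ _ r]) auto
  ultimately have "(\<lambda>i. if i < k then m i else \<zero>\<^bsub>M\<^esub>) \<in> tensor_span M ?A"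
    using M.tensor_span_mono by blast
  then have "pure_sum k n (\<lambda>i. if i < k then m i else \<zero>\<^bsub>M\<^esub>) \<in> rel"
    using nm by (intro pure_sum_tensor_span[of k n ?A]) auto
  then have "pure_sum k n m \<in> rel" by (simp add: pure_sum_def)
  then show "t \<in> rel" using rel_cong[OF nm(3)] by simp
qed

theorem flat_module_if_equationally_flat:
  assumes "module R M" "equationally_flat R M"
  shows "flat_module TYPE('c) R M"
  unfolding flat_module_def
proof (intro conjI allI impI assms(1), elim conjE)
  fix N N' :: "('a, 'c) module" and f
  assume N: "module R N" "module R N'" "f \<in> module_hom R N N'" "inj_on f (carrier N)"
  interpret M: module R M by fact
  interpret M: matrix_module R M by unfold_locales
  interpret N: module R N by fact
  interpret N': module R N' by fact
  interpret tensor_map_setup R N M N' f by unfold_locales fact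
  show "inj_on (tensor_map R N' M f) (carrier (tensor_product R N M))"
    by (rule inj_on_tensor_map[OF assms(2) N(4)])
qed

section \<open>Powers of ideals and the Artin--Rees property\<close>

definition noetherian_module :: "('r, 'k) ring_scheme \<Rightarrow> ('r, 'a, 'm) module_scheme \<Rightarrow> bool"
  where "noetherian_module R M \<longleftrightarrow>
    (\<forall>S. S \<noteq> {} \<and> (\<forall>K\<in>S. submodule K R M) \<longrightarrow> (\<exists>K\<in>S. \<forall>L\<in>S. K \<subseteq> L \<longrightarrow> L = K))"

lemma (in cring) ideal_if_closed:
  assumes "H \<subseteq> carrier R" "\<zero> \<in> H" "\<And>a b. a \<in> H \<Longrightarrow> b \<in> H \<Longrightarrow> a \<oplus> b \<in> H"
    and s: "\<And>r a. r \<in> carrier R \<Longrightarrow> a \<in> H \<Longrightarrow> r \<otimes> a \<in> H"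
  shows "ideal H R"
proof (rule idealI)
  have "\<ominus> a \<in> H" if "a \<in> H" for a using s[of "\<ominus> \<one>" a] assms(1) that l_minus[of \<one> a] by auto
  then show "subgroup H (add_monoid R)"
    using assms by (intro add.subgroupI) auto
  show "a \<otimes> x \<in> H" if "a \<in> H" "x \<in> carrier R" for a x
    using s[of x a] that assms(1) m_comm[of a x] by auto
qed (use s ring_axioms in auto)

lemma ideal_mem_closed:
  assumes "ideal J R"
  shows "J \<subseteq> carrier R" "\<zero>\<^bsub>R\<^esub> \<in> J" "\<And>a b. a \<in> J \<Longrightarrow> b \<in> J \<Longrightarrow> a \<oplus>\<^bsub>R\<^esub> b \<in> J"
    "\<And>r a. r \<in> carrier R \<Longrightarrow> a \<in> J \<Longrightarrow> r \<otimes>\<^bsub>R\<^esub> a \<in> J"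
    "\<And>r a. r \<in> carrier R \<Longrightarrow> a \<in> J \<Longrightarrow> a \<otimes>\<^bsub>R\<^esub> r \<in> J"
proof -
  interpret ideal J R by fact
  show "J \<subseteq> carrier R" "\<zero>\<^bsub>R\<^esub> \<in> J" "\<And>a b. a \<in> J \<Longrightarrow> b \<in> J \<Longrightarrow> a \<oplus>\<^bsub>R\<^esub> b \<in> J"
    "\<And>r a. r \<in> carrier R \<Longrightarrow> a \<in> J \<Longrightarrow> r \<otimes>\<^bsub>R\<^esub> a \<in> J"
    "\<And>r a. r \<in> carrier R \<Longrightarrow> a \<in> J \<Longrightarrow> a \<otimes>\<^bsub>R\<^esub> r \<in> J"
    using a_subset by (auto simp: I_l_closed I_r_closed)
qed

context cring begin

lemma ideals_monoid: "monoid (ideals_set R)"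
  using ideals_set_is_comm_monoid by (simp add: comm_monoid_def)

lemma ideal_power_ideal: "ideal I R \<Longrightarrow> ideal (ideal_power R I s) R"
  using monoid.nat_pow_closed[OF ideals_monoid, of I s] by (simp add: ideals_set_def)

lemma ideal_power_zero: "ideal_power R I 0 = carrier R"
  by (simp add: nat_pow_def ideals_set_def)

lemma ideal_power_add:
  "ideal I R \<Longrightarrow> ideal_power R I (m + n) = ideal_power R I m \<cdot>\<^bsub>R\<^esub> ideal_power R I n"
  using monoid.nat_pow_mult[OF ideals_monoid, of I m n] by (simp add: ideals_set_def)

lemma ideal_power_one: "ideal I R \<Longrightarrow> ideal_power R I 1 = I"
  using monoid.nat_pow_eone[OF ideals_monoid, of I] by (simp add: ideals_set_def)

lemma ideal_power_antimono:
  assumes "ideal I R" "m \<le> n" shows "ideal_power R I n \<subseteq> ideal_power R I m"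
proof -
  obtain k where "n = m + k" using assms(2) le_Suc_ex by blast
  then show ?thesis using ideal_power_add[OF assms(1), of m k]
      ideal_prod_inter[OF ideal_power_ideal ideal_power_ideal, OF assms(1) assms(1)] by auto
qed

lemma pow_in_ideal_power:
  assumes "ideal I R" "x \<in> I" shows "x [^] n \<in> ideal_power R I n"
proof (induction n)
  case 0 show ?case unfolding ideal_power_zero by simp
next
  case (Suc n)
  have "ideal_power R I (Suc n) = ideal_power R I n \<cdot>\<^bsub>R\<^esub> I"
    using ideal_power_add[OF assms(1), of n 1] ideal_power_one[OF assms(1)] by simp
  then show ?case using ideal_prod.prod[OF Suc assms(2)] by simp
qed

end

lemma noetherian_ring_maximal_ideal_in_set:
  assumes "noetherian_ring R" "S \<noteq> {}" "\<And>J. J \<in> S \<Longrightarrow> ideal J R"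
  shows "\<exists>J\<in>S. \<forall>L\<in>S. J \<subseteq> L \<longrightarrow> L = J"
proof (rule subset_Zorn_nonempty[OF assms(2)])
  fix C assume C: "C \<noteq> {}" "subset.chain S C"
  then have "subset.chain {J. ideal J R} C"
    using assms(3) by (auto simp: subset_chain_def)
  then have "\<Union>C \<in> C" by (rule noetherian_ring.ideal_chain_is_trivial[OF assms(1) C(1)])
  then show "\<Union>C \<in> S" using C(2) by (auto simp: subset_chain_def)
qed

text \<open>Noetherian induction on \<open>Q\<close>. If \<open>g \<in> I - Q\<close> has a power in \<open>Q\<close>, then both \<open>(Q : g)\<close> and \<open>Q + (g)\<close> are strictly larger than \<open>Q\<close>,
  so they contain powers of \<open>I\<close>, and the product of the two powers lies in \<open>Q\<close>.\<close>

lemma ideal_power_subset_of_nil: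
  fixes R (structure)
  assumes "noetherian_ring R" "cring R" "ideal I R" "ideal Q R"
    and nil: "\<And>x. x \<in> I \<Longrightarrow> \<exists>n::nat. x [^]\<^bsub>R\<^esub> n \<in> Q"
  shows "\<exists>a. ideal_power R I a \<subseteq> Q"
proof (rule ccontr)
  interpret cring R by fact
  define S where "S = {Q. ideal Q R \<and> (\<forall>x\<in>I. \<exists>n::nat. x [^]\<^bsub>R\<^esub> n \<in> Q) \<and> \<not> (\<exists>a. ideal_power R I a \<subseteq> Q)}"
  assume "\<not> (\<exists>a. ideal_power R I a \<subseteq> Q)"
  then have "Q \<in> S" using assms(4) nil by (simp add: S_def)
  then have "S \<noteq> {}" by blast
  then have "\<exists>J\<in>S. \<forall>L\<in>S. J \<subseteq> L \<longrightarrow> L = J"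
    by (rule noetherian_ring_maximal_ideal_in_set[OF assms(1)]) (simp add: S_def)
  then obtain Q where Q: "Q \<in> S" "\<And>L. L \<in> S \<Longrightarrow> Q \<subseteq> L \<Longrightarrow> L = Q"
    by blast
  then have iQ: "ideal Q R" by (simp add: S_def)
  note q = ideal_mem_closed[OF iQ] and i = ideal_mem_closed[OF assms(3)]
  have "\<not> ideal_power R I 1 \<subseteq> Q" using Q(1) unfolding S_def by blast
  then have "\<not> I \<subseteq> Q" unfolding ideal_power_one[OF assms(3)] .
  then obtain g where g: "g \<in> I" "g \<notin> Q" by blast
  then have gc: "g \<in> carrier R" using i by blast
  \<comment> \<open>The power of \<open>g\<close> before the first one in \<open>Q\<close> lies in \<open>(Q : g)\<close> and not in \<open>Q\<close>.\<close>
  define n where "n = (LEAST n::nat. g [^] n \<in> Q)"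
  obtain n0 :: nat where "g [^] n0 \<in> Q" using Q(1) g(1) by (auto simp: S_def)
  then have n: "g [^] n \<in> Q" unfolding n_def by (rule LeastI)
  have "n \<noteq> 0"
  proof
    assume "n = 0"
    then have "\<one> \<in> Q" using n by simp
    then show False using g(2) q(4)[of g \<one>] gc by simp
  qed
  then obtain m where m: "n = Suc m" by (cases n) auto
  have gm: "g [^] m \<notin> Q" using not_less_Least[of m "\<lambda>n. g [^] n \<in> Q"] m by (simp add: n_def)
  \<comment> \<open>These are \<open>(Q : g)\<close> and \<open>Q + (g)\<close>.\<close>
  define Q1 where "Q1 = {r \<in> carrier R. r \<otimes> g \<in> Q}"
  define Q2 where "Q2 = {x \<oplus> r \<otimes> g |x r. x \<in> Q \<and> r \<in> carrier R}"
  have enlarge: "\<exists>a. ideal_power R I a \<subseteq> L" if "ideal L R" "Q \<subseteq> L" "L \<noteq> Q" for L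
  proof (rule ccontr)
    assume "\<not> (\<exists>a. ideal_power R I a \<subseteq> L)"
    then have "L \<in> S" using that Q(1) unfolding S_def by blast
    then show False using Q(2) that by blast
  qed
  have "ideal Q1 R" unfolding Q1_def
    by (rule ideal_if_closed) (use q gc in \<open>auto simp: l_distr m_assoc\<close>)
  moreover have "Q \<subseteq> Q1" using q gc by (auto simp: Q1_def)
  moreover have "g [^] m \<in> Q1" using n m gc by (simp add: Q1_def)
  ultimately obtain a1 where a1: "ideal_power R I a1 \<subseteq> Q1" using enlarge gm by blast
  have "Q2 = Q <+> PIdl g" by (auto simp: Q2_def set_add_def' cgenideal_def)
  then have "ideal Q2 R" by (simp add: add_ideals iQ cgenideal_ideal gc)
  moreover have "Q \<subseteq> Q2"
  proof
    fix x assume x: "x \<in> Q"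
    then have "x = x \<oplus> \<zero> \<otimes> g" using gc q(1) by auto
    then show "x \<in> Q2" unfolding Q2_def using x by blast
  qed
  moreover have "g \<in> Q2"
  proof -
    have "g = \<zero> \<oplus> \<one> \<otimes> g" using gc by simp
    then show ?thesis unfolding Q2_def using q(2) by blast
  qed
  ultimately obtain a2 where a2: "ideal_power R I a2 \<subseteq> Q2" using enlarge g by blast
  have "ideal_power R I (a1 + a2) \<subseteq> Q"
  proof
    fix z assume "z \<in> ideal_power R I (a1 + a2)"
    then have "z \<in> ideal_power R I a1 \<cdot>\<^bsub>R\<^esub> ideal_power R I a2"
      using ideal_power_add[OF assms(3)] by simp
    then show "z \<in> Q"
    proof induction
      case (prod s t)
      then have s: "s \<in> carrier R" "s \<otimes> g \<in> Q" using a1 by (auto simp: Q1_def)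
      obtain x r where t: "t = x \<oplus> r \<otimes> g" "x \<in> Q" "r \<in> carrier R" using prod a2 by (auto simp: Q2_def)
      have "x \<in> carrier R" using t q(1) by blast
      then have "s \<otimes> t = s \<otimes> x \<oplus> r \<otimes> (s \<otimes> g)"
        using s t gc by (simp add: r_distr m_lcomm)
      then show ?case using q(3)[OF q(4)[OF s(1) t(2)] q(4)[OF t(3) s(2)]] by simp
    next
      case (sum s t) then show ?case using q(3) by blast
    qed
  qed
  then show False using Q(1) by (auto simp: S_def)
qed

text \<open>Choose \<open>L\<close> maximal among the submodules that contain \<open>K0\<close> and meet \<open>K\<close> in \<open>K0\<close>. For \<open>x \<in> I\<close> the submodules
  \<open>(L : x\<^sup>n)\<close> become stationary, say at \<open>n\<close>. Then \<open>L + x\<^sup>nN\<close> still meets \<open>K\<close> in \<open>K0\<close>: if \<open>x\<^sup>n z + u \<in> K\<close> with \<open>u \<in> L\<close>, then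
  multiplication by \<open>x\<^sup>b\<close> gives \<open>x\<^sup>n\<^sup>+\<^sup>b z \<in> L\<close>, since \<open>x\<^sup>bK \<subseteq> K0 \<subseteq> L\<close>, hence \<open>x\<^sup>n z \<in> L\<close>. By maximality \<open>x\<^sup>nN\<close> lies in \<open>L\<close>. So every element of \<open>I\<close> has a power in
  the ideal of all \<open>r\<close> with \<open>rN \<subseteq> L\<close>, and therefore this ideal contains a power of \<open>I\<close>.
  In the application \<open>K0\<close> is \<open>I\<^sup>bK\<close>.\<close>

lemma weak_artin_rees:
  assumes "noetherian_ring R" "module R N" "noetherian_module R N" "ideal I R"
    and K: "submodule K R N" and K0: "submodule K0 R N" "K0 \<subseteq> K"
    and b: "\<And>x v. x \<in> I \<Longrightarrow> v \<in> K \<Longrightarrow> (x [^]\<^bsub>R\<^esub> (b::nat)) \<odot>\<^bsub>N\<^esub> v \<in> K0"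
  shows "\<exists>a L. submodule L R N \<and> L \<inter> K \<subseteq> K0 \<and>
    (\<forall>r \<in> ideal_power R I a. \<forall>z \<in> carrier N. r \<odot>\<^bsub>N\<^esub> z \<in> L)"
proof -
  interpret N: module R N by fact
  note i = ideal_mem_closed[OF assms(4)]
  define S where "S = {L. submodule L R N \<and> K0 \<subseteq> L \<and> L \<inter> K \<subseteq> K0}"
  have "K0 \<in> S" using K0 by (auto simp: S_def)
  then have "S \<noteq> {} \<and> (\<forall>K\<in>S. submodule K R N)" by (auto simp: S_def)
  then obtain L where LS: "L \<in> S" and Lmax: "\<And>L'. L' \<in> S \<Longrightarrow> L \<subseteq> L' \<Longrightarrow> L' = L"
    using assms(3) unfolding noetherian_module_def by metis
  have L: "submodule L R N" "K0 \<subseteq> L" "L \<inter> K \<subseteq> K0" using LS by (auto simp: S_def)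
  note l = N.submoduleE(1,4,5)[OF L(1)]
  have nil: "\<exists>n::nat. \<forall>z\<in>carrier N. (x [^]\<^bsub>R\<^esub> n) \<odot>\<^bsub>N\<^esub> z \<in> L" if x: "x \<in> I" for x
  proof -
    have xc: "x \<in> carrier R" using x i(1) by blast
    \<comment> \<open>This is \<open>(L : x\<^sup>n)\<close>.\<close>
    define D where "D = (\<lambda>n::nat. {z \<in> carrier N. (x [^]\<^bsub>R\<^esub> n) \<odot>\<^bsub>N\<^esub> z \<in> L})"
    have D: "submodule (D n) R N" for n
    proof (rule N.submodule_if_closed)
      show "\<zero>\<^bsub>N\<^esub> \<in> D n" using xc N.submodule_zero[OF L(1)] by (simp add: D_def)
      show "r \<odot>\<^bsub>N\<^esub> a \<in> D n" if r: "r \<in> carrier R" and a: "a \<in> D n" for r a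
      proof -
        have "(x [^]\<^bsub>R\<^esub> n) \<odot>\<^bsub>N\<^esub> (r \<odot>\<^bsub>N\<^esub> a) = r \<odot>\<^bsub>N\<^esub> ((x [^]\<^bsub>R\<^esub> n) \<odot>\<^bsub>N\<^esub> a)"
          using r a xc by (simp add: D_def N.smult_assoc1[symmetric] N.R.m_comm)
        then show ?thesis using r a l(2) by (simp add: D_def)
      qed
    qed (use xc l in \<open>auto simp: D_def N.smult_r_distr\<close>)
    have Dmono: "D n \<subseteq> D (n + m)" for n m
    proof
      fix z assume z: "z \<in> D n"
      have "(x [^]\<^bsub>R\<^esub> (n + m)) \<odot>\<^bsub>N\<^esub> z = (x [^]\<^bsub>R\<^esub> m) \<odot>\<^bsub>N\<^esub> ((x [^]\<^bsub>R\<^esub> n) \<odot>\<^bsub>N\<^esub> z)"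
        using xc z by (simp add: D_def N.smult_assoc1[symmetric] N.R.nat_pow_mult add.commute)
      then show "z \<in> D (n + m)" using z xc l(2) by (simp add: D_def)
    qed
    have "range D \<noteq> {} \<and> (\<forall>K\<in>range D. submodule K R N)" using D by auto
    then obtain n where n: "\<And>m. D n \<subseteq> D m \<Longrightarrow> D m = D n"
      using assms(3) unfolding noetherian_module_def by (metis (no_types, lifting) rangeE rangeI)
    \<comment> \<open>This is \<open>L + x\<^sup>nN\<close>.\<close>
    define L' where "L' = {(x [^]\<^bsub>R\<^esub> n) \<odot>\<^bsub>N\<^esub> z \<oplus>\<^bsub>N\<^esub> u |z u. z \<in> carrier N \<and> u \<in> L}"
    have xn: "x [^]\<^bsub>R\<^esub> n \<in> carrier R" "x [^]\<^bsub>R\<^esub> b \<in> carrier R" using xc by auto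
    have L': "submodule L' R N"
    proof (rule N.submodule_if_closed)
      show "L' \<subseteq> carrier N" using xn l(1) by (auto simp: L'_def)
      have "\<zero>\<^bsub>N\<^esub> = (x [^]\<^bsub>R\<^esub> n) \<odot>\<^bsub>N\<^esub> \<zero>\<^bsub>N\<^esub> \<oplus>\<^bsub>N\<^esub> \<zero>\<^bsub>N\<^esub>" using xn by simp
      then show "\<zero>\<^bsub>N\<^esub> \<in> L'" unfolding L'_def using N.submodule_zero[OF L(1)] by blast
      fix s t assume "s \<in> L'"
      then obtain z u where s: "s = (x [^]\<^bsub>R\<^esub> n) \<odot>\<^bsub>N\<^esub> z \<oplus>\<^bsub>N\<^esub> u" "z \<in> carrier N" "u \<in> L"
        by (auto simp: L'_def)
      have uc: "u \<in> carrier N" using s l(1) by blast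
      {
        assume "t \<in> L'"
        then obtain y w where t: "t = (x [^]\<^bsub>R\<^esub> n) \<odot>\<^bsub>N\<^esub> y \<oplus>\<^bsub>N\<^esub> w" "y \<in> carrier N" "w \<in> L"
          by (auto simp: L'_def)
        have wc: "w \<in> carrier N" using t l(1) by blast
        have "s \<oplus>\<^bsub>N\<^esub> t = (x [^]\<^bsub>R\<^esub> n) \<odot>\<^bsub>N\<^esub> (z \<oplus>\<^bsub>N\<^esub> y) \<oplus>\<^bsub>N\<^esub> (u \<oplus>\<^bsub>N\<^esub> w)"
          using s t uc wc xn by (simp add: N.smult_r_distr N.M.a_ac)
        then show "s \<oplus>\<^bsub>N\<^esub> t \<in> L'" unfolding L'_def using l(3)[OF s(3) t(3)] s(2) t(2) N.M.a_closed by blast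
      }
      fix r assume r: "r \<in> carrier R"
      have "r \<odot>\<^bsub>N\<^esub> s = (x [^]\<^bsub>R\<^esub> n) \<odot>\<^bsub>N\<^esub> (r \<odot>\<^bsub>N\<^esub> z) \<oplus>\<^bsub>N\<^esub> r \<odot>\<^bsub>N\<^esub> u"
        using r s uc xn by (simp add: N.smult_r_distr N.smult_assoc1[symmetric] N.R.m_comm)
      then show "r \<odot>\<^bsub>N\<^esub> s \<in> L'" unfolding L'_def using l(2)[OF r s(3)] r s(2) N.smult_closed by blast
    qed
    have "L \<subseteq> L'"
    proof
      fix u assume u: "u \<in> L"
      then have "u = (x [^]\<^bsub>R\<^esub> n) \<odot>\<^bsub>N\<^esub> \<zero>\<^bsub>N\<^esub> \<oplus>\<^bsub>N\<^esub> u" using xn l(1) by auto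
      then show "u \<in> L'" unfolding L'_def using u by blast
    qed
    moreover have "L' \<inter> K \<subseteq> K0"
    proof safe
      fix v assume v: "v \<in> L'" "v \<in> K"
      then obtain z u where s: "v = (x [^]\<^bsub>R\<^esub> n) \<odot>\<^bsub>N\<^esub> z \<oplus>\<^bsub>N\<^esub> u" "z \<in> carrier N" "u \<in> L"
        by (auto simp: L'_def)
      have uc: "u \<in> carrier N" using s l(1) by blast
      have "(x [^]\<^bsub>R\<^esub> b) \<odot>\<^bsub>N\<^esub> v = (x [^]\<^bsub>R\<^esub> (n + b)) \<odot>\<^bsub>N\<^esub> z \<oplus>\<^bsub>N\<^esub> (x [^]\<^bsub>R\<^esub> b) \<odot>\<^bsub>N\<^esub> u"
        using s uc xc xn by (simp add: N.smult_r_distr N.smult_assoc1[symmetric] N.R.nat_pow_mult add.commute)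
      then have "(x [^]\<^bsub>R\<^esub> (n + b)) \<odot>\<^bsub>N\<^esub> z = (x [^]\<^bsub>R\<^esub> b) \<odot>\<^bsub>N\<^esub> v \<ominus>\<^bsub>N\<^esub> (x [^]\<^bsub>R\<^esub> b) \<odot>\<^bsub>N\<^esub> u"
        using s uc xc xn by (simp add: a_minus_def N.M.a_assoc N.M.r_neg)
      moreover have "(x [^]\<^bsub>R\<^esub> b) \<odot>\<^bsub>N\<^esub> v \<in> L" using b[OF x v(2)] L(2) by blast
      moreover have "(x [^]\<^bsub>R\<^esub> b) \<odot>\<^bsub>N\<^esub> u \<in> L" using l(2) xn s by blast
      ultimately have "(x [^]\<^bsub>R\<^esub> (n + b)) \<odot>\<^bsub>N\<^esub> z \<in> L" using N.submodule_minus[OF L(1)] by simp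
      then have "z \<in> D (n + b)" using s by (simp add: D_def)
      then have "z \<in> D n" using n[OF Dmono] by blast
      then have "v \<in> L" using s l(3) by (simp add: D_def)
      then show "v \<in> K0" using L(3) v by blast
    qed
    ultimately have "L' = L" using Lmax L' L(2) by (auto simp: S_def)
    moreover have "(x [^]\<^bsub>R\<^esub> n) \<odot>\<^bsub>N\<^esub> z \<in> L'" if "z \<in> carrier N" for z
    proof -
      have "(x [^]\<^bsub>R\<^esub> n) \<odot>\<^bsub>N\<^esub> z = (x [^]\<^bsub>R\<^esub> n) \<odot>\<^bsub>N\<^esub> z \<oplus>\<^bsub>N\<^esub> \<zero>\<^bsub>N\<^esub>" using that xn by simp
      then show ?thesis unfolding L'_def using that N.submodule_zero[OF L(1)] by blast
    qed
    ultimately show ?thesis by blast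
  qed
  define Q where "Q = {r \<in> carrier R. \<forall>z\<in>carrier N. r \<odot>\<^bsub>N\<^esub> z \<in> L}"
  have "ideal Q R"
    by (rule N.R.ideal_if_closed)
      (use l N.submodule_zero[OF L(1)] in \<open>auto simp: Q_def N.smult_l_distr N.smult_assoc1\<close>)
  moreover have "\<exists>n::nat. x [^]\<^bsub>R\<^esub> n \<in> Q" if "x \<in> I" for x
    using nil[OF that] that i(1) by (auto simp: Q_def)
  ultimately obtain a where "ideal_power R I a \<subseteq> Q"
    using ideal_power_subset_of_nil[OF assms(1) N.R.is_cring assms(4)] by blast
  then show ?thesis using L(1,3) by (intro exI[of _ a] exI[of _ L]) (auto simp: Q_def)
qed

section \<open>Finite free modules over a Noetherian ring\<close>

text \<open>The position \<open>i\<close> of the first nonzero entry plays the role of the degree in the Hilbert basis theorem.\<close>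

definition leading_coeffs :: "('r, 'k) ring_scheme \<Rightarrow> nat \<Rightarrow> (nat \<Rightarrow> 'r) set \<Rightarrow> 'r set"
  where "leading_coeffs R i K = {v i |v. v \<in> K \<and> (\<forall>j<i. v j = \<zero>\<^bsub>R\<^esub>)}"

lemma ideal_leading_coeffs:
  fixes R (structure)
  assumes "cring R" "submodule K R (free_power R k)"
  shows "ideal (leading_coeffs R i K) R"
proof -
  interpret cring R by fact
  interpret V: module R "free_power R k"
    by (rule module_power_module[OF module_ring_as_module[OF is_cring]])
  have vn: "v j \<in> carrier R" if "v \<in> K" for v j
  proof -
    have "v \<in> vecs R k" using that V.submoduleE(1)[OF assms(2)] by blast
    then show ?thesis using power_module_nth[OF module_ring_as_module[OF is_cring], of v k j] by simp
  qed
  show ?thesis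
  proof (rule ideal_if_closed)
    show "leading_coeffs R i K \<subseteq> carrier R" using vn by (auto simp: leading_coeffs_def)
    show "\<zero> \<in> leading_coeffs R i K"
      using V.submodule_zero[OF assms(2)] by (force simp: leading_coeffs_def)
    fix a b assume "a \<in> leading_coeffs R i K"
    then obtain v where v: "a = v i" "v \<in> K" "\<forall>j<i. v j = \<zero>" by (auto simp: leading_coeffs_def)
    {
      assume "b \<in> leading_coeffs R i K"
      then obtain w where w: "b = w i" "w \<in> K" "\<forall>j<i. w j = \<zero>" by (auto simp: leading_coeffs_def)
      show "a \<oplus> b \<in> leading_coeffs R i K" unfolding leading_coeffs_def
        using V.submoduleE(5)[OF assms(2) v(2) w(2)] v w
        by (auto intro!: exI[of _ "\<lambda>i. v i \<oplus> w i"])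
    }
    fix r assume "r \<in> carrier R"
    then show "r \<otimes> a \<in> leading_coeffs R i K" unfolding leading_coeffs_def
      using V.submoduleE(4)[OF assms(2) _ v(2), of r] v by (auto intro!: exI[of _ "\<lambda>i. r \<otimes> v i"])
  qed
qed

text \<open>An element of \<open>K'\<close> is reduced to \<open>0\<close> by subtracting elements of \<open>K\<close> that cancel its entries from the left to the right.\<close>

lemma submodule_subset_by_leading_coeffs:
  fixes R (structure)
  assumes "cring R" "submodule K R (free_power R k)" "submodule K' R (free_power R k)" "K \<subseteq> K'"
    and lead: "\<And>i. i < k \<Longrightarrow> leading_coeffs R i K' \<subseteq> leading_coeffs R i K"
  shows "K' \<subseteq> K"
proof -
  interpret cring R by fact
  interpret V: module R "free_power R k"
    by (rule module_power_module[OF module_ring_as_module[OF is_cring]])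
  have car: "v \<in> vecs R k" "\<And>j. v j \<in> carrier R" if "v \<in> K'" for v
  proof -
    show "v \<in> vecs R k" using that V.submoduleE(1)[OF assms(3)] by blast
    then show "v j \<in> carrier R" for j
      using power_module_nth[OF module_ring_as_module[OF is_cring], of v k j] by simp
  qed
  have "v \<in> K" if "v \<in> K'" "j \<le> k" "\<forall>i<k-j. v i = \<zero>" for v j
    using that
  proof (induction j arbitrary: v)
    case 0
    then have "v = \<zero>\<^bsub>free_power R k\<^esub>"
      using car(1)[OF 0(1)] by (auto simp: mem_power_module_iff) (metis not_le)
    then show ?case using V.submodule_zero[OF assms(2)] by simp
  next
    case (Suc j)
    let ?i = "k - Suc j"
    have "v ?i \<in> leading_coeffs R ?i K'" using Suc.prems by (auto simp: leading_coeffs_def)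
    then have "v ?i \<in> leading_coeffs R ?i K" using lead[of ?i] Suc.prems by auto
    then obtain w where w: "w \<in> K" "w ?i = v ?i" "\<forall>i<?i. w i = \<zero>" by (auto simp: leading_coeffs_def)
    let ?u = "v \<ominus>\<^bsub>free_power R k\<^esub> w"
    have wK: "w \<in> K'" using w assms(4) by blast
    have u: "?u \<in> K'" using V.submodule_minus[OF assms(3)] Suc.prems wK by blast
    have ui: "?u i = v i \<oplus> \<ominus> w i" for i
      using power_module_a_inv[OF module_ring_as_module[OF is_cring] car(1)[OF wK]] by (simp add: a_minus_def)
    have "?u i = \<zero>" if "i < k - j" for i
    proof -
      have "i < ?i \<or> i = ?i" using that by linarith
      then show ?thesis using ui w Suc.prems(3) car(2)[OF Suc.prems(1)] by (auto simp: r_neg)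
    qed
    then have uK: "?u \<in> K" using Suc u by auto
    have "v = ?u \<oplus>\<^bsub>free_power R k\<^esub> w"
      using car(1)[OF Suc.prems(1)] car(1)[OF wK]
      by (simp add: a_minus_def V.M.a_assoc V.M.l_neg del: power_module_sel)
    then show ?case using V.submoduleE(5)[OF assms(2) uK w(1)] by simp
  qed
  from this[of _ k] show ?thesis by auto
qed

lemma chain_finite_upper_bound:
  assumes "finite A" "A \<noteq> {}" "subset.chain S C" "A \<subseteq> C"
  shows "\<exists>M\<in>C. \<forall>K\<in>A. K \<subseteq> M"
  using assms
proof (induction A rule: finite_ne_induct)
  case (singleton x) then show ?case by auto
next
  case (insert x F)
  then obtain M where M: "M \<in> C" "\<forall>K\<in>F. K \<subseteq> M" by auto
  have "x \<subseteq> M \<or> M \<subseteq> x" using insert.prems M by (auto simp: subset_chain_def)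
  then show ?case
  proof
    assume "x \<subseteq> M" then show ?thesis using M by (intro bexI[of _ M]) auto
  next
    assume "M \<subseteq> x" then show ?thesis using M insert.prems by (intro bexI[of _ x]) auto
  qed
qed

text \<open>In a chain of submodules the ideals of leading coefficients reach their union for each of the \<open>k\<close> positions, and the chain
  is stationary from the largest of the members where this happens.\<close>

theorem noetherian_free_power:
  assumes "noetherian_ring R" "cring R"
  shows "noetherian_module R (free_power R k)"
  unfolding noetherian_module_def
proof (intro allI impI, elim conjE)
  fix S assume S: "S \<noteq> {}" "\<forall>K\<in>S. submodule K R (free_power R k)"
  show "\<exists>K\<in>S. \<forall>L\<in>S. K \<subseteq> L \<longrightarrow> L = K"
  proof (rule subset_Zorn_nonempty[OF S(1)])
    fix C assume C: "C \<noteq> {}" "subset.chain S C"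
    then have sub: "submodule K R (free_power R k)" if "K \<in> C" for K
      using S(2) that by (auto simp: subset_chain_def)
    have ex: "\<exists>K\<in>C. \<forall>L\<in>C. leading_coeffs R i L \<subseteq> leading_coeffs R i K" for i
    proof -
      have mono: "leading_coeffs R i K \<subseteq> leading_coeffs R i L" if "K \<subseteq> L" for K L
        using that by (auto simp: leading_coeffs_def)
      have "subset.chain {J. ideal J R} (leading_coeffs R i ` C)"
        unfolding subset_chain_def
      proof (intro conjI subsetI ballI)
        show "J \<in> {J. ideal J R}" if "J \<in> leading_coeffs R i ` C" for J
          using that sub ideal_leading_coeffs[OF assms(2)] by blast
        fix J J' assume "J \<in> leading_coeffs R i ` C" "J' \<in> leading_coeffs R i ` C"
        then obtain K L where KL: "J = leading_coeffs R i K" "J' = leading_coeffs R i L" "K \<in> C" "L \<in> C"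
          by blast
        then have "K \<subseteq> L \<or> L \<subseteq> K" using C(2) by (auto simp: subset_chain_def)
        then show "J \<subseteq> J' \<or> J' \<subseteq> J" unfolding KL(1,2) using mono by metis
      qed
      moreover have "leading_coeffs R i ` C \<noteq> {}" using C(1) by simp
      ultimately have "\<Union>(leading_coeffs R i ` C) \<in> leading_coeffs R i ` C"
        by (intro noetherian_ring.ideal_chain_is_trivial[OF assms(1)])
      then obtain K where K: "K \<in> C" "\<Union>(leading_coeffs R i ` C) = leading_coeffs R i K" by (rule imageE)
      have "leading_coeffs R i L \<subseteq> leading_coeffs R i K" if "L \<in> C" for L
        unfolding K(2)[symmetric] using that by (rule UN_upper)
      then show ?thesis using K(1) by (intro bexI[of _ K] ballI)
    qed
    then have "\<forall>i. \<exists>K. K \<in> C \<and> (\<forall>L\<in>C. leading_coeffs R i L \<subseteq> leading_coeffs R i K)" by blast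
    from choice[OF this]
    obtain K where "\<forall>i. K i \<in> C \<and> (\<forall>L\<in>C. leading_coeffs R i L \<subseteq> leading_coeffs R i (K i))" ..
    then have K: "\<And>i. K i \<in> C" "\<And>i L. L \<in> C \<Longrightarrow> leading_coeffs R i L \<subseteq> leading_coeffs R i (K i)"
      by simp_all
    \<comment> \<open>The extra index \<open>k\<close> only keeps this set of members nonempty when \<open>k = 0\<close>.\<close>
    have "finite (K ` {..k})" "K ` {..k} \<noteq> {}" "K ` {..k} \<subseteq> C" using K by auto
    from chain_finite_upper_bound[OF this(1,2) C(2) this(3)]
    obtain M where M: "M \<in> C" "\<And>i. i \<le> k \<Longrightarrow> K i \<subseteq> M" by auto
    have "L \<subseteq> M" if L: "L \<in> C" for L
    proof -
      consider "L \<subseteq> M" | "M \<subseteq> L" using C(2) L M(1) by (auto simp: subset_chain_def)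
      then show ?thesis
      proof cases
        case 2
        then show ?thesis
        proof (rule submodule_subset_by_leading_coeffs[OF assms(2) sub[OF M(1)] sub[OF L]])
          fix i assume "i < k"
          then have "leading_coeffs R i (K i) \<subseteq> leading_coeffs R i M"
            using M(2)[of i] by (auto simp: leading_coeffs_def)
          then show "leading_coeffs R i L \<subseteq> leading_coeffs R i M" using K(2)[OF L, of i] by blast
        qed
      qed
    qed
    then have "\<Union>C = M" using M(1) by blast
    then show "\<Union>C \<in> S" using M(1) C(2) by (auto simp: subset_chain_def)
  qed
qed

section \<open>The Artin--Rees property for matrices\<close>

definition ideal_vectors :: "('r, 'k) ring_scheme \<Rightarrow> nat \<Rightarrow> 'r set \<Rightarrow> (nat \<Rightarrow> 'r) set"
  where "ideal_vectors R k J = {v \<in> vecs R k. \<forall>i. v i \<in> J}"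

context matrix_module begin

lemma submodule_ideal_vectors:
  assumes "ideal J R" shows "submodule (ideal_vectors R k J) R (free_power R k)"
proof -
  interpret V: module R "free_power R k" by (rule module_vec)
  note j = ideal_mem_closed[OF assms]
  show ?thesis
    by (rule V.submodule_if_closed)
      (use j in \<open>auto simp: ideal_vectors_def vec_nth vec_zero intro!: vec_memI\<close>)
qed

lemma matrix_artin_rees:
  assumes noeth: "noetherian_ring R" and I: "ideal I R"
    and c: "\<And>i. i < p \<Longrightarrow> c i \<in> vecs R k"
  shows "\<exists>a. \<forall>v \<in> vecs R p.
    matrix_map Rm p c v \<in> ideal_vectors R k (ideal_power R I a) \<longrightarrow>
    (\<exists>v' \<in> ideal_vectors R p (ideal_power R I b). matrix_map Rm p c v' = matrix_map Rm p c v)"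
proof -
  interpret V: matrix_module R Rm by unfold_locales
  interpret P: module R "free_power R p" by (rule module_vec)
  interpret N: module R "free_power R k" by (rule module_vec)
  let ?Ib = "ideal_power R I b"
  note Ib = R.ideal_power_ideal[OF I, of b]
  note ib = ideal_mem_closed[OF Ib]
  let ?\<phi> = "matrix_map Rm p c"
  have K: "submodule (?\<phi> ` vecs R p) R (free_power R k)"
    by (rule V.submodule_matrix_map_image[OF c P.carrier_is_submodule])
  have K0: "submodule (?\<phi> ` ideal_vectors R p ?Ib) R (free_power R k)"
    by (rule V.submodule_matrix_map_image[OF c submodule_ideal_vectors[OF Ib]])
  have sub: "?\<phi> ` ideal_vectors R p ?Ib \<subseteq> ?\<phi> ` vecs R p"
    by (auto simp: ideal_vectors_def)
  have pow: "(x [^] b) \<odot>\<^bsub>free_power R k\<^esub> v \<in> ?\<phi> ` ideal_vectors R p ?Ib"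
    if x: "x \<in> I" and v: "v \<in> ?\<phi> ` vecs R p" for x v
  proof -
    obtain y where y: "v = ?\<phi> y" "y \<in> vecs R p" using v by blast
    have xb: "x [^] b \<in> ?Ib" by (rule R.pow_in_ideal_power[OF I x])
    then have xc: "x [^] b \<in> carrier R" using ib(1) by blast
    have "?\<phi> (\<lambda>i. (x [^] b) \<otimes> y i) = (x [^] b) \<odot>\<^bsub>free_power R k\<^esub> v"
      using V.matrix_map_smult[OF c y(2) xc] y(1) by simp
    moreover have "(\<lambda>i. (x [^] b) \<otimes> y i) \<in> ideal_vectors R p ?Ib"
      using y(2) xb xc ib(5) by (auto simp: ideal_vectors_def vec_nth vec_zero intro!: vec_memI)
    ultimately show ?thesis by (metis image_eqI)
  qed
  have "\<exists>a L. submodule L R (free_power R k) \<and>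
    L \<inter> ?\<phi> ` vecs R p \<subseteq> ?\<phi> ` ideal_vectors R p ?Ib \<and>
    (\<forall>r \<in> ideal_power R I a. \<forall>z \<in> vecs R k. r \<odot>\<^bsub>free_power R k\<^esub> z \<in> L)"
    by (rule weak_artin_rees[OF noeth module_vec noetherian_free_power[OF noeth R.is_cring] I K K0 sub]) (rule pow)
  then obtain a L where L: "submodule L R (free_power R k)"
    "L \<inter> ?\<phi> ` vecs R p \<subseteq> ?\<phi> ` ideal_vectors R p ?Ib"
    "\<forall>r \<in> ideal_power R I a. \<forall>z \<in> vecs R k. r \<odot>\<^bsub>free_power R k\<^esub> z \<in> L"
    by (elim exE conjE)
  have in_L: "u \<in> L" if "u \<in> ideal_vectors R k (ideal_power R I a)" for u
  proof -
    have u: "u \<in> vecs R k" "\<And>i. u i \<in> ideal_power R I a"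
      using that by (auto simp: ideal_vectors_def)
    have "finsum (free_power R k) (\<lambda>i. u i \<odot>\<^bsub>free_power R k\<^esub> unit_vec i) {..<k} \<in> L"
      by (intro N.submodule_finsum[OF L(1)] L(3)[rule_format, OF u(2)] unit_vec_closed) auto
    then show ?thesis unfolding finsum_unit_vec[OF u(1)] .
  qed
  have "\<exists>v' \<in> ideal_vectors R p ?Ib. ?\<phi> v' = ?\<phi> v"
    if "v \<in> vecs R p" "?\<phi> v \<in> ideal_vectors R k (ideal_power R I a)" for v
  proof -
    have "?\<phi> v \<in> L \<inter> ?\<phi> ` vecs R p"
      by (rule IntI, rule in_L, rule that(2), rule imageI, rule that(1))
    then have "?\<phi> v \<in> ?\<phi> ` ideal_vectors R p ?Ib" using L(2) by (rule rev_subsetD)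
    then obtain v' where "?\<phi> v = ?\<phi> v'" "v' \<in> ideal_vectors R p ?Ib" by (rule imageE)
    then show ?thesis by (intro bexI[of _ v']) simp_all
  qed
  then show ?thesis by (intro exI[of _ a]) simp
qed

text \<open>A maximal member among the submodules generated by finitely many vectors of \<open>K\<close> is all of \<open>K\<close>, because any further
  vector of \<open>K\<close> could be added as a column.\<close>

lemma submodule_finitely_generated:
  assumes noeth: "noetherian_ring R" and K: "submodule K R (free_power R k)"
  obtains p d where "\<And>j. j < p \<Longrightarrow> d j \<in> K" "K = matrix_map Rm p d ` vecs R p"
proof -
  interpret V: matrix_module R Rm by unfold_locales
  interpret N: module R "free_power R k" by (rule module_vec)
  note K' = N.submoduleE[OF K]
  define im where "im = (\<lambda>p d. matrix_map Rm p d ` vecs R p)"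
  have imsub: "submodule (im p d) R (free_power R k)" if "\<And>j. j < p \<Longrightarrow> d j \<in> K" for p d
  proof -
    interpret P: module R "free_power R p" by (rule module_vec)
    show ?thesis unfolding im_def using that K'(1)
      by (intro V.submodule_matrix_map_image[OF _ P.carrier_is_submodule]) blast
  qed
  define S where "S = {im p d |p d. \<forall>j<p. d j \<in> K}"
  have "im 0 (\<lambda>_ _. \<zero>) \<in> S" by (auto simp: S_def)
  then have "S \<noteq> {} \<and> (\<forall>L\<in>S. submodule L R (free_power R k))" using imsub by (auto simp: S_def)
  then obtain L where L: "L \<in> S" "\<And>L'. L' \<in> S \<Longrightarrow> L \<subseteq> L' \<Longrightarrow> L' = L"
    using noetherian_free_power[OF noeth R.is_cring, of k] unfolding noetherian_module_def by metis
  then obtain p d where pd: "L = im p d" "\<And>j. j < p \<Longrightarrow> d j \<in> K" by (auto simp: S_def)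
  have dc: "d j \<in> vecs R k" if "j < p" for j using pd(2)[OF that] K'(1) by blast
  have "im p d \<subseteq> K"
  proof
    fix w assume "w \<in> im p d"
    then obtain y where y: "w = matrix_map Rm p d y" "y \<in> vecs R p" by (auto simp: im_def)
    have "matrix_map Rm q d y \<in> K" if "q \<le> p" for q
      using that
    proof (induction q)
      case 0
      then show ?case using N.submodule_zero[OF K] by (simp add: matrix_map_def)
    next
      case (Suc q)
      have "matrix_map Rm (Suc q) d y = (\<lambda>i. outer Rm (d q) (y q) i \<oplus> matrix_map Rm q d y i)"
        using Suc.prems dc vec_nth[OF y(2)] by (subst V.matrix_map_Suc[of q d k y]) auto
      moreover have "outer Rm (d q) (y q) = y q \<odot>\<^bsub>free_power R k\<^esub> d q"
        using Suc.prems vec_nth[OF dc] vec_nth[OF y(2)] by (auto simp: outer_def R.m_comm)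
      ultimately have "matrix_map Rm (Suc q) d y =
          (y q \<odot>\<^bsub>free_power R k\<^esub> d q) \<oplus>\<^bsub>free_power R k\<^esub> matrix_map Rm q d y" by simp
      then show ?case using K'(5)[OF K'(4)[OF vec_nth[OF y(2)] pd(2)] Suc.IH] Suc.prems by simp
    qed
    then show "w \<in> K" using y by simp
  qed
  moreover have "K \<subseteq> im p d"
  proof
    fix v assume v: "v \<in> K"
    define d' where "d' = d(p := v)"
    have d': "d' j \<in> K" if "j < Suc p" for j using that pd(2) v by (auto simp: d'_def)
    then have d'c: "d' j \<in> vecs R k" if "j < Suc p" for j using that K'(1) by blast
    have mm: "matrix_map Rm (Suc p) d' y = (\<lambda>i. v i \<otimes> y p \<oplus> matrix_map Rm p d y i)"
      if "\<And>i. y i \<in> carrier R" for y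
    proof -
      have "matrix_map Rm (Suc p) d' y = (\<lambda>i. outer Rm (d' p) (y p) i \<oplus> matrix_map Rm p d' y i)"
        using that d'c by (subst V.matrix_map_Suc[of p d' k y]) auto
      moreover have "matrix_map Rm p d' y = matrix_map Rm p d y"
        unfolding matrix_map_def using that vec_nth[OF dc]
        by (intro ext Rm.M.finsum_cong') (auto simp: d'_def)
      ultimately show ?thesis by (simp add: outer_def d'_def)
    qed
    have vc: "v i \<in> carrier R" for i using v K'(1) vec_nth by blast
    have "im (Suc p) d' \<in> S" using d' by (auto simp: S_def)
    moreover have "im p d \<subseteq> im (Suc p) d'"
    proof
      fix w assume "w \<in> im p d"
      then obtain y where y: "w = matrix_map Rm p d y" "y \<in> vecs R p" by (auto simp: im_def)
      have "y \<in> vecs R (Suc p)" using vec_nth[OF y(2)] vec_zero[OF y(2)] by (intro vec_memI) auto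
      moreover have "matrix_map Rm (Suc p) d' y = w"
        unfolding mm[OF vec_nth[OF y(2)]] using vec_zero[OF y(2), of p] y(1) vc
          vec_nth[OF V.matrix_map_closed[OF dc y(2)]] by simp
      ultimately show "w \<in> im (Suc p) d'" unfolding im_def by blast
    qed
    ultimately have "im (Suc p) d' = im p d" using L(2) pd(1) by blast
    moreover have "v \<in> im (Suc p) d'"
      unfolding im_def using matrix_map_unit_vec[of "Suc p" d' k p, OF d'c] unit_vec_closed[of p "Suc p"]
      by (auto simp: d'_def intro!: image_eqI[of _ _ "unit_vec p"])
    ultimately show "v \<in> im p d" by simp
  qed
  ultimately show thesis using that[of p d] pd(2) unfolding im_def by blast
qed

lemma submodule_ideal_smult:
  assumes "ideal J R" shows "submodule (ideal_smult J M) R M"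
proof -
  note j = ideal_mem_closed[OF assms]
  have gens: "{r \<odot>\<^bsub>M\<^esub> x |r x. r \<in> J \<and> x \<in> carrier M} \<subseteq> carrier M" using j(1) by auto
  have sg: "subgroup (ideal_smult J M) (add_monoid M)"
    unfolding ideal_smult_def using gens by (intro M.add.generate_is_subgroup) simp
  have car: "x \<in> carrier M" if "x \<in> ideal_smult J M" for x
    using subgroup.mem_carrier[OF sg that] by simp
  show ?thesis
  proof (intro submodule.intro submodule_axioms.intro sg)
    fix a x assume a: "a \<in> carrier R" and "x \<in> ideal_smult J M"
    then have "x \<in> generate (add_monoid M) {r \<odot>\<^bsub>M\<^esub> x |r x. r \<in> J \<and> x \<in> carrier M}"
      by (simp add: ideal_smult_def)
    then show "a \<odot>\<^bsub>M\<^esub> x \<in> ideal_smult J M"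
    proof induction
      case one
      show ?case using subgroup.one_closed[OF sg] a by simp
    next
      case (incl h)
      then obtain r x where h: "h = r \<odot>\<^bsub>M\<^esub> x" "r \<in> J" "x \<in> carrier M" by blast
      then have "a \<odot>\<^bsub>M\<^esub> h = (a \<otimes> r) \<odot>\<^bsub>M\<^esub> x" using a j(1) by (auto simp: smult_assoc1)
      then show ?case unfolding ideal_smult_def using j(4)[OF a h(2)] h(3) by (auto intro!: generate.incl)
    next
      case (inv h)
      then obtain r x where h: "h = r \<odot>\<^bsub>M\<^esub> x" "r \<in> J" "x \<in> carrier M" by blast
      have hc: "h \<in> carrier M" using h j(1) by auto
      have "a \<odot>\<^bsub>M\<^esub> h = (a \<otimes> r) \<odot>\<^bsub>M\<^esub> x" using h a j(1) by (auto simp: smult_assoc1)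
      then have "a \<odot>\<^bsub>M\<^esub> h \<in> ideal_smult J M"
        unfolding ideal_smult_def using j(4)[OF a h(2)] h(3) by (auto intro!: generate.incl)
      from subgroup.m_inv_closed[OF sg this] show ?case
        using smult_r_minus[OF a hc] by (simp add: a_inv_def)
    next
      case (eng h h')
      then have "h \<in> carrier M" "h' \<in> carrier M" using car by (auto simp: ideal_smult_def)
      then show ?case using eng subgroup.m_closed[OF sg] a by (simp add: smult_r_distr)
    qed
  qed
qed

lemma smult_in_ideal_smult: "r \<in> J \<Longrightarrow> x \<in> carrier M \<Longrightarrow> r \<odot>\<^bsub>M\<^esub> x \<in> ideal_smult J M"
  unfolding ideal_smult_def by (auto intro!: generate.incl)

lemma ideal_smult_mono:
  assumes "J \<subseteq> J'" "ideal J' R" shows "ideal_smult J M \<subseteq> ideal_smult J' M"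
  unfolding ideal_smult_def
  by (rule M.add.mono_generate) (use assms in auto)

text \<open>The submodule \<open>(JM)\<^sup>k\<close> has the form \<open>LM\<close> with \<open>L = J\<^sup>k\<close>, the vectors with entries in \<open>J\<close>.\<close>

lemma ideal_smult_power_in_tensor_span:
  assumes J: "ideal J R" and m: "m \<in> mvecs M k" "\<And>i. m i \<in> ideal_smult J M"
  shows "m \<in> tensor_span M (ideal_vectors R k J)"
proof -
  interpret P: module R "power_module k M" by (rule module_pow)
  interpret V: module R "free_power R k" by (rule module_vec)
  note j = ideal_mem_closed[OF J]
  have VJ: "submodule (ideal_vectors R k J) R (free_power R k)" by (rule submodule_ideal_vectors[OF J])
  note sub = V.submoduleE(1)[OF VJ]
  have S: "submodule (tensor_span M (ideal_vectors R k J)) R (power_module k M)"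
    by (rule submodule_tensor_span[OF VJ])
  have uc: "u \<in> carrier M" if "u \<in> ideal_smult J M" for u
    using submoduleE(1)[OF submodule_ideal_smult[OF J]] that by blast
  have single: "outer M (unit_vec i) u \<in> tensor_span M (ideal_vectors R k J)"
    if i: "i < k" and "u \<in> ideal_smult J M" for i u
  proof -
    have gen: "outer M (unit_vec i) (r \<odot>\<^bsub>M\<^esub> x) \<in> tensor_span M (ideal_vectors R k J)"
      if "r \<in> J" "x \<in> carrier M" for r x
    proof -
      have "outer M (unit_vec i) (r \<odot>\<^bsub>M\<^esub> x) = outer M (\<lambda>j. if j = i then r else \<zero>) x"
        using that(2) subsetD[OF j(1) that(1)] by (auto simp: outer_def unit_vec_def)
      moreover have "(\<lambda>j. if j = i then r else \<zero>) \<in> ideal_vectors R k J"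
        using i that j(1,2) by (auto simp: ideal_vectors_def intro!: vec_memI)
      ultimately show ?thesis using outer_in_tensor_span[OF _ sub that(2)] by simp
    qed
    from that(2) have "u \<in> generate (add_monoid M) {r \<odot>\<^bsub>M\<^esub> x |r x. r \<in> J \<and> x \<in> carrier M}"
      by (simp add: ideal_smult_def)
    then show ?thesis
    proof induction
      case one
      have "outer M (unit_vec i) \<zero>\<^bsub>M\<^esub> = (\<lambda>_. \<zero>\<^bsub>M\<^esub>)" by (auto simp: outer_def unit_vec_def)
      then show ?case using tensor_span.zero by simp
    next
      case (incl h) then show ?case using gen by blast
    next
      case (inv h)
      then obtain r x where h: "h = r \<odot>\<^bsub>M\<^esub> x" "r \<in> J" "x \<in> carrier M" by blast
      have "h \<in> carrier M" using h j(1) by auto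
      then have "outer M (unit_vec i) (inv\<^bsub>add_monoid M\<^esub> h) = (\<lambda>j. \<ominus>\<^bsub>M\<^esub> outer M (unit_vec i) h j)"
        by (auto simp: outer_def unit_vec_def a_inv_def[symmetric])
      then show ?case using tensor_span_uminus[OF sub gen[OF h(2,3)]] h(1) by simp
    next
      case (eng h h')
      then have "h \<in> carrier M" "h' \<in> carrier M" using uc by (auto simp: ideal_smult_def)
      then have "outer M (unit_vec i) (h \<otimes>\<^bsub>add_monoid M\<^esub> h') =
        (\<lambda>j. outer M (unit_vec i) h j \<oplus>\<^bsub>M\<^esub> outer M (unit_vec i) h' j)"
        by (auto simp: outer_def unit_vec_def)
      then show ?case using tensor_span_add[OF sub eng.IH] by simp
    qed
  qed
  have "finsum (power_module k M) (\<lambda>i. outer M (unit_vec i) (m i)) {..<k} \<in> tensor_span M (ideal_vectors R k J)"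
    using single m(2) by (intro P.submodule_finsum[OF S]) auto
  then show ?thesis by (simp add: finsum_outer_unit_vec[OF m(1)])
qed

end

text \<open>The preimage of \<open>I\<^sup>aM\<^sup>k\<close> under \<open>c\<close> is \<open>LM\<close>, where \<open>L\<close> is the preimage of the vectors over \<open>R\<close> with entries in \<open>I\<^sup>a\<close>
  (by flatness), and \<open>L\<close> is contained in the sum of the kernel of \<open>c\<close> and the vectors with entries in \<open>I\<^sup>b\<close>
  (by Artin--Rees for the image of \<open>c\<close>).\<close>

lemma flat_artin_rees:
  fixes R :: "('a, 'r) ring_scheme" and M :: "('a, 'b, 'm) module_scheme"
  assumes flat: "flat_module TYPE((nat \<Rightarrow> 'a) set) R M"
    and noeth: "noetherian_ring R" and I: "ideal I R"
    and c: "\<And>i. i < p \<Longrightarrow> c i \<in> vecs R k"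
  shows "\<exists>a. \<forall>y \<in> mvecs M p.
    (\<forall>l. matrix_map M p c y l \<in> ideal_smult (ideal_power R I a) M) \<longrightarrow>
    (\<exists>y' \<in> mvecs M p. \<exists>w \<in> tensor_span M
        {v \<in> vecs R p. matrix_map (ring_as_module R) p c v = (\<lambda>_. \<zero>\<^bsub>R\<^esub>)}.
      (\<forall>i. y' i \<in> ideal_smult (ideal_power R I b) M) \<and> y = (\<lambda>i. y' i \<oplus>\<^bsub>M\<^esub> w i))"
proof -
  interpret module R M using flat by (simp add: flat_module_def)
  interpret matrix_module R M by unfold_locales
  interpret V: matrix_module R Rm by unfold_locales
  interpret P: module R "free_power R p" by (rule module_vec)
  interpret PM: module R "power_module p M" by (rule module_pow)
  let ?\<phi> = "matrix_map Rm p c"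
  let ?K = "{v \<in> vecs R p. ?\<phi> v = (\<lambda>_. \<zero>\<^bsub>R\<^esub>)}"
  have "\<exists>a. \<forall>v \<in> vecs R p.
    ?\<phi> v \<in> ideal_vectors R k (ideal_power R I a) \<longrightarrow>
    (\<exists>v' \<in> ideal_vectors R p (ideal_power R I b). ?\<phi> v' = ?\<phi> v)"
    by (rule matrix_artin_rees[OF noeth I]) (rule c)
  then obtain a where a: "\<forall>v \<in> vecs R p.
    ?\<phi> v \<in> ideal_vectors R k (ideal_power R I a) \<longrightarrow>
    (\<exists>v' \<in> ideal_vectors R p (ideal_power R I b). ?\<phi> v' = ?\<phi> v)" ..
  let ?JM = "ideal_smult (ideal_power R I b) M"
  note JM = submodule_ideal_smult[OF R.ideal_power_ideal[OF I, of b]]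
  have "\<exists>y' \<in> mvecs M p. \<exists>w \<in> tensor_span M ?K.
      (\<forall>i. y' i \<in> ?JM) \<and> y = (\<lambda>i. y' i \<oplus>\<^bsub>M\<^esub> w i)"
    if y: "y \<in> mvecs M p" "\<And>l. matrix_map M p c y l \<in> ideal_smult (ideal_power R I a) M" for y
  proof -
    have "matrix_map M p c y \<in> tensor_span M (ideal_vectors R k (ideal_power R I a))"
      using y matrix_map_closed[OF c y(1)] by (intro ideal_smult_power_in_tensor_span R.ideal_power_ideal[OF I])
    then have "y \<in> tensor_span M {v \<in> vecs R p.
        ?\<phi> v \<in> ideal_vectors R k (ideal_power R I a)}"
      using flat_imp_tensor_span_preimage[OF flat _ submodule_ideal_vectors[OF R.ideal_power_ideal[OF I]] y(1), of c] c
      by simp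
    then show ?thesis
    proof induction
      case zero
      show ?case
        by (rule bexI[of _ "\<lambda>_. \<zero>\<^bsub>M\<^esub>"], rule bexI[of _ "\<lambda>_. \<zero>\<^bsub>M\<^esub>"])
          (use submodule_zero[OF JM] in \<open>auto intro: tensor_span.zero pow_memI\<close>)
    next
      case (add v u w)
      obtain y' w' where IH: "y' \<in> mvecs M p" "w' \<in> tensor_span M ?K"
        "\<And>i. y' i \<in> ?JM" "w = (\<lambda>i. y' i \<oplus>\<^bsub>M\<^esub> w' i)" using add.IH by blast
      have v: "v \<in> vecs R p" "?\<phi> v \<in> ideal_vectors R k (ideal_power R I a)" using add by auto
      obtain v' where v': "v' \<in> ideal_vectors R p (ideal_power R I b)" "?\<phi> v' = ?\<phi> v" using a[rule_format, OF v] by (rule bexE)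
      have v'c: "v' \<in> vecs R p" using v' by (auto simp: ideal_vectors_def)
      define \<kappa> where "\<kappa> = v \<ominus>\<^bsub>free_power R p\<^esub> v'"
      have \<kappa>c: "\<kappa> \<in> vecs R p" using v v'c by (simp add: \<kappa>_def)
      have vk: "v = (\<lambda>i. \<kappa> i \<oplus>\<^bsub>R\<^esub> v' i)"
      proof -
        have "v = \<kappa> \<oplus>\<^bsub>free_power R p\<^esub> v'"
          using v v'c by (simp add: \<kappa>_def a_minus_def P.M.a_assoc P.M.l_neg del: power_module_sel)
        then show ?thesis by simp
      qed
      have "?\<phi> \<kappa> = (\<lambda>_. \<zero>\<^bsub>R\<^esub>)"
      proof
        fix l
        have absorb: "?\<phi> v l = ?\<phi> \<kappa> l \<oplus>\<^bsub>R\<^esub> ?\<phi> v l"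
        proof -
          have "?\<phi> (\<lambda>i. \<kappa> i \<oplus>\<^bsub>Rm\<^esub> v' i) l = ?\<phi> \<kappa> l \<oplus>\<^bsub>Rm\<^esub> ?\<phi> v' l"
            by (subst V.matrix_map_add[OF c \<kappa>c v'c]) auto
          then show ?thesis using v'(2) by (subst vk) simp
        qed
        show "?\<phi> \<kappa> l = \<zero>\<^bsub>R\<^esub>"
        proof -
          have "?\<phi> \<kappa> \<in> vecs R k" "?\<phi> v \<in> vecs R k"
            using V.matrix_map_closed[of p c k] c \<kappa>c v(1) by simp_all
          then show ?thesis
            using R.add.r_cancel_one'[of "?\<phi> v l" "?\<phi> \<kappa> l"] absorb vec_nth by blast
        qed
      qed
      then have \<kappa>K: "\<kappa> \<in> ?K" using \<kappa>c by simp
      have cl: "v' i \<in> carrier R" "\<kappa> i \<in> carrier R" "y' i \<in> carrier M" "w' i \<in> carrier M" for i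
        using v'c \<kappa>c vec_nth IH(1) pow_nth tensor_span_closed[of ?K p, OF _ IH(2)] by blast+
      have u: "u \<in> carrier M" by fact
      show ?case
      proof (rule bexI[of _ "\<lambda>i. outer M v' u i \<oplus>\<^bsub>M\<^esub> y' i"], rule bexI[of _ "\<lambda>i. outer M \<kappa> u i \<oplus>\<^bsub>M\<^esub> w' i"], intro conjI allI)
        show "outer M v' u i \<oplus>\<^bsub>M\<^esub> y' i \<in> ?JM" for i
          using v'(1) u IH(3) submoduleE(5)[OF JM] smult_in_ideal_smult
          by (auto simp: outer_def ideal_vectors_def)
        show "(\<lambda>i. outer M v u i \<oplus>\<^bsub>M\<^esub> w i) =
          (\<lambda>i. outer M v' u i \<oplus>\<^bsub>M\<^esub> y' i \<oplus>\<^bsub>M\<^esub> (outer M \<kappa> u i \<oplus>\<^bsub>M\<^esub> w' i))"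
        proof
          fix i
          have "outer M v u i = outer M \<kappa> u i \<oplus>\<^bsub>M\<^esub> outer M v' u i"
            using cl u by (subst vk) (simp add: outer_def smult_l_distr)
          then show "outer M v u i \<oplus>\<^bsub>M\<^esub> w i = outer M v' u i \<oplus>\<^bsub>M\<^esub> y' i \<oplus>\<^bsub>M\<^esub> (outer M \<kappa> u i \<oplus>\<^bsub>M\<^esub> w' i)"
            using cl u by (simp add: IH(4) outer_def M.a_ac)
        qed
        show "(\<lambda>i. outer M \<kappa> u i \<oplus>\<^bsub>M\<^esub> w' i) \<in> tensor_span M ?K"
          by (rule tensor_span.add[OF \<kappa>K u IH(2)])
        show "(\<lambda>i. outer M v' u i \<oplus>\<^bsub>M\<^esub> y' i) \<in> mvecs M p"
          using PM.M.a_closed[OF outer_closed[OF v'c u] IH(1)] by simp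
      qed
    qed
  qed
  then show ?thesis by blast
qed

section \<open>Adic completion\<close>

locale adic_module = matrix_module R M for R (structure) and M (structure) +
  fixes I assumes ideal_I: "ideal I R"
begin

abbreviation filt where "filt s \<equiv> ideal_smult (ideal_power R I s) M"

lemma submodule_filt: "submodule (filt s) R M"
  by (rule submodule_ideal_smult[OF R.ideal_power_ideal[OF ideal_I]])

sublocale Q: quotient_module R M "filt s" for s
  by (intro quotient_module.intro quotient_module_axioms.intro module_axioms submodule_filt)

abbreviation quo where "quo s x \<equiv> filt s +>\<^bsub>M\<^esub> x"

lemma filt_antimono: "s \<le> t \<Longrightarrow> filt t \<subseteq> filt s"
  by (rule ideal_smult_mono[OF R.ideal_power_antimono[OF ideal_I] R.ideal_power_ideal[OF ideal_I]])

lemma quo_coarsen: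
  assumes "quo t x = quo t y" "s \<le> t" "x \<in> carrier M" "y \<in> carrier M"
  shows "quo s x = quo s y"
  using assms filt_antimono[OF assms(2)] Q.cls_eq_iff by blast

lemma quo_add_cong:
  assumes "quo s x = quo s x'" "quo s y = quo s y'"
    "x \<in> carrier M" "y \<in> carrier M" "x' \<in> carrier M" "y' \<in> carrier M"
  shows "quo s (x \<oplus>\<^bsub>M\<^esub> y) = quo s (x' \<oplus>\<^bsub>M\<^esub> y')"
  using assms Q.Q_add[of x y s] Q.Q_add[of x' y' s] by simp

lemma quo_smult_cong:
  assumes "quo s x = quo s x'" "x \<in> carrier M" "x' \<in> carrier M" "r \<in> carrier R"
  shows "quo s (r \<odot>\<^bsub>M\<^esub> x) = quo s (r \<odot>\<^bsub>M\<^esub> x')"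
  using assms Q.Q_smult[of r x s] Q.Q_smult[of r x' s] by simp

text \<open>Elements of the completion are represented by sequences in \<open>M\<close> itself. Congruence modulo \<open>I\<^sup>sM\<close> is
  written as equality of cosets, so that it is transitive for the simplifier.\<close>

definition coherent where
  "coherent z \<longleftrightarrow> (\<forall>s. z s \<in> carrier M) \<and> (\<forall>s. quo s (z (Suc s)) = quo s (z s))"

definition adic_lim where "adic_lim z = (\<lambda>s. quo s (z s))"

abbreviation Mhat where "Mhat \<equiv> completion R I M"

lemma coherent_closed: "coherent z \<Longrightarrow> z s \<in> carrier M"
  by (simp add: coherent_def)

lemma coherent_quo:
  assumes "coherent z" "s \<le> t" shows "quo s (z t) = quo s (z s)"
  using assms(2)
proof (induction rule: dec_induct)
  case (step n)
  have "quo n (z (Suc n)) = quo n (z n)" using assms(1) by (simp add: coherent_def)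
  then have "quo s (z (Suc n)) = quo s (z n)"
    using quo_coarsen step(1) coherent_closed[OF assms(1)] by blast
  then show ?case using step by simp
qed simp

lemma lim_eq_iff: "adic_lim z = adic_lim w \<longleftrightarrow> (\<forall>s. quo s (z s) = quo s (w s))"
  by (auto simp: adic_lim_def fun_eq_iff)

lemma transition:
  assumes "x \<in> carrier M"
  shows "filt s <+>\<^bsub>M\<^esub> (quo (Suc s) x) = quo s x"
proof
  show "filt s <+>\<^bsub>M\<^esub> (quo (Suc s) x) \<subseteq> quo s x"
  proof
    fix u assume "u \<in> filt s <+>\<^bsub>M\<^esub> (quo (Suc s) x)"
    then obtain h k where hk: "u = h \<oplus>\<^bsub>M\<^esub> (k \<oplus>\<^bsub>M\<^esub> x)" "h \<in> filt s" "k \<in> filt (Suc s)"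
      by (auto simp: set_add_def' a_r_coset_def')
    have "k \<in> filt s" using hk(3) filt_antimono[of s "Suc s"] by auto
    then have "h \<oplus>\<^bsub>M\<^esub> k \<in> filt s" using hk(2) by (rule Q.K_add[rotated])
    moreover have "u = (h \<oplus>\<^bsub>M\<^esub> k) \<oplus>\<^bsub>M\<^esub> x"
      using hk Q.K_closed[OF hk(2)] Q.K_closed[OF hk(3)] assms by (simp add: M.a_assoc)
    ultimately show "u \<in> quo s x" by (auto simp: a_r_coset_def')
  qed
  show "quo s x \<subseteq> filt s <+>\<^bsub>M\<^esub> (quo (Suc s) x)"
  proof
    fix u assume "u \<in> quo s x"
    then obtain h where h: "u = h \<oplus>\<^bsub>M\<^esub> x" "h \<in> filt s" by (auto simp: a_r_coset_def')
    have "x \<in> quo t x" for t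
      using Q.mem_cls_iff[OF assms, of x] Q.K_zero assms by (simp add: a_minus_def M.r_neg)
    then have "x \<in> quo (Suc s) x" .
    then show "u \<in> filt s <+>\<^bsub>M\<^esub> (quo (Suc s) x)" unfolding set_add_def' h(1) using h(2) by blast
  qed
qed

lemma carrier_completion: "carrier Mhat = adic_lim ` {z. coherent z}"
proof
  have car: "carrier Mhat = {A. (\<forall>s. A s \<in> carrier (quot_module M (filt s))) \<and> (\<forall>s. filt s <+>\<^bsub>M\<^esub> A (Suc s) = A s)}"
    by (simp add: completion_def Let_def)
  show "carrier Mhat \<subseteq> adic_lim ` {z. coherent z}"
  proof
    fix A assume "A \<in> carrier Mhat"
    then have A: "\<And>s. A s \<in> quo s ` carrier M" "\<And>s. filt s <+>\<^bsub>M\<^esub> A (Suc s) = A s"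
      unfolding car by (auto simp: Q.carrier_Q)
    from A(1) have "\<forall>s. \<exists>x. x \<in> carrier M \<and> A s = quo s x" by blast
    from choice[OF this] obtain z where z: "\<And>s. z s \<in> carrier M" "\<And>s. A s = quo s (z s)" by blast
    have "coherent z" using z(1) A(2) z(2) transition by (simp add: coherent_def)
    moreover have "A = adic_lim z" using z(2) by (auto simp: adic_lim_def)
    ultimately show "A \<in> adic_lim ` {z. coherent z}" by blast
  qed
  show "adic_lim ` {z. coherent z} \<subseteq> carrier Mhat"
  proof
    fix A assume "A \<in> adic_lim ` {z. coherent z}"
    then obtain z where z: "A = adic_lim z" "coherent z" by blast
    have "filt s <+>\<^bsub>M\<^esub> A (Suc s) = A s" for s
    proof -
      have "filt s <+>\<^bsub>M\<^esub> A (Suc s) = quo s (z (Suc s))"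
        unfolding z(1) adic_lim_def by (rule transition[OF coherent_closed[OF z(2)]])
      then show ?thesis using z by (simp add: adic_lim_def coherent_def)
    qed
    moreover have "A s \<in> carrier (quot_module M (filt s))" for s
      using coherent_closed[OF z(2)] by (simp add: z(1) adic_lim_def Q.carrier_Q)
    ultimately show "A \<in> carrier Mhat" unfolding car by blast
  qed
qed

lemma coherent_const: "x \<in> carrier M \<Longrightarrow> coherent (\<lambda>_. x)"
  by (simp add: coherent_def)

lemma coherent_add:
  assumes "coherent z" "coherent w" shows "coherent (\<lambda>s. z s \<oplus>\<^bsub>M\<^esub> w s)"
  unfolding coherent_def
proof (intro conjI allI)
  fix s
  show "quo s (z (Suc s) \<oplus>\<^bsub>M\<^esub> w (Suc s)) = quo s (z s \<oplus>\<^bsub>M\<^esub> w s)"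
    by (rule quo_add_cong) (use assms in \<open>auto simp: coherent_def\<close>)
qed (use assms in \<open>auto simp: coherent_def\<close>)

lemma coherent_smult:
  assumes "coherent z" "r \<in> carrier R" shows "coherent (\<lambda>s. r \<odot>\<^bsub>M\<^esub> z s)"
  unfolding coherent_def
proof (intro conjI allI)
  fix s
  show "quo s (r \<odot>\<^bsub>M\<^esub> z (Suc s)) = quo s (r \<odot>\<^bsub>M\<^esub> z s)"
    by (rule quo_smult_cong) (use assms in \<open>auto simp: coherent_def\<close>)
qed (use assms in \<open>auto simp: coherent_def\<close>)

lemma completion_zero: "\<zero>\<^bsub>Mhat\<^esub> = adic_lim (\<lambda>_. \<zero>\<^bsub>M\<^esub>)"
  unfolding completion_def Let_def adic_lim_def ring.simps by (rule ext) (rule Q.Q_zero)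

lemma completion_add:
  "coherent z \<Longrightarrow> coherent w \<Longrightarrow> adic_lim z \<oplus>\<^bsub>Mhat\<^esub> adic_lim w = adic_lim (\<lambda>s. z s \<oplus>\<^bsub>M\<^esub> w s)"
  by (simp add: completion_def Let_def adic_lim_def Q.Q_add coherent_closed)

lemma completion_smult:
  "coherent z \<Longrightarrow> r \<in> carrier R \<Longrightarrow> r \<odot>\<^bsub>Mhat\<^esub> adic_lim z = adic_lim (\<lambda>s. r \<odot>\<^bsub>M\<^esub> z s)"
  by (simp add: completion_def Let_def adic_lim_def Q.Q_smult coherent_closed)

lemma module_completion: "module R Mhat"
proof (rule moduleI_without_inverses)
  show "cring R" by (rule R.is_cring)
  show "\<zero>\<^bsub>Mhat\<^esub> \<in> carrier Mhat"
    by (auto simp: completion_zero carrier_completion intro!: coherent_const)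
  fix x y z assume "x \<in> carrier Mhat" "y \<in> carrier Mhat" "z \<in> carrier Mhat"
  then obtain x' y' z' where x: "x = adic_lim x'" "coherent x'" "y = adic_lim y'" "coherent y'" "z = adic_lim z'" "coherent z'"
    unfolding carrier_completion by blast
  show "x \<oplus>\<^bsub>Mhat\<^esub> y = y \<oplus>\<^bsub>Mhat\<^esub> x"
    using x by (simp add: completion_add M.a_comm coherent_closed)
  show "x \<oplus>\<^bsub>Mhat\<^esub> y \<oplus>\<^bsub>Mhat\<^esub> z = x \<oplus>\<^bsub>Mhat\<^esub> (y \<oplus>\<^bsub>Mhat\<^esub> z)"
    using x by (simp add: completion_add M.a_assoc coherent_closed coherent_add)
qed (auto simp: carrier_completion completion_add completion_smult completion_zero coherent_add coherent_smult
    coherent_closed coherent_const smult_l_distr smult_r_distr smult_assoc1)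

lemma finsum_completion:
  assumes "finite A" "\<And>i. i \<in> A \<Longrightarrow> coherent (z i)"
  shows "coherent (\<lambda>s. finsum M (\<lambda>i. z i s) A) \<and>
    finsum Mhat (\<lambda>i. adic_lim (z i)) A = adic_lim (\<lambda>s. finsum M (\<lambda>i. z i s) A)"
  using assms
proof (induction A rule: finite_induct)
  interpret H: module R Mhat by (rule module_completion)
  {
    case empty then show ?case by (simp add: completion_zero coherent_const)
  next
    case (insert a A)
    have e: "finsum M (\<lambda>i. z i s) (insert a A) = z a s \<oplus>\<^bsub>M\<^esub> finsum M (\<lambda>i. z i s) A" for s
      using insert coherent_closed by (subst M.finsum_insert) auto
    have "finsum Mhat (\<lambda>i. adic_lim (z i)) (insert a A) = adic_lim (z a) \<oplus>\<^bsub>Mhat\<^esub> finsum Mhat (\<lambda>i. adic_lim (z i)) A"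
      using insert by (subst H.M.finsum_insert) (auto simp: carrier_completion)
    then show ?case unfolding e using insert by (simp add: completion_add coherent_add)
  }
qed

lemma matrix_map_completion:
  assumes "\<And>i. i < p \<Longrightarrow> c i \<in> vecs R k" "\<And>i. coherent (\<lambda>s. z s i)"
  shows "matrix_map Mhat p c (\<lambda>i. adic_lim (\<lambda>s. z s i)) l = adic_lim (\<lambda>s. matrix_map M p c (z s) l)"
proof -
  interpret H: module R Mhat by (rule module_completion)
  have cl: "c i l \<in> carrier R" if "i < p" for i using assms(1)[OF that] by (rule vec_nth)
  have co: "coherent (\<lambda>s. c i l \<odot>\<^bsub>M\<^esub> z s i)" if "i < p" for i
    using cl[OF that] assms(2) by (intro coherent_smult)
  have "matrix_map Mhat p c (\<lambda>i. adic_lim (\<lambda>s. z s i)) l = finsum Mhat (\<lambda>i. adic_lim (\<lambda>s. c i l \<odot>\<^bsub>M\<^esub> z s i)) {..<p}"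
    unfolding matrix_map_def using cl co assms(2)
    by (intro H.M.finsum_cong') (auto simp: completion_smult carrier_completion)
  also have "\<dots> = adic_lim (\<lambda>s. matrix_map M p c (z s) l)"
    unfolding matrix_map_def using finsum_completion[of "{..<p}" "\<lambda>i s. c i l \<odot>\<^bsub>M\<^esub> z s i"] co by simp
  finally show ?thesis .
qed

end

section \<open>Flatness of the completion\<close>

text \<open>Two uses of \<open>flat_artin_rees\<close>: for \<open>c\<close> it gives the approximations \<open>d \<kappa>\<^sub>b\<close> of \<open>z\<close>, and for \<open>d\<close> it makes
  the coefficient vectors converge.\<close>

theorem completion_equationally_flat:
  fixes R :: "('a, 'r) ring_scheme" and M :: "('a, 'b, 'm) module_scheme"
  assumes flat: "flat_module TYPE((nat \<Rightarrow> 'a) set) R M"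
    and noeth: "noetherian_ring R" and I: "ideal I R"
  shows "equationally_flat R (completion R I M)"
  unfolding equationally_flat_def
proof (intro allI impI)
  interpret module R M using flat by (simp add: flat_module_def)
  interpret matrix_module R M by unfold_locales
  interpret adic_module R M I
    by (intro adic_module.intro adic_module_axioms.intro matrix_module_axioms I)
  interpret V: matrix_module R Rm by unfold_locales
  interpret H: module R Mhat by (rule module_completion)
  interpret H: matrix_module R Mhat by unfold_locales
  fix p k c z
  assume c: "\<forall>i<p. c i \<in> vecs R k" and z: "z \<in> mvecs Mhat p"
    and zero: "matrix_map Mhat p c z = (\<lambda>_. \<zero>\<^bsub>Mhat\<^esub>)"
  have c: "c i \<in> vecs R k" if "i < p" for i using c that by blast
  let ?K = "{v \<in> vecs R p. matrix_map Rm p c v = (\<lambda>_. \<zero>\<^bsub>R\<^esub>)}"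
  interpret N: module R "free_power R k" by (rule module_vec)
  interpret P: module R "free_power R p" by (rule module_vec)
  have "submodule {\<lambda>_. \<zero>\<^bsub>R\<^esub>} R (free_power R k)"
    by (rule N.submodule_if_closed) (auto intro: vec_memI)
  from V.submodule_preimage[OF c this] have K: "submodule ?K R (free_power R p)" by simp
  obtain q d where d: "\<And>j. j < q \<Longrightarrow> d j \<in> ?K" and Kd: "?K = matrix_map Rm q d ` vecs R q"
    using submodule_finitely_generated[OF noeth K] by blast
  have dc: "d j \<in> vecs R p" if "j < q" for j using d[OF that] by blast

  have zi: "\<exists>w. coherent w \<and> z i = adic_lim w \<and> (p \<le> i \<longrightarrow> w = (\<lambda>_. \<zero>\<^bsub>M\<^esub>))" for i
  proof (cases "i < p")
    case True
    then have "z i \<in> carrier Mhat" using z by (simp add: mem_power_module_iff)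
    then show ?thesis using True by (auto simp: carrier_completion)
  next
    case False
    then have "z i = adic_lim (\<lambda>_. \<zero>\<^bsub>M\<^esub>)" using z completion_zero by (simp add: mem_power_module_iff)
    then show ?thesis using coherent_const by blast
  qed
  then have "\<forall>i. \<exists>w. coherent w \<and> z i = adic_lim w \<and> (p \<le> i \<longrightarrow> w = (\<lambda>_. \<zero>\<^bsub>M\<^esub>))" by blast
  from choice[OF this] obtain W where W: "\<And>i. coherent (W i)" "\<And>i. z i = adic_lim (W i)"
    "\<And>i. p \<le> i \<Longrightarrow> W i = (\<lambda>_. \<zero>\<^bsub>M\<^esub>)" by blast
  define Z where "Z = (\<lambda>s i. W i s)"
  have Zc: "coherent (\<lambda>s. Z s i)" and zZ: "z i = adic_lim (\<lambda>s. Z s i)" for i using W by (auto simp: Z_def)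
  have Zp: "Z s \<in> mvecs M p" for s
    using coherent_closed[OF Zc] W(3) by (intro pow_memI) (auto simp: Z_def)
  have Zn: "Z s i \<in> carrier M" for s i using pow_nth[OF Zp] .
  have cZ: "matrix_map M p c (Z s) l \<in> filt s" for s l
  proof -
    have "adic_lim (\<lambda>s. matrix_map M p c (Z s) l) = adic_lim (\<lambda>_. \<zero>\<^bsub>M\<^esub>)"
    proof -
      have "(\<lambda>i. adic_lim (\<lambda>s. Z s i)) = z" by (rule ext) (simp add: zZ)
      then show ?thesis
        using matrix_map_completion[of p c k Z l, OF c Zc] zero completion_zero by simp
    qed
    then have "quo s (matrix_map M p c (Z s) l) = quo s \<zero>\<^bsub>M\<^esub>" by (simp add: lim_eq_iff)
    then show ?thesis
      using Q.cls_eq_zero_iff[OF pow_nth[OF matrix_map_closed[OF c Zp]]] Q.cls_zero by simp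
  qed

  \<comment> \<open>Flatness of \<open>M\<close> for \<open>c\<close>: the representatives are congruent to elements of the image of \<open>d\<close>.\<close>
  have approx: "\<exists>\<kappa> \<in> mvecs M q. \<forall>i. quo b (matrix_map M q d \<kappa> i) = quo b (Z b i)" for b
  proof -
    obtain a where a: "\<And>y. y \<in> mvecs M p \<Longrightarrow> (\<forall>l. matrix_map M p c y l \<in> filt a) \<Longrightarrow>
      \<exists>y' \<in> mvecs M p. \<exists>w \<in> tensor_span M ?K.
      (\<forall>i. y' i \<in> filt b) \<and> y = (\<lambda>i. y' i \<oplus>\<^bsub>M\<^esub> w i)"
      using flat_artin_rees[OF flat noeth I, of p c k b] c by blast
    \<comment> \<open>The exponent \<open>a\<close> makes the decomposition possible, and \<open>b\<close> brings \<open>Z s\<close> back to \<open>Z b\<close>.\<close>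
    define s where "s = max a b"
    have "\<forall>l. matrix_map M p c (Z s) l \<in> filt a"
      using cZ[of s] filt_antimono[of a s] by (auto simp: s_def)
    from a[OF Zp this] obtain y' w where y': "y' \<in> mvecs M p" "w \<in> tensor_span M ?K"
      "\<And>i. y' i \<in> filt b" "Z s = (\<lambda>i. y' i \<oplus>\<^bsub>M\<^esub> w i)" by blast
    obtain \<kappa> where \<kappa>: "\<kappa> \<in> mvecs M q" "w = matrix_map M q d \<kappa>"
      using tensor_span_image[of q d p w, OF dc] y'(2) unfolding Kd by blast
    have wn: "w i \<in> carrier M" for i
      using pow_nth[OF matrix_map_closed[OF dc \<kappa>(1)]] \<kappa>(2) by simp
    have "quo b (w i) = quo b (Z b i)" for i
    proof -
      have y'n: "y' i \<in> carrier M" using pow_nth[OF y'(1)] .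
      have "quo b (y' i) = quo b \<zero>\<^bsub>M\<^esub>" using Q.cls_eq_zero_iff[OF y'n] y'(3) Q.cls_zero by simp
      then have "quo b (y' i \<oplus>\<^bsub>M\<^esub> w i) = quo b (\<zero>\<^bsub>M\<^esub> \<oplus>\<^bsub>M\<^esub> w i)"
        using y'n wn by (intro quo_add_cong) auto
      then have "quo b (w i) = quo b (Z s i)" using wn y'(4) by simp
      also have "\<dots> = quo b (Z b i)" using coherent_quo[OF Zc, of b s] by (simp add: s_def)
      finally show ?thesis .
    qed
    then show ?thesis using \<kappa> by blast
  qed
  then have "\<forall>b. \<exists>\<kappa>. \<kappa> \<in> mvecs M q \<and> (\<forall>i. quo b (matrix_map M q d \<kappa> i) = quo b (Z b i))"
    by blast
  from choice[OF this] obtain \<kappa>0 where \<kappa>0: "\<And>b. \<kappa>0 b \<in> mvecs M q"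
    "\<And>b i. quo b (matrix_map M q d (\<kappa>0 b) i) = quo b (Z b i)" by blast

  \<comment> \<open>Flatness of \<open>M\<close> for \<open>d\<close>: a vector with small image can be replaced by a small vector with the same image.\<close>
  have "\<exists>a. \<forall>y. y \<in> mvecs M q \<longrightarrow> (\<forall>l. matrix_map M q d y l \<in> filt a) \<longrightarrow>
    (\<exists>y'. y' \<in> mvecs M q \<and> (\<forall>i. y' i \<in> filt b) \<and> matrix_map M q d y' = matrix_map M q d y)" for b
  proof -
    let ?L = "{v \<in> vecs R q. matrix_map Rm q d v = (\<lambda>_. \<zero>\<^bsub>R\<^esub>)}"
    obtain a where a: "\<And>y. y \<in> mvecs M q \<Longrightarrow> (\<forall>l. matrix_map M q d y l \<in> filt a) \<Longrightarrow>
      \<exists>y' \<in> mvecs M q. \<exists>w \<in> tensor_span M ?L.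
      (\<forall>i. y' i \<in> filt b) \<and> y = (\<lambda>i. y' i \<oplus>\<^bsub>M\<^esub> w i)"
      using flat_artin_rees[OF flat noeth I, of q d p b] dc by blast
    have "\<exists>y'. y' \<in> mvecs M q \<and> (\<forall>i. y' i \<in> filt b) \<and> matrix_map M q d y' = matrix_map M q d y"
      if y: "y \<in> mvecs M q" "\<forall>l. matrix_map M q d y l \<in> filt a" for y
    proof -
      from a[OF y] obtain y' w where y': "y' \<in> mvecs M q" "w \<in> tensor_span M ?L"
        "\<forall>i. y' i \<in> filt b" "y = (\<lambda>i. y' i \<oplus>\<^bsub>M\<^esub> w i)" by blast
      have w: "w \<in> mvecs M q" using tensor_span_closed[OF _ y'(2), of q] by blast
      have "matrix_map M q d y = (\<lambda>l. matrix_map M q d y' l \<oplus>\<^bsub>M\<^esub> matrix_map M q d w l)"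
        unfolding y'(4) by (rule matrix_map_add[OF dc y'(1) w])
      also have "\<dots> = matrix_map M q d y'"
        using matrix_map_tensor_span_kernel[OF dc y'(2)] pow_nth[OF matrix_map_closed[OF dc y'(1)]] by simp
      finally show ?thesis using y' by (intro exI[of _ y']) simp
    qed
    then show ?thesis by blast
  qed
  then have "\<forall>b. \<exists>a. \<forall>y. y \<in> mvecs M q \<longrightarrow> (\<forall>l. matrix_map M q d y l \<in> filt a) \<longrightarrow>
    (\<exists>y'. y' \<in> mvecs M q \<and> (\<forall>i. y' i \<in> filt b) \<and> matrix_map M q d y' = matrix_map M q d y)"
    by (rule allI)
  from choice[OF this] obtain a0 where a0: "\<And>b y. y \<in> mvecs M q \<Longrightarrow>
    (\<And>l. matrix_map M q d y l \<in> filt (a0 b)) \<Longrightarrow>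
    \<exists>y'. y' \<in> mvecs M q \<and> (\<forall>i. y' i \<in> filt b) \<and> matrix_map M q d y' = matrix_map M q d y"
    by blast
  \<comment> \<open>The sum makes the exponents increasing and at least as large as \<open>a0 b\<close> and \<open>b\<close>.\<close>
  define a where "a = (\<lambda>b. b + (\<Sum>i\<le>b. a0 i))"
  have a: "a0 b \<le> a b" "b \<le> a b" "a b \<le> a (Suc b)" for b
    using member_le_sum[of b "{..b}" a0] by (auto simp: a_def)
  define \<kappa> where "\<kappa> = (\<lambda>b. \<kappa>0 (a b))"
  have \<kappa>p: "\<kappa> b \<in> mvecs M q" for b using \<kappa>0(1) by (simp add: \<kappa>_def)
  have \<kappa>n: "matrix_map M q d (\<kappa> b) l \<in> carrier M" for b l
    using pow_nth[OF matrix_map_closed[OF dc \<kappa>p]] .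
  have \<kappa>: "quo s (matrix_map M q d (\<kappa> b) i) = quo s (Z s i)" if "s \<le> a b" for s b i
  proof -
    have "quo (a b) (matrix_map M q d (\<kappa> b) i) = quo (a b) (Z (a b) i)"
      using \<kappa>0(2) by (simp add: \<kappa>_def)
    then have "quo s (matrix_map M q d (\<kappa> b) i) = quo s (Z (a b) i)"
      using quo_coarsen that \<kappa>n Zn by blast
    then show ?thesis using coherent_quo[OF Zc that] by simp
  qed
  define \<delta> where "\<delta> = (\<lambda>b i. \<kappa> (Suc b) i \<ominus>\<^bsub>M\<^esub> \<kappa> b i)"
  have \<delta>p: "\<delta> b \<in> mvecs M q" for b
    using pow_nth[OF \<kappa>p] pow_zero[OF \<kappa>p] by (intro pow_memI) (auto simp: \<delta>_def a_minus_def)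
  have d\<delta>: "matrix_map M q d (\<delta> b) l = matrix_map M q d (\<kappa> (Suc b)) l \<ominus>\<^bsub>M\<^esub> matrix_map M q d (\<kappa> b) l" for b l
    unfolding \<delta>_def by (rule matrix_map_minus[OF dc \<kappa>p \<kappa>p])
  have "\<exists>y'. y' \<in> mvecs M q \<and> (\<forall>i. y' i \<in> filt b) \<and>
      matrix_map M q d y' = matrix_map M q d (\<delta> b)" for b
  proof (rule a0[OF \<delta>p])
    fix l
    have "quo (a0 b) (matrix_map M q d (\<kappa> (Suc b)) l) = quo (a0 b) (matrix_map M q d (\<kappa> b) l)"
      using \<kappa>[of "a0 b" b l] \<kappa>[of "a0 b" "Suc b" l] a(1,3)[of b] by simp
    then show "matrix_map M q d (\<delta> b) l \<in> filt (a0 b)"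
      unfolding d\<delta> using Q.cls_eq_iff \<kappa>n by blast
  qed
  then have "\<forall>b. \<exists>y'. y' \<in> mvecs M q \<and> (\<forall>i. y' i \<in> filt b) \<and>
      matrix_map M q d y' = matrix_map M q d (\<delta> b)" by (rule allI)
  from choice[OF this] obtain y where y: "\<And>b. y b \<in> mvecs M q"
    "\<And>b i. y b i \<in> filt b" "\<And>b. matrix_map M q d (y b) = matrix_map M q d (\<delta> b)" by blast
  \<comment> \<open>Partial sums of the small vectors \<open>y b\<close>: they converge, and \<open>d (Y b) = d (\<kappa> b)\<close> since the differences of the \<open>\<kappa> b\<close> telescope.\<close>
  define Y where "Y = rec_nat (\<kappa> 0) (\<lambda>b Yb i. Yb i \<oplus>\<^bsub>M\<^esub> y b i)"
  have Y0: "Y 0 = \<kappa> 0" and YS: "Y (Suc b) = (\<lambda>i. Y b i \<oplus>\<^bsub>M\<^esub> y b i)" for b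
    by (simp_all add: Y_def)
  interpret PM: module R "power_module q M" by (rule module_pow)
  have Yp: "Y b \<in> mvecs M q" for b
  proof (induction b)
    case 0 show ?case unfolding Y0 by (rule \<kappa>p)
  next
    case (Suc b) then show ?case unfolding YS using PM.M.a_closed[OF Suc y(1)] by simp
  qed
  have Yn: "Y b i \<in> carrier M" for b i using pow_nth[OF Yp] .
  have yn: "y b i \<in> carrier M" for b i using pow_nth[OF y(1)] .
  have dY: "matrix_map M q d (Y b) l = matrix_map M q d (\<kappa> b) l" for b l
  proof (induction b)
    case 0 then show ?case by (simp add: Y0)
  next
    case (Suc b)
    have "matrix_map M q d (Y (Suc b)) l = matrix_map M q d (Y b) l \<oplus>\<^bsub>M\<^esub> matrix_map M q d (y b) l"
      unfolding YS using matrix_map_add[OF dc Yp y(1)] by simp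
    also have "\<dots> = matrix_map M q d (\<kappa> b) l \<oplus>\<^bsub>M\<^esub>
        (matrix_map M q d (\<kappa> (Suc b)) l \<ominus>\<^bsub>M\<^esub> matrix_map M q d (\<kappa> b) l)"
      by (simp add: Suc y(3) d\<delta>)
    also have "\<dots> = matrix_map M q d (\<kappa> (Suc b)) l"
      using \<kappa>n[of b l] \<kappa>n[of "Suc b" l]
        M.a_lcomm[of "matrix_map M q d (\<kappa> b) l" "matrix_map M q d (\<kappa> (Suc b)) l"
          "\<ominus>\<^bsub>M\<^esub> matrix_map M q d (\<kappa> b) l"]
      by (simp add: a_minus_def M.r_neg)
    finally show ?case .
  qed
  have Yc: "coherent (\<lambda>b. Y b i)" for i
    unfolding coherent_def
  proof (intro conjI allI Yn)
    fix b
    have "quo b (y b i) = quo b \<zero>\<^bsub>M\<^esub>" using Q.cls_eq_zero_iff[OF yn] y(2) Q.cls_zero by simp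
    then have "quo b (Y b i \<oplus>\<^bsub>M\<^esub> y b i) = quo b (Y b i \<oplus>\<^bsub>M\<^esub> \<zero>\<^bsub>M\<^esub>)"
      using Yn yn by (intro quo_add_cong) auto
    then show "quo b (Y (Suc b) i) = quo b (Y b i)" using Yn by (simp add: YS)
  qed
  have "z = matrix_map Mhat q d (\<lambda>i. adic_lim (\<lambda>b. Y b i))"
  proof
    fix l
    have "adic_lim (\<lambda>s. Z s l) = adic_lim (\<lambda>b. matrix_map M q d (Y b) l)"
      unfolding lim_eq_iff dY using \<kappa>[OF a(2)] by simp
    then show "z l = matrix_map Mhat q d (\<lambda>i. adic_lim (\<lambda>b. Y b i)) l"
      using matrix_map_completion[OF dc Yc] zZ by simp
  qed
  also have "\<dots> \<in> tensor_span Mhat ?K"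
    using Yc by (intro H.matrix_map_in_tensor_span[OF d]) (auto simp: carrier_completion)
  finally show "z \<in> tensor_span Mhat ?K" .
qed

theorem proposition3p13:
  fixes R :: "('a, 'r) ring_scheme"
    and M :: "('a, 'b, 'm) module_scheme"
    and n :: nat
    and xs :: "'a list"
    and I :: "'a set"
  assumes "regular_local_ring R"
    and "complete_local_ring R"
    and "krull_dim R = enat n"
    and "minimal_generators R I xs"
    and "regular_sequence R xs"
    and "flat_module TYPE((nat \<Rightarrow> 'a) set) R M"
    and "projective_module TYPE(('b set \<Rightarrow> 'a set) set) (R Quot I) (reduction I M)"
  shows "flat_module TYPE('c) R (completion R I M)"
proof -
  have noeth: "noetherian_ring R" using assms(1) by (simp add: regular_local_ring_def)
  interpret module R M using assms(6) by (simp add: flat_module_def)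
  interpret matrix_module R M by unfold_locales
  have I: "ideal I R" using assms(4) R.genideal_ideal by (auto simp: minimal_generators_def)
  interpret adic_module R M I
    by (intro adic_module.intro adic_module_axioms.intro matrix_module_axioms I)
  show ?thesis
    by (rule flat_module_if_equationally_flat[OF module_completion
          completion_equationally_flat[OF assms(6) noeth I]])
qed

end
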